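(* Let $n,k\geq 2$. (a) If $n=k=2$ then the homomorphism $(\iota_2)_{\#2}\colon\pi_2(F_2(S^2))\to\pi_2(S^2\times S^2)$ is the anti-diagonal homomorphism that sends a generator of $\pi_2(F_2(S^2))$ to $(1,-1)$ or to $(-1,1)$ depending on the choice of orientation of $S^2$. (b) If $n\geq 2$ and $k\geq 3$ then $(\iota_n)_{\#k}\colon\pi_k(F_n(S^2))\to\pi_k(\prod_1^nS^2)$ is a diagonal homomorphism.
   Context: $F_n(S^2)$ is the $n$th configuration space of $S^2$ (pairwise distinct $n$-tuples), and $\iota_n\colon F_n(S^2)\to\prod_1^nS^2$ is the inclusion, with $(\iota_n)_{\#k}$ the induced homomorphism on $\pi_k$. In (a), $\pi_2(F_2(S^2))\cong\mathbb{Z}$, and $\pi_2(S^2\times S^2)=\pi_2(S^2)\times\pi_2(S^2)$ is identified with $\mathbb{Z}\times\mathbb{Z}$ using the same orientation of $S^2$ on both factors. Let $p_i\colon F_n(S^2)\to S^2$ denote projection onto the $i$th coordinate. "$(\iota_n)_{\#k}$ is diagonal" means that $(p_i)_{\#k}=(p_j)_{\#k}$ for all $1\le i<j\le n$ (the groups $\pi_k(S^2)$ at different basepoints being canonically identified). *)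

theory Defs
  imports "HOL-Analysis.Analysis" "HOL-Algebra.Elementary_Groups"
begin

section \<open>Homotopy groups\<close>

definition cube :: "nat \<Rightarrow> (nat \<Rightarrow> real) topology" where
  "cube k = product_topology (\<lambda>_. top_of_set {0..1}) {..<k}"

definition cube_boundary :: "nat \<Rightarrow> (nat \<Rightarrow> real) set" where
  "cube_boundary k = {t \<in> topspace (cube k). \<exists>i<k. t i = 0 \<or> t i = 1}"

text \<open>Maps of pairs from the cube and its boundary to a pointed space. They are made
  extensional, so that equality of functions is equality of maps on the cube.\<close>

definition cube_maps :: "nat \<Rightarrow> 'a topology \<Rightarrow> 'a \<Rightarrow> ((nat \<Rightarrow> real) \<Rightarrow> 'a) set" where
  "cube_maps k X x =
     {f \<in> extensional (topspace (cube k)).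
        continuous_map (cube k) X f \<and> (\<forall>t\<in>cube_boundary k. f t = x)}"

definition cube_homotopy_rel ::
  "nat \<Rightarrow> 'a topology \<Rightarrow> 'a \<Rightarrow> (((nat \<Rightarrow> real) \<Rightarrow> 'a) \<times> ((nat \<Rightarrow> real) \<Rightarrow> 'a)) set" where
  "cube_homotopy_rel k X x =
     {(f, g). f \<in> cube_maps k X x \<and> g \<in> cube_maps k X x \<and>
        homotopic_with (\<lambda>h. \<forall>t\<in>cube_boundary k. h t = x) (cube k) X f g}"

definition cube_concat ::
  "nat \<Rightarrow> ((nat \<Rightarrow> real) \<Rightarrow> 'a) \<Rightarrow> ((nat \<Rightarrow> real) \<Rightarrow> 'a) \<Rightarrow> (nat \<Rightarrow> real) \<Rightarrow> 'a" where
  "cube_concat k f g =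
     restrict (\<lambda>t. if t 0 \<le> 1/2 then f (t(0 := 2 * t 0)) else g (t(0 := 2 * t 0 - 1)))
       (topspace (cube k))"

text \<open>The group \<open>\<pi>\<^sub>k(X, x)\<close>, meaningful for \<open>k \<ge> 1\<close>. The union in the product
  runs over representatives, all of which yield the same class.\<close>

definition homotopy_group :: "nat \<Rightarrow> 'a topology \<Rightarrow> 'a \<Rightarrow> ((nat \<Rightarrow> real) \<Rightarrow> 'a) set monoid" where
  "homotopy_group k X x =
     \<lparr>carrier = cube_maps k X x // cube_homotopy_rel k X x,
      mult = (\<lambda>A B. \<Union>f\<in>A. \<Union>g\<in>B. cube_homotopy_rel k X x `` {cube_concat k f g}),
      one = cube_homotopy_rel k X x `` {restrict (\<lambda>_. x) (topspace (cube k))}\<rparr>"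

text \<open>The map from \<open>\<pi>\<^sub>k(X, x)\<close> to \<open>\<pi>\<^sub>k(Y, p x)\<close> induced by \<open>p\<close>. The source space
  enters only through the classes to which it is applied.\<close>

definition homotopy_induced ::
  "nat \<Rightarrow> 'b topology \<Rightarrow> ('a \<Rightarrow> 'b) \<Rightarrow> 'a \<Rightarrow> ((nat \<Rightarrow> real) \<Rightarrow> 'a) set \<Rightarrow> ((nat \<Rightarrow> real) \<Rightarrow> 'b) set" where
  "homotopy_induced k Y p x A =
     (\<Union>f\<in>A. cube_homotopy_rel k Y (p x) `` {restrict (p \<circ> f) (topspace (cube k))})"

text \<open>Change of basepoint along a path \<open>\<gamma>\<close>: the class at \<open>\<gamma> 0\<close> of \<open>f\<close> goes to the class at
  \<open>\<gamma> 1\<close> of those \<open>g\<close> that are joined to \<open>f\<close> by a free homotopy during which the whole boundary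
  of the cube runs along \<open>\<gamma>\<close>. In a simply connected space it depends only on the endpoints of
  \<open>\<gamma>\<close>, and it is then the canonical identification of the groups at the two basepoints.\<close>

definition basepoint_change ::
  "nat \<Rightarrow> 'a topology \<Rightarrow> (real \<Rightarrow> 'a) \<Rightarrow> ((nat \<Rightarrow> real) \<Rightarrow> 'a) set \<Rightarrow> ((nat \<Rightarrow> real) \<Rightarrow> 'a) set" where
  "basepoint_change k X \<gamma> A =
     {g \<in> cube_maps k X (\<gamma> 1). \<exists>f\<in>A. \<exists>h.
        continuous_map (prod_topology (top_of_set {0..1::real}) (cube k)) X h \<and>
        (\<forall>t\<in>topspace (cube k). h (0, t) = f t \<and> h (1, t) = g t) \<and>
        (\<forall>s\<in>{0..1}. \<forall>t\<in>cube_boundary k. h (s, t) = \<gamma> s)}"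

section \<open>Configuration spaces of the 2-sphere\<close>

abbreviation S2 :: "(real^3) topology" where
  "S2 \<equiv> top_of_set (sphere 0 1)"

definition power_space :: "nat \<Rightarrow> 'a topology \<Rightarrow> (nat \<Rightarrow> 'a) topology" where
  "power_space n X = product_topology (\<lambda>_. X) {1..n}"

definition config_space :: "nat \<Rightarrow> 'a topology \<Rightarrow> (nat \<Rightarrow> 'a) topology" where
  "config_space n X = subtopology (power_space n X) {x. inj_on x {1..n}}"

definition incl_induced ::
  "nat \<Rightarrow> nat \<Rightarrow> (nat \<Rightarrow> real^3) \<Rightarrow> ((nat \<Rightarrow> real) \<Rightarrow> nat \<Rightarrow> real^3) set \<Rightarrow>
   ((nat \<Rightarrow> real) \<Rightarrow> nat \<Rightarrow> real^3) set" where
  "incl_induced n k x = homotopy_induced k (power_space n S2) (\<lambda>y. y) x"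

text \<open>An orientation of the sphere, given by the identification of \<open>\<pi>\<^sub>2\<close> with the integers that
  it determines: an isomorphism at every basepoint, compatible with the canonical identifications
  of the groups at different basepoints. There are exactly two, differing by the sign.\<close>

definition S2_orientation :: "(real^3 \<Rightarrow> ((nat \<Rightarrow> real) \<Rightarrow> real^3) set \<Rightarrow> int) \<Rightarrow> bool" where
  "S2_orientation \<phi> \<longleftrightarrow>
     (\<forall>y\<in>topspace S2. \<phi> y \<in> iso (homotopy_group 2 S2 y) integer_group) \<and>
     (\<forall>\<gamma>. pathin S2 \<gamma> \<longrightarrow>
        (\<forall>A\<in>carrier (homotopy_group 2 S2 (\<gamma> 0)).
           \<phi> (\<gamma> 1) (basepoint_change 2 S2 \<gamma> A) = \<phi> (\<gamma> 0) A))"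

text \<open>The identification of \<open>\<pi>\<^sub>2\<close> of the product of two spheres, based at \<open>x\<close>, with pairs of
  integers: the two coordinate projections followed by the same orientation on both factors.\<close>

definition pi2_coords ::
  "(real^3 \<Rightarrow> ((nat \<Rightarrow> real) \<Rightarrow> real^3) set \<Rightarrow> int) \<Rightarrow> (nat \<Rightarrow> real^3) \<Rightarrow>
   ((nat \<Rightarrow> real) \<Rightarrow> nat \<Rightarrow> real^3) set \<Rightarrow> int \<times> int" where
  "pi2_coords \<phi> x c =
     (\<phi> (x 1) (homotopy_induced 2 S2 (\<lambda>y. y 1) x c),
      \<phi> (x 2) (homotopy_induced 2 S2 (\<lambda>y. y 2) x c))"

text \<open>The projections of the configuration space onto any two coordinates induce the same
  homomorphism, once the groups at the two basepoints are canonically identified.\<close>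

definition diagonal_incl_induced :: "nat \<Rightarrow> nat \<Rightarrow> (nat \<Rightarrow> real^3) \<Rightarrow> bool" where
  "diagonal_incl_induced n k x \<longleftrightarrow>
     (\<forall>i j \<gamma>. 1 \<le> i \<and> i < j \<and> j \<le> n \<and> pathin S2 \<gamma> \<and> \<gamma> 0 = x i \<and> \<gamma> 1 = x j \<longrightarrow>
        (\<forall>A\<in>carrier (homotopy_group k (config_space n S2) x).
           basepoint_change k S2 \<gamma> (homotopy_induced k S2 (\<lambda>y. y i) x A) =
           homotopy_induced k S2 (\<lambda>y. y j) x A))"

end

theory Submission
  imports Defs
begin

text \<open>Everything rests on one remark. Two coordinates \<open>f\<close>, \<open>g\<close> of a map from a cube into the
  configuration space never agree, so \<open>f t\<close> and \<open>- g t\<close> are never antipodal and \<open>f\<close> is freely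
  homotopic to the antipode of \<open>g\<close> (\<open>antipodal_homotopy_of_disjoint\<close>). The theorem is therefore
  a statement about the antipode of the 2-sphere: it acts as \<open>-1\<close> on the second homotopy group and
  trivially on all higher ones.

  Both facts come from the Hopf map of the 3-sphere, the unit sphere of \<open>complex \<times> complex\<close>. Its
  fibres are the circles of unit multiples, and the antipode is covered by a map \<open>conj_swap\<close> that
  is homotopic to the identity and conjugates these multiples. Maps of cubes lift through the Hopf
  map (\<open>hopf_lift_along_interval\<close>), and a lift can be kept constant on all faces but one. On
  that face it moves within one fibre, and the angle of this motion is a new map of a cube of one
  dimension less.

  In dimension 2 the angle at the end of the face is an integer, the degree. It does not change
  under free homotopies (\<open>degree_family\<close>) and classifies maps up to homotopy, since maps
  into the 3-sphere extend from closed subsets of a 3-cube to all of it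
  (\<open>equal_degree_homotopic\<close>). The covering map \<open>conj_swap\<close> reverses the sign of the angle, so
  the antipode has degree \<open>-1\<close>. The first projection of the configuration space of two points has
  a section (\<open>config_section\<close>) and contractible fibres (\<open>pair_maps_homotopic\<close>), so its second
  homotopy group is infinite cyclic as well (\<open>pair_degree_iso\<close>), and the two coordinates of a
  generator have opposite degrees 1 and \<open>-1\<close>. An orientation of the sphere is the degree up to one
  global sign (\<open>S2_orientation_sign\<close>).

  From dimension 3 on the integer vanishes, and the lift can be made constant on the whole
  boundary (\<open>constant_boundary_lift\<close>). The homotopy from the identity to \<open>conj_swap\<close> then
  projects to a free homotopy from \<open>f\<close> to its antipode (\<open>homotopic_to_antipode\<close>).

  Free homotopies have to be compared with the canonical identification of the groups at
  different basepoints. A lift of the path of basepoints to the 3-sphere gives a path of rotations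
  that follows the basepoint, and composition with it turns a free homotopy into a based one
  (\<open>straighten_homotopy\<close>, \<open>basepoint_change_S2\<close>).\<close>

section \<open>Homotopy lifting\<close>

text \<open>Homotopy lifting in the only form used below. The map \<open>h\<close> from \<open>E\<close> to \<open>B\<close> comes with a
  continuous rule \<open>T\<close> that moves a point of \<open>E\<close> into the fibre over any sufficiently close point
  of \<open>B\<close>, and does not move it when it already lies there. By compactness finitely many short
  moves cover the unit interval. Since \<open>T\<close> does not move points without need, the lift stands
  still over every \<open>x\<close> at which \<open>f\<close> stands still; this gives the lifting property relative to
  the boundary of a cube without any extra work.\<close>

lemma lift_along_interval:
  fixes f :: "'a::metric_space \<times> real \<Rightarrow> 'b::metric_space"
    and T :: "'b \<Rightarrow> 'e::topological_space \<Rightarrow> 'e" and h :: "'e \<Rightarrow> 'b"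
  assumes K: "compact K"
    and contf: "continuous_on (K \<times> {0..1}) f" and fim: "\<And>z. z \<in> K \<times> {0..1} \<Longrightarrow> f z \<in> B"
    and contF0: "continuous_on K init" and F0E: "\<And>x. x \<in> K \<Longrightarrow> init x \<in> E"
    and F0h: "\<And>x. x \<in> K \<Longrightarrow> h (init x) = f (x, 0)"
    and delta: "0 < \<delta>"
    and contT: "continuous_on {(b, e). b \<in> B \<and> e \<in> E \<and> dist (h e) b < \<delta>} (\<lambda>(b, e). T b e)"
    and TE: "\<And>b e. b \<in> B \<Longrightarrow> e \<in> E \<Longrightarrow> dist (h e) b < \<delta> \<Longrightarrow> T b e \<in> E"
    and Th: "\<And>b e. b \<in> B \<Longrightarrow> e \<in> E \<Longrightarrow> dist (h e) b < \<delta> \<Longrightarrow> h (T b e) = b"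
    and T_id: "\<And>e. e \<in> E \<Longrightarrow> T (h e) e = e"
  obtains F where "continuous_on (K \<times> {0..1}) F" "\<And>z. z \<in> K \<times> {0..1} \<Longrightarrow> F z \<in> E"
    "\<And>z. z \<in> K \<times> {0..1} \<Longrightarrow> h (F z) = f z" "\<And>x. x \<in> K \<Longrightarrow> F (x, 0) = init x"
    "\<And>x c s. x \<in> K \<Longrightarrow> (\<And>s. s \<in> {0..1} \<Longrightarrow> f (x, s) = c) \<Longrightarrow> s \<in> {0..1} \<Longrightarrow> F (x, s) = init x"
proof -
  have "uniformly_continuous_on (K \<times> {0..1}) f"
    by (intro compact_uniformly_continuous contf compact_Times K) auto
  then obtain \<eta> where \<eta>: "\<eta> > 0"
    and unif: "\<And>z z'. z \<in> K \<times> {0..1} \<Longrightarrow> z' \<in> K \<times> {0..1} \<Longrightarrow> dist z' z < \<eta> \<Longrightarrow> dist (f z') (f z) < \<delta>"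
    using delta unfolding uniformly_continuous_on_def by metis
  obtain N :: nat where N: "N > 0" "1 / real N < \<eta>"
    using real_arch_inverse[of \<eta>] \<eta> by (auto simp: inverse_eq_divide)
  define good where "good m F \<longleftrightarrow> continuous_on (K \<times> {0..real m / real N}) F \<and>
      (\<forall>z\<in>K \<times> {0..real m / real N}. F z \<in> E \<and> h (F z) = f z) \<and> (\<forall>x\<in>K. F (x, 0) = init x) \<and>
      (\<forall>x\<in>K. \<forall>c. (\<forall>s\<in>{0..1}. f (x, s) = c) \<longrightarrow> (\<forall>s\<in>{0..real m / real N}. F (x, s) = init x))"
    for m :: nat and F :: "'a \<times> real \<Rightarrow> 'e"
  have "\<exists>F. good m F" if "m \<le> N" for m
    using that
  proof (induction m)
    case 0
    have "continuous_on (K \<times> {0..0::real}) (\<lambda>z. init (fst z))"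
      by (intro continuous_on_compose2[OF contF0] continuous_intros) auto
    then have "good 0 (\<lambda>z. init (fst z))"
      using F0E F0h by (auto simp: good_def)
    then show ?case by (rule exI[where P="good 0"])
  next
    case (Suc m)
    then have "\<exists>F. good m F" by simp
    then obtain F where F: "good m F" by (rule exE)
    define a b where a_def: "a = real m / real N" and b_def: "b = real (Suc m) / real N"
    have ab: "0 \<le> a" "a \<le> b" "b \<le> 1" "b - a < \<eta>" "a \<le> 1"
      using Suc.prems N by (auto simp: a_def b_def field_simps)
    have contF: "continuous_on (K \<times> {0..a}) F" and FE: "\<And>z. z \<in> K \<times> {0..a} \<Longrightarrow> F z \<in> E"
      and Fh: "\<And>z. z \<in> K \<times> {0..a} \<Longrightarrow> h (F z) = f z" and F_0: "\<And>x. x \<in> K \<Longrightarrow> F (x, 0) = init x"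
      and F_c: "\<And>x c s. x \<in> K \<Longrightarrow> \<forall>s\<in>{0..1}. f (x, s) = c \<Longrightarrow> s \<in> {0..a} \<Longrightarrow> F (x, s) = init x"
      using F by (auto simp: good_def a_def)
    \<comment> \<open>On the next subinterval the end value of the lift is transported over \<open>f z\<close>; this is possible because \<open>f\<close> has moved by less than \<open>\<delta>\<close>.\<close>
    define G where "G z = T (f z) (F (fst z, a))" for z
    have close: "f z \<in> B \<and> F (fst z, a) \<in> E \<and> dist (h (F (fst z, a))) (f z) < \<delta>"
      if "z \<in> K \<times> {a..b}" for z
    proof -
      have "dist (fst z, a) z < \<eta>"
        using that ab by (cases z) (auto simp: dist_Pair_Pair dist_real_def)
      then have "dist (f (fst z, a)) (f z) < \<delta>"
        using that ab by (intro unif) (auto)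
      moreover have "z \<in> K \<times> {0..1}" using that ab by auto
      ultimately show ?thesis
        using that ab Fh[of "(fst z, a)"] FE[of "(fst z, a)"] fim[of z] by auto
    qed
    have contG: "continuous_on (K \<times> {a..b}) G"
    proof -
      have "continuous_on (K \<times> {a..b}) (\<lambda>z. (f z, F (fst z, a)))"
        using ab by (intro continuous_on_Pair continuous_on_subset[OF contf]
            continuous_on_compose2[OF contF] continuous_intros) auto
      from continuous_on_compose2[OF contT this] close show ?thesis
        by (simp add: G_def split_def image_subset_iff)
    qed
    define F' where "F' z = (if snd z \<le> a then F z else G z)" for z
    have seam: "G z = F z" if "z \<in> K \<times> {a}" for z
    proof -
      have zz: "(fst z, a) = z" and zK: "z \<in> K \<times> {0..a}" using that ab by auto
      show ?thesis
        using T_id[OF FE[OF zK]] Fh[OF zK] by (simp add: G_def zz)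
    qed
    have 1: "continuous_on (K \<times> {0..b}) F'"
    proof -
      have eq: "K \<times> {0..b} = K \<times> {0..a} \<union> K \<times> {a..b}" using ab by auto
      have cl: "closed (K \<times> {0..a})" "closed (K \<times> {a..b})"
        using compact_imp_closed[OF K] by (auto intro!: closed_Times)
      have "continuous_on (K \<times> {0..a} \<union> K \<times> {a..b}) F'"
        unfolding F'_def
        by (rule continuous_on_If[OF cl contF contG]) (use ab seam in auto)
      then show ?thesis by (simp add: eq)
    qed
    have 2: "F' z \<in> E \<and> h (F' z) = f z" if z: "z \<in> K \<times> {0..b}" for z
    proof (cases "snd z \<le> a")
      case True
      then show ?thesis using FE[of z] Fh[of z] z by (auto simp: F'_def)
    next
      case False
      then have "z \<in> K \<times> {a..b}" using z by auto
      from close[OF this] False TE Th show ?thesis by (auto simp: F'_def G_def)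
    qed
    have 3: "F' (x, 0) = init x" if "x \<in> K" for x
      using that F_0 ab by (auto simp: F'_def)
    have 4: "F' (x, s) = init x"
      if x: "x \<in> K" and c: "\<forall>s\<in>{0..1}. f (x, s) = c" and s: "s \<in> {0..b}" for x s c
    proof (cases "s \<le> a")
      case True
      then show ?thesis using F_c[OF x c, of s] s by (auto simp: F'_def)
    next
      case False
      have "F (x, a) = init x" using F_c[OF x c, of a] ab by auto
      moreover have "f (x, s) = h (init x)" using c s ab F0h[OF x] by auto
      ultimately show ?thesis using False T_id[OF F0E[OF x]] by (auto simp: F'_def G_def)
    qed
    have "good (Suc m) F'"
      unfolding good_def b_def[symmetric] using 1 2 3 4 by (intro conjI ballI allI impI) simp_all
    then show ?case by (rule exI[where P="good (Suc m)"])
  qed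
  from this[of N] obtain F where "good N F" by auto
  moreover have "real N / real N = 1" using N by simp
  ultimately show ?thesis
    by (intro that[of F]) (auto simp: good_def)
qed

lemma cis_2pi_eq_1_iff: "cis (2 * pi * x) = 1 \<longleftrightarrow> x \<in> \<int>"
proof -
  have "cis (2 * pi * x) = exp (\<i> * of_real (2 * pi * x))" by (rule cis_conv_exp)
  also have "\<dots> = 1 \<longleftrightarrow> (\<exists>n::int. 2 * pi * x = of_int (2 * n) * pi)"
    unfolding exp_eq_1 by simp
  also have "\<dots> \<longleftrightarrow> (\<exists>n::int. x = of_int n)"
    by (intro ex_cong1) auto
  finally show ?thesis by (auto simp: Ints_def)
qed

lemma continuous_Ints_constant:
  fixes f :: "'a::topological_space \<Rightarrow> real"
  assumes "connected S" "continuous_on S f" "\<And>x. x \<in> S \<Longrightarrow> f x \<in> \<int>" "x \<in> S" "y \<in> S"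
  shows "f x = f y"
proof -
  have "f constant_on S"
  proof (rule continuous_discrete_range_constant[OF assms(1,2)])
    fix x assume x: "x \<in> S"
    have "1 \<le> norm (f y - f x)" if "y \<in> S" "f y \<noteq> f x" for y
      using that x assms(3) Ints_nonzero_abs_ge1[of "f y - f x"] by auto
    then show "\<exists>e>0. \<forall>y. y \<in> S \<and> f y \<noteq> f x \<longrightarrow> e \<le> norm (f y - f x)"
      by (intro exI[of _ 1]) auto
  qed
  then show ?thesis using assms unfolding constant_on_def by metis
qed

text \<open>The instance for the universal cover of the circle: near \<open>cis (2 * pi * \<theta>)\<close> the
  principal logarithm of the quotient corrects \<open>\<theta>\<close>.\<close>

lemma log_lift_along_interval:
  fixes u :: "'a::metric_space \<times> real \<Rightarrow> complex"
  assumes K: "compact K"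
    and contu: "continuous_on (K \<times> {0..1}) u" and uim: "\<And>z. z \<in> K \<times> {0..1} \<Longrightarrow> norm (u z) = 1"
    and u0: "\<And>x. x \<in> K \<Longrightarrow> u (x, 0) = 1"
  obtains \<theta> where "continuous_on (K \<times> {0..1}) \<theta>"
    "\<And>z. z \<in> K \<times> {0..1} \<Longrightarrow> cis (2 * pi * \<theta> z) = u z" "\<And>x. x \<in> K \<Longrightarrow> \<theta> (x, 0) = 0"
    "\<And>x s. x \<in> K \<Longrightarrow> (\<And>s. s \<in> {0..1} \<Longrightarrow> u (x, s) = 1) \<Longrightarrow> s \<in> {0..1} \<Longrightarrow> \<theta> (x, s) = 0"
proof -
  let ?h = "\<lambda>\<theta>::real. cis (2 * pi * \<theta>)"
  let ?T = "\<lambda>(b::complex) \<theta>. \<theta> + Im (Ln (b * cis (- (2 * pi * \<theta>)))) / (2 * pi)"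
  \<comment> \<open>The quotient of two points of the circle at distance less than 1 has positive real part.\<close>
  have ne: "b * cis (- (2 * pi * \<theta>)) \<notin> \<real>\<^sub>\<le>\<^sub>0"
    if "b \<in> sphere 0 1" "dist (?h \<theta>) b < 1" for b \<theta>
  proof -
    let ?c = "b * cis (- (2 * pi * \<theta>))"
    have "norm (?c - 1) = norm ((b - ?h \<theta>) * cis (- (2 * pi * \<theta>)))"
      by (simp add: algebra_simps cis_mult)
    also have "\<dots> = dist (?h \<theta>) b"
      by (simp add: norm_mult dist_norm norm_minus_commute)
    finally have "norm (?c - 1) < 1" using that by simp
    then have "\<bar>Re ?c - 1\<bar> < 1"
      using abs_Re_le_cmod[of "?c - 1"] by (simp del: cis.sel)
    then show ?thesis by (auto simp: complex_nonpos_Reals_iff)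
  qed
  have hT: "?h (?T b \<theta>) = b" if b: "b \<in> sphere 0 1" and d: "dist (?h \<theta>) b < 1" for b \<theta>
  proof -
    let ?c = "b * cis (- (2 * pi * \<theta>))"
    have c0: "?c \<noteq> 0" and c1: "norm ?c = 1" using b by (auto simp: norm_mult)
    have "?h (?T b \<theta>) = ?h \<theta> * cis (Im (Ln ?c))"
      by (simp add: cis_mult distrib_left)
    also have "cis (Im (Ln ?c)) = ?c"
      using exp_eq_polar[of "Ln ?c"] exp_Ln[OF c0] Re_Ln[OF c0] unfolding c1 by simp
    finally show ?thesis by (simp add: cis_mult mult.left_commute)
  qed
  have contT: "continuous_on {(b, e). b \<in> sphere 0 1 \<and> e \<in> UNIV \<and> dist (?h e) b < 1} (\<lambda>(b, e). ?T b e)"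
    unfolding split_def
    by (intro continuous_intros) (use ne in auto)
  show ?thesis
  proof (rule lift_along_interval[where K=K and f=u and B="sphere 0 1" and E=UNIV and h="?h" and T="?T"
        and init="\<lambda>_. 0" and \<delta>=1, OF K contu])
    fix F assume F: "continuous_on (K \<times> {0..1}) F"
      "\<And>z. z \<in> K \<times> {0..1} \<Longrightarrow> cis (2 * pi * F z) = u z" "\<And>x. x \<in> K \<Longrightarrow> F (x, 0) = 0"
      "\<And>x c s. x \<in> K \<Longrightarrow> (\<And>s. s \<in> {0..1} \<Longrightarrow> u (x, s) = c) \<Longrightarrow> s \<in> {0..1} \<Longrightarrow> F (x, s) = 0"
    show thesis by (rule that[OF F])
  next
    show "u z \<in> sphere 0 1" if "z \<in> K \<times> {0..1}" for z using uim[OF that] by simp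
    show "cis (2 * pi * 0) = u (x, 0)" if "x \<in> K" for x using u0[OF that] by simp
    show "?h (?T b e) = b" if "b \<in> sphere 0 1" "dist (?h e) b < 1" for b e
      using that by (rule hT)
    show "?T (?h e) e = e" for e :: real by (simp add: cis_mult)
  qed (rule contT continuous_on_const UNIV_I zero_less_one)+
qed

section \<open>The Hopf map\<close>

text \<open>The unit sphere of \<open>complex \<times> complex\<close> is the 3-sphere. The matrix \<open>F F\<^sup>*\<close> of the
  projection onto the line spanned by a unit vector \<open>F\<close> equals
  \<open>(1 + b \<bullet> \<sigma>) / 2\<close>, where \<open>\<sigma>\<close> is the vector of the Pauli matrices and \<open>b = hopf F\<close>.\<close>

definition hopf :: "complex \<times> complex \<Rightarrow> real^3" where
  "hopf F = vector [2 * Re (fst F * cnj (snd F)), - 2 * Im (fst F * cnj (snd F)),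
     (cmod (fst F))\<^sup>2 - (cmod (snd F))\<^sup>2]"

definition phase :: "complex \<Rightarrow> complex \<times> complex \<Rightarrow> complex \<times> complex" where
  "phase c F = (c * fst F, c * snd F)"

definition hermitian :: "complex \<times> complex \<Rightarrow> complex \<times> complex \<Rightarrow> complex" where
  "hermitian F G = fst F * cnj (fst G) + snd F * cnj (snd G)"

text \<open>Multiplication by the quaternion unit that anticommutes with the complex scalars. It covers
  the antipode of the 2-sphere and reverses the direction of the Hopf fibres.\<close>

definition conj_swap :: "complex \<times> complex \<Rightarrow> complex \<times> complex" where
  "conj_swap F = (- cnj (snd F), cnj (fst F))"

text \<open>Twice the orthogonal projection onto the complex line that corresponds to a unit vector
  \<open>b\<close>, that is, the matrix \<open>1 + b \<bullet> \<sigma>\<close>. Projecting to a nearby line and normalising is the local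
  transport for the Hopf map.\<close>

definition line_proj :: "real^3 \<Rightarrow> complex \<times> complex \<Rightarrow> complex \<times> complex" where
  "line_proj b F =
     (of_real (1 + b$3) * fst F + Complex (b$1) (- (b$2)) * snd F,
      Complex (b$1) (b$2) * fst F + of_real (1 - b$3) * snd F)"

lemma norm3_sq: "(norm (v :: real^3))\<^sup>2 = (v$1)\<^sup>2 + (v$2)\<^sup>2 + (v$3)\<^sup>2"
  unfolding power2_norm_eq_inner by (simp add: inner_vec_def sum_3 power2_eq_square)

lemma norm_C2_sq: "(norm (F :: complex \<times> complex))\<^sup>2 = (cmod (fst F))\<^sup>2 + (cmod (snd F))\<^sup>2"
  by (simp add: norm_prod_def)

lemma hopf_simps [simp]:
  "hopf F $ 1 = 2 * Re (fst F * cnj (snd F))" "hopf F $ 2 = - 2 * Im (fst F * cnj (snd F))"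
  "hopf F $ 3 = (cmod (fst F))\<^sup>2 - (cmod (snd F))\<^sup>2"
  by (simp_all add: hopf_def)

lemma norm_phase [simp]: "norm (phase c F) = cmod c * norm F"
proof (rule power2_eq_imp_eq)
  show "(norm (phase c F))\<^sup>2 = (cmod c * norm F)\<^sup>2"
    unfolding power_mult_distrib norm_C2_sq
    by (simp add: phase_def norm_mult power_mult_distrib algebra_simps)
qed auto

lemma phase_phase [simp]: "phase c (phase d F) = phase (c * d) F"
  by (simp add: phase_def mult.assoc)

lemma phase_1 [simp]: "phase 1 F = F"
  by (simp add: phase_def)

lemma hopf_phase: "hopf (phase c F) = (cmod c)\<^sup>2 *\<^sub>R hopf F"
proof -
  have "fst (phase c F) * cnj (snd (phase c F)) = of_real ((cmod c)\<^sup>2) * (fst F * cnj (snd F))"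
    unfolding complex_norm_square by (simp add: phase_def)
  moreover have "cmod (fst (phase c F)) = cmod c * cmod (fst F)" "cmod (snd (phase c F)) = cmod c * cmod (snd F)"
    by (simp_all add: phase_def norm_mult)
  ultimately show ?thesis
    unfolding vec_eq_iff forall_3 hopf_simps vector_scaleR_component Re_complex_of_real Im_complex_of_real
    by (simp add: power_mult_distrib right_diff_distrib)
qed

lemma norm_hopf: "norm (hopf F) = (norm F)\<^sup>2"
proof (rule power2_eq_imp_eq)
  obtain a b c d where F: "F = (Complex a b, Complex c d)"
    by (metis complex_surj prod.collapse)
  show "(norm (hopf F))\<^sup>2 = ((norm F)\<^sup>2)\<^sup>2"
    unfolding norm3_sq norm_C2_sq by (simp add: F cmod_power2) algebra
qed auto

lemma hopf_in_sphere: "F \<in> sphere 0 1 \<Longrightarrow> hopf F \<in> sphere 0 1"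
  by (simp add: norm_hopf)

lemma continuous_on_hopf [continuous_intros]:
  assumes "continuous_on S f" shows "continuous_on S (\<lambda>x. hopf (f x))"
proof -
  have "continuous_on S (\<lambda>x. hopf (f x) $ i)" for i
    using exhaust_3[of i] by (elim disjE; simp only: hopf_simps) (intro continuous_intros assms)+
  then show ?thesis
    using continuous_on_vec_lambda[where f="\<lambda>i x. hopf (f x) $ i" and S=S] by simp
qed

lemma continuous_on_phase [continuous_intros]:
  "continuous_on S c \<Longrightarrow> continuous_on S f \<Longrightarrow> continuous_on S (\<lambda>x. phase (c x) (f x))"
  unfolding phase_def by (intro continuous_intros)

lemma continuous_on_hermitian [continuous_intros]:
  "continuous_on S f \<Longrightarrow> continuous_on S g \<Longrightarrow> continuous_on S (\<lambda>x. hermitian (f x) (g x))"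
  unfolding hermitian_def by (intro continuous_intros)

lemma continuous_on_conj_swap [continuous_intros]:
  "continuous_on S f \<Longrightarrow> continuous_on S (\<lambda>x. conj_swap (f x))"
  unfolding conj_swap_def by (intro continuous_intros)

lemma continuous_on_line_proj [continuous_intros]:
  "continuous_on S b \<Longrightarrow> continuous_on S f \<Longrightarrow> continuous_on S (\<lambda>x. line_proj (b x) (f x))"
  unfolding line_proj_def by (intro continuous_intros continuous_on_component)

lemma hermitian_self: "hermitian F F = of_real ((norm F)\<^sup>2)"
  unfolding norm_C2_sq hermitian_def of_real_add complex_norm_square ..

lemma line_proj_hopf:
  assumes "norm F = 1" shows "line_proj (hopf F) G = phase (2 * hermitian G F) F"
proof -
  obtain z w where F: "F = (z, w)" by (cases F)
  have n: "(cmod z)\<^sup>2 + (cmod w)\<^sup>2 = 1"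
    using norm_C2_sq[of F] assms by (simp add: F)
  have "1 + hopf F $ 3 = 2 * (cmod z)\<^sup>2" "1 - hopf F $ 3 = 2 * (cmod w)\<^sup>2"
    using n by (auto simp: F)
  then have 1: "complex_of_real (1 + hopf F $ 3) = 2 * (z * cnj z)"
    "complex_of_real (1 - hopf F $ 3) = 2 * (w * cnj w)"
    by (simp_all only: complex_norm_square of_real_mult of_real_numeral)
  have 2: "Complex (hopf F $ 1) (- (hopf F $ 2)) = 2 * (z * cnj w)"
    "Complex (hopf F $ 1) (hopf F $ 2) = 2 * (cnj z * w)"
    by (simp_all add: F complex_eq_iff)
  show ?thesis
    unfolding line_proj_def phase_def hermitian_def 1 2
    by (simp add: F algebra_simps)
qed

lemma norm_line_proj:
  assumes "norm b = 1"
  shows "(norm (line_proj b F))\<^sup>2 = 2 * ((norm F)\<^sup>2 + b \<bullet> hopf F)"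
proof -
  obtain x y z w where F: "F = (Complex x y, Complex z w)"
    by (metis complex_surj prod.collapse)
  obtain p q r where pqr: "b$1 = p" "b$2 = q" "b$3 = r" by auto
  have "p\<^sup>2 + q\<^sup>2 + r\<^sup>2 = 1"
    using norm3_sq[of b] assms pqr by simp
  then have "p\<^sup>2 = 1 - q\<^sup>2 - r\<^sup>2" by simp
  then show ?thesis
    unfolding norm_C2_sq inner_vec_def sum_3 hopf_simps inner_real_def
    by (simp add: F pqr line_proj_def cmod_power2) algebra
qed

lemma hopf_line_proj:
  assumes "norm b = 1"
  shows "hopf (line_proj b F) = (norm (line_proj b F))\<^sup>2 *\<^sub>R b"
proof -
  obtain x y z w where F: "F = (Complex x y, Complex z w)"
    by (metis complex_surj prod.collapse)
  obtain p q r where pqr: "b$1 = p" "b$2 = q" "b$3 = r" by auto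
  have "p\<^sup>2 + q\<^sup>2 + r\<^sup>2 = 1"
    using norm3_sq[of b] assms pqr by simp
  then have "p\<^sup>2 = 1 - q\<^sup>2 - r\<^sup>2" by simp
  then show ?thesis
    unfolding norm_C2_sq vec_eq_iff forall_3 hopf_simps vector_scaleR_component
    by (simp add: F pqr line_proj_def cmod_power2; algebra)
qed

lemma hopf_conj_swap: "hopf (conj_swap F) = - hopf F"
  unfolding vec_eq_iff forall_3 by (simp add: conj_swap_def)

lemma norm_conj_swap [simp]: "norm (conj_swap F) = norm F"
  by (simp add: conj_swap_def norm_prod_def add.commute)

lemma conj_swap_phase: "conj_swap (phase c F) = phase (cnj c) (conj_swap F)"
  by (simp add: conj_swap_def phase_def)

text \<open>\<open>F\<close> and \<open>conj_swap F\<close> are orthogonal for the Hermitian form.\<close>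

lemma norm_add_conj_swap:
  "(norm (phase c F + phase d (conj_swap F)))\<^sup>2 = ((cmod c)\<^sup>2 + (cmod d)\<^sup>2) * (norm F)\<^sup>2"
proof -
  obtain x y z w where F: "F = (Complex x y, Complex z w)"
    by (metis complex_surj prod.collapse)
  show ?thesis
    unfolding norm_C2_sq F cmod_power2
    by (simp add: phase_def conj_swap_def) algebra
qed

text \<open>Both vectors span the line onto which \<open>line_proj\<close> of their common image projects.\<close>

lemma same_fibre:
  assumes "norm F = 1" "norm G = 1" "hopf F = hopf G"
  shows "G = phase (hermitian G F) F" "cmod (hermitian G F) = 1"
proof -
  have "phase (2 * hermitian G F) F = phase 2 G"
    using line_proj_hopf[OF assms(1), of G] line_proj_hopf[OF assms(2), of G] assms
    by (simp add: hermitian_self)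
  then show G: "G = phase (hermitian G F) F"
    by (auto simp: phase_def prod_eq_iff)
  show "cmod (hermitian G F) = 1"
    using arg_cong[OF G, of norm] assms by simp
qed

lemma phase_cancel:
  assumes "F \<noteq> 0" "phase c F = phase d F" shows "c = d"
  using assms by (auto simp: phase_def prod_eq_iff zero_prod_def)

lemma hopf_surj:
  assumes "norm b = 1" obtains F where "norm F = 1" "hopf F = b"
proof -
  obtain F where F: "line_proj b F \<noteq> 0"
  proof (cases "b $ 3 = -1")
    case True
    then have "line_proj b (0, 1) \<noteq> 0" by (simp add: line_proj_def zero_prod_def)
    then show thesis by (rule that)
  next
    case False
    then have "1 + complex_of_real (b $ 3) \<noteq> 0"
      by (simp add: complex_eq_iff) 
    then have "line_proj b (1, 0) \<noteq> 0" by (simp add: line_proj_def zero_prod_def)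
    then show thesis by (rule that)
  qed
  let ?G = "phase (of_real (inverse (norm (line_proj b F)))) (line_proj b F)"
  have "norm ?G = 1" using F by (simp add: norm_inverse)
  moreover have "hopf ?G = b"
    using F by (simp add: hopf_phase hopf_line_proj[OF assms] norm_inverse power_inverse)
  ultimately show thesis by (rule that)
qed

definition hopf_transport :: "real^3 \<Rightarrow> complex \<times> complex \<Rightarrow> complex \<times> complex" where
  "hopf_transport b F = phase (of_real (inverse (norm (line_proj b F)))) (line_proj b F)"

text \<open>The projection of a unit vector vanishes only on the line of the antipodal point, and that
  point has distance 2.\<close>

lemma line_proj_nonzero:
  assumes "norm b = 1" "norm F = 1" "dist (hopf F) b < 1" shows "line_proj b F \<noteq> 0"
proof
  assume "line_proj b F = 0"
  then have "b \<bullet> hopf F = - 1" using norm_line_proj[OF assms(1), of F] assms by simp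
  moreover have "(dist (hopf F) b)\<^sup>2 = 1 + 1 - 2 * (b \<bullet> hopf F)"
    unfolding dist_norm using dot_norm_neg[of b "hopf F"] assms
    by (simp add: norm_hopf norm_minus_commute)
  ultimately have "(dist (hopf F) b)\<^sup>2 = 4" by simp
  moreover have "(dist (hopf F) b)\<^sup>2 \<le> 1\<^sup>2"
    using assms by (intro power_mono) auto
  ultimately show False by simp
qed

lemma hopf_lift_along_interval:
  fixes f :: "'a::metric_space \<times> real \<Rightarrow> real^3"
  assumes K: "compact K"
    and contf: "continuous_on (K \<times> {0..1}) f" and fim: "\<And>z. z \<in> K \<times> {0..1} \<Longrightarrow> f z \<in> sphere 0 1"
    and conti: "continuous_on K init" and init: "\<And>x. x \<in> K \<Longrightarrow> init x \<in> sphere 0 1"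
    and h: "\<And>x. x \<in> K \<Longrightarrow> hopf (init x) = f (x, 0)"
  obtains F where "continuous_on (K \<times> {0..1}) F" "\<And>z. z \<in> K \<times> {0..1} \<Longrightarrow> F z \<in> sphere 0 1"
    "\<And>z. z \<in> K \<times> {0..1} \<Longrightarrow> hopf (F z) = f z" "\<And>x. x \<in> K \<Longrightarrow> F (x, 0) = init x"
    "\<And>x c s. x \<in> K \<Longrightarrow> (\<And>s. s \<in> {0..1} \<Longrightarrow> f (x, s) = c) \<Longrightarrow> s \<in> {0..1} \<Longrightarrow> F (x, s) = init x"
proof (rule lift_along_interval[where K=K and f=f and B="sphere 0 1" and E="sphere 0 1" and h=hopf
      and T=hopf_transport and init=init and \<delta>=1, OF K contf fim conti init h])
  show "continuous_on {(b, e). b \<in> sphere 0 1 \<and> e \<in> sphere 0 1 \<and> dist (hopf e) b < 1}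
     (\<lambda>(b, e). hopf_transport b e)"
    unfolding hopf_transport_def split_def
    by (intro continuous_intros) (auto simp: line_proj_nonzero)
  fix b :: "real^3" and e :: "complex \<times> complex"
  show "hopf_transport (hopf e) e = e" if "e \<in> sphere 0 1"
    using that by (simp add: hopf_transport_def line_proj_hopf hermitian_self)
  assume be: "b \<in> sphere 0 1" "e \<in> sphere 0 1" "dist (hopf e) b < 1"
  then have nz: "line_proj b e \<noteq> 0" by (intro line_proj_nonzero) auto
  show "hopf_transport b e \<in> sphere 0 1"
    using nz by (simp add: hopf_transport_def norm_inverse)
  show "hopf (hopf_transport b e) = b"
    using nz be by (simp add: hopf_transport_def hopf_phase hopf_line_proj norm_inverse power_inverse)
qed (use that in auto)

lemma hopf_path_lift:
  assumes cont: "continuous_on {0..1::real} \<gamma>" and \<gamma>: "\<And>s. s \<in> {0..1} \<Longrightarrow> norm (\<gamma> s) = 1"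
    and p: "norm p = 1" "hopf p = \<gamma> 0"
  obtains \<Gamma> where "continuous_on {0..1} \<Gamma>" "\<forall>s\<in>{0..1}. norm (\<Gamma> s) = 1"
    "\<forall>s\<in>{0..1}. hopf (\<Gamma> s) = \<gamma> s" "\<Gamma> 0 = p"
proof (rule hopf_lift_along_interval[where K="{0::real}" and f="\<lambda>z. \<gamma> (snd z)" and init="\<lambda>_. p"])
  show "continuous_on ({0} \<times> {0..1}) (\<lambda>z. \<gamma> (snd z))"
    by (intro continuous_on_compose2[OF cont] continuous_intros) auto
  fix F assume F: "continuous_on ({0::real} \<times> {0..1::real}) F" "\<And>z. z \<in> {0} \<times> {0..1} \<Longrightarrow> F z \<in> sphere 0 1"
    "\<And>z. z \<in> {0} \<times> {0..1} \<Longrightarrow> hopf (F z) = \<gamma> (snd z)" "\<And>x. x \<in> {0} \<Longrightarrow> F (x, 0) = p"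
  have "continuous_on {0..1} (\<lambda>s. F (0, s))"
    by (intro continuous_on_compose2[OF F(1)] continuous_intros) auto
  moreover have "norm (F (0, s)) = 1" "hopf (F (0, s)) = \<gamma> s" if "s \<in> {0..1}" for s
    using F(2,3)[of "(0, s)"] that by simp_all
  ultimately show thesis using F(4) by (intro that[of "\<lambda>s. F (0, s)"]) simp_all
qed (use \<gamma> p in \<open>simp_all add: mem_Times_iff\<close>)

section \<open>The degree of a map from the square to the sphere\<close>

text \<open>A lift \<open>F\<close> of \<open>f\<close> to the 3-sphere that is constant on three sides of the square. On the
  fourth side it runs in one Hopf fibre, \<open>\<theta>\<close> of a full turn away from \<open>p\<close>. The end value \<open>\<theta> 1\<close>
  is an integer because \<open>F\<close> is back at \<open>p\<close> in the corner. It is the image of \<open>f\<close> under the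
  connecting homomorphism from the second homotopy group of the sphere to the fundamental group
  of the fibre.\<close>

definition degree_lift ::
  "(real \<times> real \<Rightarrow> real^3) \<Rightarrow> complex \<times> complex \<Rightarrow> (real \<times> real \<Rightarrow> complex \<times> complex) \<Rightarrow> (real \<Rightarrow> real) \<Rightarrow> bool" where
  "degree_lift f p F \<theta> \<longleftrightarrow>
     continuous_on ({0..1} \<times> {0..1}) F \<and> (\<forall>z\<in>{0..1} \<times> {0..1}. F z \<in> sphere 0 1 \<and> hopf (F z) = f z) \<and>
     (\<forall>b\<in>{0..1}. F (0, b) = p \<and> F (1, b) = p) \<and>
     (\<forall>a\<in>{0..1}. F (a, 0) = p \<and> F (a, 1) = phase (cis (2 * pi * \<theta> a)) p) \<and>
     continuous_on {0..1} \<theta> \<and> \<theta> 0 = 0"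

definition sphere_degree :: "(real \<times> real \<Rightarrow> real^3) \<Rightarrow> int \<Rightarrow> bool" where
  "sphere_degree f d \<longleftrightarrow> (\<exists>p F \<theta>. degree_lift f p F \<theta> \<and> \<theta> 1 = of_int d)"

lemma degree_liftD:
  assumes "degree_lift f p F \<theta>"
  shows "continuous_on ({0..1} \<times> {0..1}) F"
    "\<And>z. z \<in> {0..1} \<times> {0..1} \<Longrightarrow> norm (F z) = 1" "\<And>z. z \<in> {0..1} \<times> {0..1} \<Longrightarrow> hopf (F z) = f z"
    "\<And>b. b \<in> {0..1} \<Longrightarrow> F (0, b) = p" "\<And>b. b \<in> {0..1} \<Longrightarrow> F (1, b) = p" "\<And>a. a \<in> {0..1} \<Longrightarrow> F (a, 0) = p"
    "\<And>a. a \<in> {0..1} \<Longrightarrow> F (a, 1) = phase (cis (2 * pi * \<theta> a)) p"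
    "continuous_on {0..1} \<theta>" "\<theta> 0 = 0" "norm p = 1"
proof -
  have "F (0, 0) = p" using assms by (simp add: degree_lift_def)
  moreover have "(0, 0) \<in> {0..1::real} \<times> {0..1::real}" by simp
  then have "F (0, 0) \<in> sphere 0 1" using assms unfolding degree_lift_def by blast
  ultimately show "norm p = 1" by simp
qed (use assms in \<open>auto simp: degree_lift_def\<close>)

lemma degree_lift_rephase:
  assumes "degree_lift f p F \<theta>" "norm q = 1" "hopf q = hopf p"
  obtains G where "degree_lift f q G \<theta>"
proof -
  note F = degree_liftD[OF assms(1)]
  define c where "c = hermitian q p"
  have c: "q = phase c p" "cmod c = 1"
    using same_fibre[of p q] F(10) assms by (auto simp: c_def)
  have "degree_lift f q (\<lambda>z. phase c (F z)) \<theta>"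
    unfolding degree_lift_def c(1)
    by (intro conjI ballI continuous_intros F(1)) (use F c(2) in \<open>auto simp: hopf_phase mult.commute\<close>)
  then show thesis by (rule that)
qed

lemma hermitian_self_unit: "norm F = 1 \<Longrightarrow> hermitian F F = 1"
  by (simp add: hermitian_self)

text \<open>Lifts exist, and their degree is constant in a family. The family may move the common value
  on the boundary, so this covers free homotopies as well as based ones.\<close>

lemma degree_family:
  fixes H :: "real \<times> real \<times> real \<Rightarrow> real^3"
  assumes contH: "continuous_on ({0..1} \<times> {0..1} \<times> {0..1}) H"
    and Him: "\<And>z. z \<in> {0..1} \<times> {0..1} \<times> {0..1} \<Longrightarrow> H z \<in> sphere 0 1"
    and bdry: "\<And>s a b. s \<in> {0..1} \<Longrightarrow> a \<in> {0..1} \<Longrightarrow> b \<in> {0..1} \<Longrightarrow> a \<in> {0, 1} \<or> b \<in> {0, 1} \<Longrightarrow> H (s, a, b) = \<gamma> s"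
  obtains d where "sphere_degree (\<lambda>z. H (0, z)) d" "sphere_degree (\<lambda>z. H (1, z)) d"
proof -
  have \<gamma>: "\<gamma> s = H (s, 0, 0)" if "s \<in> {0..1}" for s
    using bdry[of s 0 0] that by simp
  have "norm (\<gamma> 0) = 1" using Him[of "(0, 0, 0)"] \<gamma>[of 0] by simp
  then obtain p where p: "norm p = 1" "hopf p = \<gamma> 0"
    by (rule hopf_surj)
  have "continuous_on {0..1} (\<lambda>s. H (s, 0, 0))"
    by (intro continuous_on_compose2[OF contH] continuous_intros) auto
  then have cont\<gamma>: "continuous_on {0..1} \<gamma>"
    by (rule continuous_on_eq) (rule \<gamma>[symmetric])
  have norm\<gamma>: "norm (\<gamma> s) = 1" if "s \<in> {0..1}" for s
    using Him[of "(s, 0, 0)"] \<gamma>[OF that] that by simp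
  obtain \<Gamma> where cont\<Gamma>: "continuous_on {0..1} \<Gamma>"
    and \<Gamma>': "\<forall>s\<in>{0..1}. norm (\<Gamma> s) = 1" "\<forall>s\<in>{0..1}. hopf (\<Gamma> s) = \<gamma> s" "\<Gamma> 0 = p"
    by (rule hopf_path_lift[OF cont\<gamma> norm\<gamma> p])
  note \<Gamma> = \<Gamma>'(1,2)[rule_format]
  define f where "f z = H (fst (fst z), snd (fst z), snd z)" for z :: "(real \<times> real) \<times> real"
  \<comment> \<open>The last coordinate is the direction of lifting; the family parameter and the first coordinate are parameters.\<close>
  obtain F where F: "continuous_on (({0..1} \<times> {0..1}) \<times> {0..1}) F"
    "\<And>z. z \<in> ({0..1} \<times> {0..1}) \<times> {0..1} \<Longrightarrow> F z \<in> sphere 0 1"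
    "\<And>z. z \<in> ({0..1} \<times> {0..1}) \<times> {0..1} \<Longrightarrow> hopf (F z) = f z"
    "\<And>x. x \<in> {0..1} \<times> {0..1} \<Longrightarrow> F (x, 0) = \<Gamma> (fst x)"
    "\<And>x c b. x \<in> {0..1} \<times> {0..1} \<Longrightarrow> (\<And>b. b \<in> {0..1} \<Longrightarrow> f (x, b) = c) \<Longrightarrow> b \<in> {0..1} \<Longrightarrow> F (x, b) = \<Gamma> (fst x)"
  proof (rule hopf_lift_along_interval[where K="{0..1::real} \<times> {0..1::real}" and f=f and init="\<lambda>x. \<Gamma> (fst x)"])
    show "continuous_on (({0..1} \<times> {0..1}) \<times> {0..1}) f"
      unfolding f_def by (intro continuous_on_compose2[OF contH] continuous_intros) auto
    show "continuous_on ({0..1} \<times> {0..1}) (\<lambda>x. \<Gamma> (fst x))"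
      by (intro continuous_on_compose2[OF cont\<Gamma>] continuous_intros) auto
  qed (use Him bdry \<Gamma> in \<open>auto simp: f_def intro!: compact_Times\<close>)
  have side: "F ((s, a), b) = \<Gamma> s" if "s \<in> {0..1}" "a \<in> {0, 1}" "b \<in> {0..1}" for s a b
    using F(5)[of "(s, a)" "\<gamma> s" b] bdry[of s a] that by (auto simp: f_def)
  define u where "u x = hermitian (F (x, 1)) (\<Gamma> (fst x))" for x
  have top: "F ((s, a), 1) = phase (u (s, a)) (\<Gamma> s)" "cmod (u (s, a)) = 1"
    if "s \<in> {0..1}" "a \<in> {0..1}" for s a
    using same_fibre[of "\<Gamma> s" "F ((s, a), 1)"] F(2,3)[of "((s, a), 1)"] \<Gamma>[OF that(1)] bdry[of s a 1] that
    by (auto simp: f_def u_def)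
  have u1: "u (s, a) = 1" if "s \<in> {0..1}" "a \<in> {0, 1}" for s a
    using side[of s a 1] that \<Gamma>(1)[OF that(1)] by (simp add: u_def hermitian_self_unit)
  obtain \<theta> where \<theta>: "continuous_on ({0..1} \<times> {0..1}) \<theta>"
    "\<And>z. z \<in> {0..1} \<times> {0..1} \<Longrightarrow> cis (2 * pi * \<theta> z) = u z" "\<And>s. s \<in> {0..1} \<Longrightarrow> \<theta> (s, 0) = 0"
  proof (rule log_lift_along_interval[where K="{0..1::real}" and u=u])
    show "continuous_on ({0..1} \<times> {0..1}) u"
      unfolding u_def
      by (intro continuous_on_compose2[OF F(1)] continuous_on_compose2[OF cont\<Gamma>] continuous_intros) auto
  qed (use top(2) u1 in auto)
  \<comment> \<open>The degree at time \<open>s\<close> is an integer that depends continuously on \<open>s\<close>.\<close>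
  have \<theta>_end: "\<theta> (s, 1) = \<theta> (s', 1)" if "s \<in> {0..1}" "s' \<in> {0..1}" for s s'
  proof (rule continuous_Ints_constant[OF _ _ _ that])
    show "continuous_on {0..1} (\<lambda>s. \<theta> (s, 1))"
      by (intro continuous_on_compose2[OF \<theta>(1)] continuous_intros) auto
    show "\<theta> (s, 1) \<in> \<int>" if "s \<in> {0..1}" for s
      using \<theta>(2)[of "(s, 1)"] u1[of s 1] that by (simp add: cis_2pi_eq_1_iff)
  qed auto
  have lift: "degree_lift (\<lambda>z. H (s, z)) (\<Gamma> s) (\<lambda>z. F ((s, fst z), snd z)) (\<lambda>a. \<theta> (s, a))"
    if s: "s \<in> {0..1}" for s
    unfolding degree_lift_def
  proof (intro conjI ballI)
    show "continuous_on ({0..1} \<times> {0..1}) (\<lambda>z. F ((s, fst z), snd z))"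
      by (intro continuous_on_compose2[OF F(1)] continuous_intros) (use s in auto)
    show "continuous_on {0..1} (\<lambda>a. \<theta> (s, a))"
      by (intro continuous_on_compose2[OF \<theta>(1)] continuous_intros) (use s in auto)
  qed (use s F(2-4) side top(1) \<theta>(2,3) in \<open>auto simp: f_def\<close>)
  have "cis (2 * pi * \<theta> (0, 1)) = 1" using \<theta>(2)[of "(0, 1)"] u1[of 0 1] by simp
  then obtain d where "\<theta> (0, 1) = of_int d"
    unfolding cis_2pi_eq_1_iff by (auto elim: Ints_cases)
  then show thesis
    using that[of d] lift[of 0] lift[of 1] \<theta>_end[of 0 1] unfolding sphere_degree_def by fastforce
qed

text \<open>Two lifts that start at the same point differ by a phase, which is 1 on three sides. Its
  logarithm therefore vanishes at both ends of the fourth side, where it measures the difference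
  of the two angles.\<close>

lemma degree_lift_unique:
  assumes "degree_lift f p F \<theta>" "degree_lift f q G \<tau>"
  shows "\<theta> 1 = \<tau> 1"
proof -
  note F = degree_liftD[OF assms(1)]
  have "hopf q = hopf p"
    using F(3)[of "(0, 0)"] degree_liftD(3)[OF assms(2), of "(0, 0)"] F(4)[of 0]
      degree_liftD(4)[OF assms(2), of 0] by simp
  then obtain G' where "degree_lift f p G' \<tau>"
    using degree_lift_rephase[OF assms(2) F(10)] by metis
  note G = degree_liftD[OF this]
  define v where "v z = hermitian (G' z) (F z)" for z
  have v: "G' z = phase (v z) (F z)" "cmod (v z) = 1" if "z \<in> {0..1} \<times> {0..1}" for z
    using same_fibre[of "F z" "G' z"] F(2,3)[OF that] G(2,3)[OF that] by (auto simp: v_def)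
  have v1: "v (a, 0) = 1" "v (0, a) = 1" "v (1, a) = 1" if "a \<in> {0..1}" for a
    using that F(4-6,10) G(4-6) by (auto simp: v_def hermitian_self_unit)
  obtain \<eta> where \<eta>: "continuous_on ({0..1} \<times> {0..1}) \<eta>"
    "\<And>z. z \<in> {0..1} \<times> {0..1} \<Longrightarrow> cis (2 * pi * \<eta> z) = v z" "\<And>x. x \<in> {0..1} \<Longrightarrow> \<eta> (x, 0) = 0"
    "\<And>x s. x \<in> {0..1} \<Longrightarrow> (\<And>s. s \<in> {0..1} \<Longrightarrow> v (x, s) = 1) \<Longrightarrow> s \<in> {0..1} \<Longrightarrow> \<eta> (x, s) = 0"
  proof (rule log_lift_along_interval[where K="{0..1::real}" and u=v])
    show "continuous_on ({0..1} \<times> {0..1}) v"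
      unfolding v_def by (intro continuous_intros F(1) G(1))
  qed (use v(2) v1 in auto)
  define \<delta> where "\<delta> a = \<tau> a - \<eta> (a, 1) - \<theta> a" for a
  have "\<delta> 0 = \<delta> 1"
  proof (rule continuous_Ints_constant[where S="{0..1::real}" and f=\<delta>])
    show "continuous_on {0..1} \<delta>"
      unfolding \<delta>_def
      by (intro continuous_intros F(8) G(8) continuous_on_compose2[OF \<eta>(1)]) auto
    show "\<delta> a \<in> \<int>" if a: "a \<in> {0..1}" for a
    proof -
      have a1: "(a, 1) \<in> {0..1} \<times> {0..1::real}" using a by simp
      have "phase (cis (2 * pi * \<tau> a)) p = phase (cis (2 * pi * \<eta> (a, 1)) * cis (2 * pi * \<theta> a)) p"
        using v(1)[OF a1] F(7)[OF a] G(7)[OF a] \<eta>(2)[OF a1] by simp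
      then have "cis (2 * pi * \<tau> a) = cis (2 * pi * \<eta> (a, 1)) * cis (2 * pi * \<theta> a)"
        using F(10) by (intro phase_cancel[of p]) auto
      also have "\<dots> = cis (2 * pi * (\<eta> (a, 1) + \<theta> a))" by (simp add: cis_mult distrib_left)
      finally have "cis (2 * pi * \<tau> a) / cis (2 * pi * (\<eta> (a, 1) + \<theta> a)) = 1" by simp
      then have "cis (2 * pi * \<delta> a) = 1"
        by (simp add: cis_divide \<delta>_def algebra_simps)
      then show ?thesis by (simp add: cis_2pi_eq_1_iff)
    qed
  qed auto
  moreover have "\<eta> (0, 1) = 0" "\<eta> (1, 1) = 0"
    using \<eta>(4)[of 0 1] \<eta>(4)[of 1 1] v1 by auto
  ultimately show ?thesis using F(9) G(9) by (simp add: \<delta>_def)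
qed

lemma sphere_degree_unique: "sphere_degree f d \<Longrightarrow> sphere_degree f e \<Longrightarrow> d = e"
  unfolding sphere_degree_def by (metis degree_lift_unique of_int_eq_iff)

lemma sphere_degree_cong:
  assumes "sphere_degree f d" "\<And>z. z \<in> {0..1} \<times> {0..1} \<Longrightarrow> f z = g z"
  shows "sphere_degree g d"
  using assms unfolding sphere_degree_def degree_lift_def by fastforce

text \<open>Lifts with a common start glue, because both are constant on the vertical sides.\<close>

lemma sphere_degree_concat:
  assumes "sphere_degree f d" "sphere_degree g e" "f (0, 0) = g (0, 0)"
  shows "sphere_degree (\<lambda>(a, b). if a \<le> 1/2 then f (2 * a, b) else g (2 * a - 1, b)) (d + e)"
proof -
  obtain p F \<theta> where fl: "degree_lift f p F \<theta>" and \<theta>: "\<theta> 1 = of_int d"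
    using assms(1) unfolding sphere_degree_def by blast
  obtain q G' \<tau> where gl: "degree_lift g q G' \<tau>" and \<tau>: "\<tau> 1 = of_int e"
    using assms(2) unfolding sphere_degree_def by blast
  note F = degree_liftD[OF fl]
  have "hopf p = hopf q"
    using F(3)[of "(0, 0)"] degree_liftD(3)[OF gl, of "(0, 0)"] F(4)[of 0]
      degree_liftD(4)[OF gl, of 0] assms(3) by simp
  then obtain G where "degree_lift g p G \<tau>"
    using degree_lift_rephase[OF gl F(10)] by metis
  note G = degree_liftD[OF this]
  define M where "M z = (if fst z \<le> 1/2 then F (2 * fst z, snd z) else G (2 * fst z - 1, snd z))" for z
  define \<mu> where "\<mu> a = (if a \<le> 1/2 then \<theta> (2 * a) else \<theta> 1 + \<tau> (2 * a - 1))" for a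
  have half: "2 * a = 1" if "a * 2 = 1" for a :: real using that by simp
  have "continuous_on ({0..1/2} \<times> {0..1} \<union> {1/2..1} \<times> {0..1}) M"
    unfolding M_def
    by (intro continuous_on_If continuous_on_compose2[OF F(1)] continuous_on_compose2[OF G(1)]
        continuous_intros closed_Times) (auto simp: F(5) G(4) half)
  moreover have "{0..1/2} \<times> {0..1} \<union> {1/2..1} \<times> {0..1} = {0..1::real} \<times> {0..1::real}"
    by force
  ultimately have contM: "continuous_on ({0..1} \<times> {0..1}) M" by simp
  have "continuous_on ({0..1/2} \<union> {1/2..1}) \<mu>"
    unfolding \<mu>_def
    by (intro continuous_on_If continuous_on_compose2[OF F(8)] continuous_on_compose2[OF G(8)]
        continuous_intros) (auto simp: G(9) half)
  moreover have "{0..1/2} \<union> {1/2..1} = {0..1::real}" by auto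
  ultimately have cont\<mu>: "continuous_on {0..1} \<mu>" by simp
  have period: "cis (2 * pi * (\<theta> 1 + x)) = cis (2 * pi * x)" for x
  proof -
    have "cis (2 * pi * \<theta> 1) = 1" by (simp add: cis_2pi_eq_1_iff \<theta>)
    then show ?thesis by (simp add: distrib_left flip: cis_mult)
  qed
  have "degree_lift (\<lambda>(a, b). if a \<le> 1/2 then f (2 * a, b) else g (2 * a - 1, b)) p M \<mu>"
    unfolding degree_lift_def using F G contM cont\<mu>
    by (auto simp: M_def \<mu>_def period)
  moreover have "\<mu> 1 = of_int (d + e)" by (simp add: \<mu>_def \<theta> \<tau>)
  ultimately show ?thesis unfolding sphere_degree_def by blast
qed

text \<open>\<open>conj_swap\<close> turns a lift of \<open>f\<close> into a lift of its antipode and conjugates the phase on the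
  fourth side.\<close>

lemma sphere_degree_antipode:
  assumes "sphere_degree f d" shows "sphere_degree (\<lambda>z. - f z) (- d)"
proof -
  obtain p F \<theta> where fl: "degree_lift f p F \<theta>" and \<theta>: "\<theta> 1 = of_int d"
    using assms(1) unfolding sphere_degree_def by blast
  note F = degree_liftD[OF fl]
  have "degree_lift (\<lambda>z. - f z) (conj_swap p) (\<lambda>z. conj_swap (F z)) (\<lambda>a. - \<theta> a)"
    unfolding degree_lift_def using F
    by (auto simp: hopf_conj_swap conj_swap_phase cis_cnj intro!: continuous_intros)
  moreover have "- \<theta> 1 = of_int (- d)" using \<theta> by simp
  ultimately show ?thesis unfolding sphere_degree_def by blast
qed

text \<open>The 3-cube has dimension less than 4, so nothing obstructs the extension of a map into the
  3-sphere. Applied to the boundary of the cube, this says that the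
  second homotopy group of the 3-sphere vanishes.\<close>

lemma extend_cube_to_S3:
  fixes M :: "real \<times> real \<times> real \<Rightarrow> complex \<times> complex"
  assumes "closed S" "S \<subseteq> {0..1} \<times> {0..1} \<times> {0..1}" "continuous_on S M" "M ` S \<subseteq> sphere 0 1"
  obtains N where "continuous_on ({0..1} \<times> {0..1} \<times> {0..1}) N" "N ` ({0..1} \<times> {0..1} \<times> {0..1}) \<subseteq> sphere 0 1"
    "\<And>x. x \<in> S \<Longrightarrow> N x = M x"
proof -
  let ?C = "cbox (0, 0, 0) (1, 1, 1) :: (real \<times> real \<times> real) set"
  have C: "?C = {0..1} \<times> {0..1} \<times> {0..1}"
    unfolding cbox_Pair_eq by (simp add: cbox_interval)
  let ?B = "cball 0 1 :: (complex \<times> complex) set"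
  have rel: "rel_frontier ?B = sphere 0 1" by (simp add: rel_frontier_cball)
  obtain N where N: "continuous_on (\<Union>{?C}) N" "N \<in> \<Union>{?C} \<rightarrow> rel_frontier ?B" "\<And>x. x \<in> S \<Longrightarrow> N x = M x"
  proof (rule extend_map_cell_complex_to_sphere[of "{?C}" S ?B M])
    fix X assume "X \<in> {?C}"
    then show "polytope X" by (simp only: singleton_iff polytope_interval)
    have "aff_dim X \<le> int DIM(real \<times> real \<times> real)" by (rule aff_dim_le_DIM)
    then show "aff_dim X < aff_dim ?B" by (simp add: aff_dim_cball)
  next
    show "S \<subseteq> \<Union>{?C}" using assms(2) C by simp
    show "M \<in> S \<rightarrow> rel_frontier ?B" using assms(4) unfolding rel by blast
  next
    fix X Y assume "X \<in> {?C}" "Y \<in> {?C}"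
    then have "X = ?C" "Y = ?C" by simp_all
    then show "X \<inter> Y face_of X"
      by (simp add: face_of_refl convex_box)
  qed (use assms in \<open>simp_all\<close>)
  then show thesis using that[of N] unfolding C rel by auto
qed

text \<open>Lifts whose angles on the fourth side have the same end values can be made equal on the
  whole boundary; then they are homotopic in the 3-sphere relative to the boundary.\<close>

lemma equal_degree_homotopic:
  assumes f: "sphere_degree f d" and g: "sphere_degree g d" and "f (0, 0) = g (0, 0)"
  obtains H :: "real \<times> real \<times> real \<Rightarrow> real^3" where "continuous_on ({0..1} \<times> {0..1} \<times> {0..1}) H" "H ` ({0..1} \<times> {0..1} \<times> {0..1}) \<subseteq> sphere 0 1"
    "\<And>z. z \<in> {0..1} \<times> {0..1} \<Longrightarrow> H (0, z) = f z" "\<And>z. z \<in> {0..1} \<times> {0..1} \<Longrightarrow> H (1, z) = g z"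
    "\<And>s a b. s \<in> {0..1} \<Longrightarrow> a \<in> {0..1} \<Longrightarrow> b \<in> {0..1} \<Longrightarrow> a \<in> {0, 1} \<or> b \<in> {0, 1} \<Longrightarrow> H (s, a, b) = f (0, 0)"
proof -
  obtain p F \<theta> where fl: "degree_lift f p F \<theta>" and \<theta>: "\<theta> 1 = of_int d"
    using assms(1) unfolding sphere_degree_def by blast
  obtain q G' \<tau> where gl: "degree_lift g q G' \<tau>" and \<tau>: "\<tau> 1 = of_int d"
    using assms(2) unfolding sphere_degree_def by blast
  note F = degree_liftD[OF fl]
  have p: "hopf p = f (0, 0)" using F(3)[of "(0, 0)"] F(4)[of 0] by simp
  then have "hopf p = hopf q"
    using degree_liftD(3)[OF gl, of "(0, 0)"] degree_liftD(4)[OF gl, of 0] assms(3) by simp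
  then obtain G where "degree_lift g p G \<tau>"
    using degree_lift_rephase[OF gl F(10)] by metis
  note G = degree_liftD[OF this]
  \<comment> \<open>The second lift is turned gradually in its fibres until it agrees with the first on the fourth side. Equality of the degrees keeps it unchanged on the vertical sides.\<close>
  define R where "R z = phase (cis (2 * pi * (snd z * (\<theta> (fst z) - \<tau> (fst z))))) (G z)" for z
  have contR: "continuous_on ({0..1} \<times> {0..1}) R"
  proof -
    have "continuous_on ({0..1} \<times> {0..1}) (\<lambda>z. \<theta> (fst z))" "continuous_on ({0..1} \<times> {0..1}) (\<lambda>z. \<tau> (fst z))"
      by (auto intro!: continuous_on_compose2[OF F(8)] continuous_on_compose2[OF G(8)] continuous_intros)
    then show ?thesis unfolding R_def cis_conv_exp by (intro continuous_intros G(1))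
  qed
  have R: "norm (R z) = 1" "hopf (R z) = g z" if "z \<in> {0..1} \<times> {0..1}" for z
    using G(2,3)[OF that] by (auto simp: R_def hopf_phase)
  have RF: "R (a, b) = F (a, b)" if ab: "a \<in> {0..1}" "b \<in> {0..1}" "a \<in> {0, 1} \<or> b \<in> {0, 1}" for a b
  proof -
    consider "a = 0" | "a = 1" | "b = 0" | "b = 1" using ab by auto
    then show ?thesis
    proof cases
      case 4
      then show ?thesis using ab F(7) G(7) by (simp add: R_def cis_mult algebra_simps)
    qed (use ab F G \<theta> \<tau> in \<open>simp_all add: R_def\<close>)
  qed
  have bdry: "hopf (F (a, b)) = f (0, 0)" if ab: "a \<in> {0..1}" "b \<in> {0..1}" "a \<in> {0, 1} \<or> b \<in> {0, 1}" for a b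
    using that F(4-7) p by (auto simp: hopf_phase)
  let ?I = "{0..1::real}"
  let ?E = "({0, 1} \<times> ?I) \<union> (?I \<times> {0, 1})"
  define M where "M x = (if fst x = 1 then R (snd x) else F (snd x))" for x :: "real \<times> real \<times> real"
  define S where "S = ({1} \<times> ?I \<times> ?I) \<union> (({0} \<times> ?I \<times> ?I) \<union> (?I \<times> ?E))"
  have S1: "closed S" unfolding S_def by (intro closed_Un closed_Times) auto
  have S2: "S \<subseteq> ?I \<times> ?I \<times> ?I" by (auto simp: S_def)
  have S3: "continuous_on S M"
    unfolding S_def M_def
  proof (rule continuous_on_If)
    show "continuous_on ({1} \<times> ?I \<times> ?I) (\<lambda>x. R (snd x))"
      by (intro continuous_on_compose2[OF contR] continuous_intros) auto
    show "continuous_on ({0} \<times> ?I \<times> ?I \<union> ?I \<times> ?E) (\<lambda>x. F (snd x))"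
      by (intro continuous_on_compose2[OF F(1)] continuous_intros) auto
    show "R (snd x) = F (snd x)" if "x \<in> {0} \<times> ?I \<times> ?I \<union> ?I \<times> ?E" "fst x = 1" for x
      using that by (auto simp: RF)
  qed (auto intro!: closed_Times closed_Un)
  have S4: "M ` S \<subseteq> sphere 0 1"
    using R(1) F(2) by (auto simp: M_def S_def)
  obtain N where N: "continuous_on (?I \<times> ?I \<times> ?I) N" "N ` (?I \<times> ?I \<times> ?I) \<subseteq> sphere 0 1"
    "\<And>x. x \<in> S \<Longrightarrow> N x = M x"
    using extend_cube_to_S3[OF S1 S2 S3 S4] by blast
  have H1: "continuous_on (?I \<times> ?I \<times> ?I) (\<lambda>x. hopf (N x))" by (intro continuous_intros N)
  have H2: "(\<lambda>x. hopf (N x)) ` (?I \<times> ?I \<times> ?I) \<subseteq> sphere 0 1"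
  proof (rule image_subsetI)
    fix x assume "x \<in> ?I \<times> ?I \<times> ?I"
    then have "N x \<in> sphere 0 1" using N(2) by blast
    then show "hopf (N x) \<in> sphere 0 1" by (rule hopf_in_sphere)
  qed
  have H3: "hopf (N (0, z)) = f z" if "z \<in> ?I \<times> ?I" for z
  proof -
    have "(0, z) \<in> S" using that unfolding S_def by simp
    from N(3)[OF this] show ?thesis using F(3)[OF that] by (simp add: M_def)
  qed
  have H4: "hopf (N (1, z)) = g z" if "z \<in> ?I \<times> ?I" for z
  proof -
    have "(1, z) \<in> S" using that unfolding S_def by simp
    from N(3)[OF this] show ?thesis using R(2)[OF that] by (simp add: M_def)
  qed
  have H5: "hopf (N (s, a, b)) = f (0, 0)"
    if "s \<in> ?I" "a \<in> ?I" "b \<in> ?I" "a \<in> {0, 1} \<or> b \<in> {0, 1}" for s a b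
  proof -
    have "(s, a, b) \<in> S" using that unfolding S_def by auto
    from N(3)[OF this] show ?thesis
      using RF[OF that(2-4)] bdry[OF that(2-4)] by (simp add: M_def)
  qed
  show thesis by (rule that[of "\<lambda>x. hopf (N x)", OF H1 H2 H3 H4 H5])
qed

text \<open>The boundary values that a lift of degree \<open>d\<close> must have are written down and extended over
  the square inside the 3-sphere. In the basis \<open>p\<close>, \<open>conj_swap p\<close> the first coordinate \<open>g\<close> has
  to run \<open>d\<close> times around the circle on the fourth side, so it may vanish inside; the second
  coordinate \<open>\<beta>\<close> vanishes exactly on the boundary and keeps the vector nonzero.\<close>

lemma sphere_degree_realised:
  assumes "norm y = 1"
  obtains f where "continuous_on ({0..1} \<times> {0..1}) f" "f ` ({0..1} \<times> {0..1}) \<subseteq> sphere 0 1"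
    "sphere_degree f d"
    "\<And>a b. a \<in> {0..1} \<Longrightarrow> b \<in> {0..1} \<Longrightarrow> a \<in> {0, 1} \<or> b \<in> {0, 1} \<Longrightarrow> f (a, b) = y"
proof -
  obtain p where p: "norm p = 1" "hopf p = y" using assms by (rule hopf_surj)
  let ?I = "{0..1::real}"
  define g where "g z = (1 - of_real (snd z)) + of_real (snd z) * cis (2 * pi * (of_int d * fst z))"
    for z :: "real \<times> real"
  define \<beta> where "\<beta> z = fst z * (1 - fst z) * (snd z * (1 - snd z))" for z :: "real \<times> real"
  define L where "L z = phase (g z) p + phase (of_real (\<beta> z)) (conj_swap p)" for z
  define F where "F z = phase (of_real (inverse (norm (L z)))) (L z)" for z
  have per: "cis (2 * pi * of_int d) = 1" by (simp add: cis_2pi_eq_1_iff)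
  have g1: "cmod (g (a, b)) = 1" "\<beta> (a, b) = 0"
    if "a \<in> ?I" "b \<in> ?I" "a \<in> {0, 1} \<or> b \<in> {0, 1}" for a b
    using that per by (auto simp: g_def \<beta>_def)
  have Lsq: "(norm (L z))\<^sup>2 = (cmod (g z))\<^sup>2 + (\<beta> z)\<^sup>2" for z
    unfolding L_def norm_add_conj_swap using p by simp
  have L_nz: "L z \<noteq> 0" if z: "z \<in> ?I \<times> ?I" for z
  proof
    assume "L z = 0"
    then have "cmod (g z) = 0" "\<beta> z = 0"
      using Lsq[of z] by (simp_all add: add_nonneg_eq_0_iff)
    moreover obtain a b where ab: "z = (a, b)" by (cases z)
    ultimately show False
      using g1[of a b] z by (auto simp: \<beta>_def)
  qed
  have contL: "continuous_on (?I \<times> ?I) L"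
    unfolding L_def g_def \<beta>_def cis_conv_exp by (intro continuous_intros)
  have contF: "continuous_on (?I \<times> ?I) F"
    unfolding F_def by (intro continuous_intros contL) (use L_nz in auto)
  have F: "norm (F z) = 1" if "z \<in> ?I \<times> ?I" for z
    using L_nz[OF that] by (simp add: F_def norm_inverse)
  have edge: "F (a, b) = phase (g (a, b)) p"
    if "a \<in> ?I" "b \<in> ?I" "a \<in> {0, 1} \<or> b \<in> {0, 1}" for a b
  proof -
    have "L (a, b) = phase (g (a, b)) p"
      using g1(2)[OF that] by (simp add: L_def phase_def flip: zero_prod_def)
    moreover have "norm (L (a, b)) = 1"
      using g1(1)[OF that] calculation p by simp
    ultimately show ?thesis by (simp add: F_def)
  qed
  have "degree_lift (\<lambda>z. hopf (F z)) p F (\<lambda>a. of_int d * a)"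
    unfolding degree_lift_def
    by (intro conjI ballI contF continuous_intros) (use F edge per in \<open>auto simp: g_def\<close>)
  then have "sphere_degree (\<lambda>z. hopf (F z)) d"
    unfolding sphere_degree_def by fastforce
  moreover have "hopf (F (a, b)) = y"
    if "a \<in> ?I" "b \<in> ?I" "a \<in> {0, 1} \<or> b \<in> {0, 1}" for a b
    using edge[OF that] g1(1)[OF that] p by (simp add: hopf_phase)
  moreover have "(\<lambda>z. hopf (F z)) ` (?I \<times> ?I) \<subseteq> sphere 0 1"
    using F by (auto simp: norm_hopf)
  ultimately show thesis
    by (intro that[of "\<lambda>z. hopf (F z)"] continuous_intros contF) auto
qed

section \<open>Homotopy classes of maps of cubes\<close>

lemma topspace_cube: "topspace (cube k) = ({..<k} \<rightarrow>\<^sub>E {0..1})"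
  by (simp add: cube_def)

lemma cube_coordinate: "t \<in> topspace (cube k) \<Longrightarrow> i < k \<Longrightarrow> 0 \<le> t i \<and> t i \<le> 1"
  by (fastforce simp: topspace_cube PiE_iff)

lemma cube_boundary_subset: "cube_boundary k \<subseteq> topspace (cube k)"
  by (auto simp: cube_boundary_def)

lemma cube_upd: "t \<in> topspace (cube k) \<Longrightarrow> j < k \<Longrightarrow> 0 \<le> r \<Longrightarrow> r \<le> 1 \<Longrightarrow> t(j := r) \<in> topspace (cube k)"
  by (auto simp: topspace_cube PiE_iff extensional_def)

lemma continuous_map_cube_coordinate:
  assumes "continuous_map Z (cube k) \<phi>" "j < k"
  shows "continuous_map Z euclideanreal (\<lambda>z. \<phi> z j)"
proof -
  have "continuous_map (cube k) (top_of_set {0..1::real}) (\<lambda>t. t j)"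
    unfolding cube_def using assms(2) by (intro continuous_map_product_projection) auto
  then have "continuous_map (cube k) euclideanreal (\<lambda>t. t j)"
    by (rule continuous_map_into_fulltopology)
  from continuous_map_compose[OF assms(1) this] show ?thesis by (simp add: o_def)
qed

lemma continuous_map_cube_upd:
  assumes \<phi>: "continuous_map Z (cube k) \<phi>" and r: "continuous_map Z euclideanreal r"
    and r01: "\<And>z. z \<in> topspace Z \<Longrightarrow> r z \<in> {0..1}" and j: "j < k"
  shows "continuous_map Z (cube k) (\<lambda>z. (\<phi> z)(j := r z))"
  unfolding cube_def continuous_map_componentwise
proof (intro conjI ballI)
  show "(\<lambda>z. (\<phi> z)(j := r z)) ` topspace Z \<subseteq> extensional {..<k}"
    using continuous_map_image_subset_topspace[OF \<phi>] j
    by (auto simp: topspace_cube PiE_iff extensional_def)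
  fix i assume i: "i \<in> {..<k}"
  have "continuous_map Z (top_of_set {0..1}) (\<lambda>z. \<phi> z i)"
    using \<phi> i unfolding cube_def continuous_map_componentwise by blast
  moreover have "continuous_map Z (top_of_set {0..1}) r"
    using r r01 by (auto simp: continuous_map_in_subtopology)
  ultimately show "continuous_map Z (top_of_set {0..1}) (\<lambda>z. ((\<phi> z)(j := r z)) i)"
    by (cases "i = j") auto
qed

text \<open>A free homotopy during which the whole boundary runs along \<open>\<gamma>\<close>. Constant \<open>\<gamma>\<close> gives the
  relation that defines the homotopy groups, general \<open>\<gamma>\<close> the change of basepoint.\<close>

definition cube_homotopy ::
  "nat \<Rightarrow> 'a topology \<Rightarrow> (real \<Rightarrow> 'a) \<Rightarrow> ((nat \<Rightarrow> real) \<Rightarrow> 'a) \<Rightarrow> ((nat \<Rightarrow> real) \<Rightarrow> 'a) \<Rightarrow> bool" where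
  "cube_homotopy k X \<gamma> f g \<longleftrightarrow>
     (\<exists>h. continuous_map (prod_topology (top_of_set {0..1::real}) (cube k)) X h \<and>
        (\<forall>t\<in>topspace (cube k). h (0, t) = f t \<and> h (1, t) = g t) \<and>
        (\<forall>s\<in>{0..1}. \<forall>t\<in>cube_boundary k. h (s, t) = \<gamma> s))"

definition homotopy_class :: "nat \<Rightarrow> 'a topology \<Rightarrow> 'a \<Rightarrow> ((nat \<Rightarrow> real) \<Rightarrow> 'a) \<Rightarrow> ((nat \<Rightarrow> real) \<Rightarrow> 'a) set" where
  "homotopy_class k X x f = cube_homotopy_rel k X x `` {f}"

lemma basepoint_change_eq:
  "basepoint_change k X \<gamma> A = {g \<in> cube_maps k X (\<gamma> 1). \<exists>f\<in>A. cube_homotopy k X \<gamma> f g}"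
  by (simp add: basepoint_change_def cube_homotopy_def)

lemma cube_homotopy_rel_iff:
  "(f, g) \<in> cube_homotopy_rel k X x \<longleftrightarrow>
     f \<in> cube_maps k X x \<and> g \<in> cube_maps k X x \<and> cube_homotopy k X (\<lambda>_. x) f g"
  unfolding cube_homotopy_rel_def cube_homotopy_def
  apply (subst homotopic_with)
  using cube_boundary_subset[of k] by fastforce+

lemma cube_mapsD:
  assumes "f \<in> cube_maps k X x"
  shows "continuous_map (cube k) X f" "f \<in> extensional (topspace (cube k))" "\<And>t. t \<in> cube_boundary k \<Longrightarrow> f t = x"
  using assms by (auto simp: cube_maps_def)

lemma equiv_cube_homotopy_rel: "equiv (cube_maps k X x) (cube_homotopy_rel k X x)"
proof (rule equivI)
  show "cube_homotopy_rel k X x \<subseteq> cube_maps k X x \<times> cube_maps k X x"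
    by (auto simp: cube_homotopy_rel_def)
  show "refl_on (cube_maps k X x) (cube_homotopy_rel k X x)"
    by (auto simp: refl_on_def cube_homotopy_rel_def cube_maps_def)
  show "sym (cube_homotopy_rel k X x)"
    by (auto simp: sym_def cube_homotopy_rel_def homotopic_with_sym)
  show "trans (cube_homotopy_rel k X x)"
    by (rule transI) (auto simp: cube_homotopy_rel_def intro: homotopic_with_trans)
qed

lemma homotopy_class_eqI:
  "(f, g) \<in> cube_homotopy_rel k X x \<Longrightarrow> homotopy_class k X x f = homotopy_class k X x g"
  unfolding homotopy_class_def by (rule equiv_class_eq[OF equiv_cube_homotopy_rel])

lemma homotopy_class_self: "f \<in> cube_maps k X x \<Longrightarrow> f \<in> homotopy_class k X x f"
  unfolding homotopy_class_def by (rule equiv_class_self[OF equiv_cube_homotopy_rel])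

lemma mem_homotopy_class_iff: "g \<in> homotopy_class k X x f \<longleftrightarrow> (f, g) \<in> cube_homotopy_rel k X x"
  by (simp add: homotopy_class_def)

lemma carrier_homotopy_group:
  "carrier (homotopy_group k X x) = homotopy_class k X x ` cube_maps k X x"
  by (auto simp: homotopy_group_def quotient_def homotopy_class_def)

text \<open>Concatenation of two homotopies. Taking stationary ones also shows that
  \<open>cube_concat\<close> of two maps with the same value on the boundary is continuous.\<close>

lemma cube_homotopy_concat:
  assumes k: "1 \<le> k" and f: "cube_homotopy k X (\<lambda>_. x) f f'" and g: "cube_homotopy k X (\<lambda>_. x) g g'"
  shows "cube_homotopy k X (\<lambda>_. x) (cube_concat k f g) (cube_concat k f' g')"
proof -
  let ?Z = "prod_topology (top_of_set {0..1::real}) (cube k)"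
  obtain h where h: "continuous_map ?Z X h" "\<And>t. t \<in> topspace (cube k) \<Longrightarrow> h (0, t) = f t \<and> h (1, t) = f' t"
    "\<And>s t. s \<in> {0..1} \<Longrightarrow> t \<in> cube_boundary k \<Longrightarrow> h (s, t) = x"
    using f unfolding cube_homotopy_def by blast
  obtain h' where h': "continuous_map ?Z X h'" "\<And>t. t \<in> topspace (cube k) \<Longrightarrow> h' (0, t) = g t \<and> h' (1, t) = g' t"
    "\<And>s t. s \<in> {0..1} \<Longrightarrow> t \<in> cube_boundary k \<Longrightarrow> h' (s, t) = x"
    using g unfolding cube_homotopy_def by blast
  define H where "H z = (if snd z 0 \<le> 1/2 then h (fst z, (snd z)(0 := 2 * snd z 0))
      else h' (fst z, (snd z)(0 := 2 * snd z 0 - 1)))" for z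
  have k0: "0 < k" using k by simp
  have coord: "0 \<le> snd z 0" "snd z 0 \<le> 1" if "z \<in> topspace ?Z" for z
    using cube_coordinate[of "snd z" k 0] that k0 by auto
  have c0: "continuous_map ?Z euclideanreal (\<lambda>z. snd z 0)"
    by (intro continuous_map_cube_coordinate[OF continuous_map_snd k0])
  have contH: "continuous_map ?Z X H"
    unfolding H_def
  proof (rule continuous_map_cases_le)
    let ?A = "subtopology ?Z {z \<in> topspace ?Z. snd z 0 \<le> 1/2}"
    have "continuous_map ?A (cube k) (\<lambda>z. (snd z)(0 := 2 * snd z 0))"
      by (intro continuous_map_cube_upd continuous_map_from_subtopology continuous_map_snd
          continuous_map_real_mult_left c0 k0) (use coord in auto)
    then have "continuous_map ?A ?Z (\<lambda>z. (fst z, (snd z)(0 := 2 * snd z 0)))"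
      by (rule continuous_map_pairedI[OF continuous_map_from_subtopology[OF continuous_map_fst]])
    from continuous_map_compose[OF this h(1)]
    show "continuous_map ?A X (\<lambda>z. h (fst z, (snd z)(0 := 2 * snd z 0)))" by (simp add: o_def)
    let ?B = "subtopology ?Z {z \<in> topspace ?Z. 1/2 \<le> snd z 0}"
    have "continuous_map ?B (cube k) (\<lambda>z. (snd z)(0 := 2 * snd z 0 - 1))"
      by (intro continuous_map_cube_upd continuous_map_from_subtopology continuous_map_snd
          continuous_map_diff continuous_map_real_mult_left c0 k0) (use coord in auto)
    then have "continuous_map ?B ?Z (\<lambda>z. (fst z, (snd z)(0 := 2 * snd z 0 - 1)))"
      by (rule continuous_map_pairedI[OF continuous_map_from_subtopology[OF continuous_map_fst]])
    from continuous_map_compose[OF this h'(1)]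
    show "continuous_map ?B X (\<lambda>z. h' (fst z, (snd z)(0 := 2 * snd z 0 - 1)))" by (simp add: o_def)
    fix z assume z: "z \<in> topspace ?Z" "snd z 0 = 1/2"
    have "(snd z)(0 := 1) \<in> cube_boundary k" "(snd z)(0 := 0) \<in> cube_boundary k" "fst z \<in> {0..1}"
      using z k0 cube_upd[of "snd z" k 0] by (auto simp: cube_boundary_def)
    then show "h (fst z, (snd z)(0 := 2 * snd z 0)) = h' (fst z, (snd z)(0 := 2 * snd z 0 - 1))"
      using h(3)[of "fst z" "(snd z)(0 := 1)"] h'(3)[of "fst z" "(snd z)(0 := 0)"] arg_cong[OF z(2), of "\<lambda>r. 2 * r"] by simp
  qed (use c0 in auto)
  have ends: "H (0, t) = cube_concat k f g t \<and> H (1, t) = cube_concat k f' g' t" if t: "t \<in> topspace (cube k)" for t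
  proof (cases "t 0 \<le> 1/2")
    case True
    then have "t(0 := 2 * t 0) \<in> topspace (cube k)"
      using cube_coordinate[OF t k0] cube_upd[OF t k0] by auto
    from h(2)[OF this] True t show ?thesis by (simp add: H_def cube_concat_def)
  next
    case False
    then have "t(0 := 2 * t 0 - 1) \<in> topspace (cube k)"
      using cube_coordinate[OF t k0] cube_upd[OF t k0] by auto
    from h'(2)[OF this] False t show ?thesis by (simp add: H_def cube_concat_def)
  qed
  have "H (s, t) = x" if s: "s \<in> {0..1}" and t: "t \<in> cube_boundary k" for s t
  proof -
    have tc: "t \<in> topspace (cube k)" using t by (simp add: cube_boundary_def)
    obtain i where i: "i < k" "t i = 0 \<or> t i = 1" using t by (auto simp: cube_boundary_def)
    show ?thesis
    proof (cases "t 0 \<le> 1/2")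
      case True
      then have "t(0 := 2 * t 0) \<in> cube_boundary k"
        using cube_coordinate[OF tc k0] cube_upd[OF tc k0] i by (auto simp: cube_boundary_def intro!: exI[of _ i])
      then show ?thesis using h(3) s True by (simp add: H_def)
    next
      case False
      then have "t(0 := 2 * t 0 - 1) \<in> cube_boundary k"
        using cube_coordinate[OF tc k0] cube_upd[OF tc k0] i by (auto simp: cube_boundary_def intro!: exI[of _ i])
      then show ?thesis using h'(3) s False by (simp add: H_def)
    qed
  qed
  with contH ends show ?thesis unfolding cube_homotopy_def by blast
qed

lemma cube_homotopy_endpoint:
  assumes "cube_homotopy k X \<gamma> f g" "g \<in> extensional (topspace (cube k))"
  shows "g \<in> cube_maps k X (\<gamma> 1)"
proof -
  obtain h where h: "continuous_map (prod_topology (top_of_set {0..1::real}) (cube k)) X h"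
    "\<And>t. t \<in> topspace (cube k) \<Longrightarrow> h (1, t) = g t"
    "\<And>s t. s \<in> {0..1} \<Longrightarrow> t \<in> cube_boundary k \<Longrightarrow> h (s, t) = \<gamma> s"
    using assms(1) unfolding cube_homotopy_def by blast
  have "continuous_map (cube k) (prod_topology (top_of_set {0..1::real}) (cube k)) (\<lambda>t. (1, t))"
    by (intro continuous_map_pairedI) auto
  from continuous_map_compose[OF this h(1)] have "continuous_map (cube k) X (\<lambda>t. h (1, t))"
    by (simp add: o_def)
  then have "continuous_map (cube k) X g"
    by (rule continuous_map_eq) (rule h(2))
  moreover have "g t = \<gamma> 1" if "t \<in> cube_boundary k" for t
    using h(2)[OF subsetD[OF cube_boundary_subset that]] h(3)[OF _ that, of 1] by simp
  ultimately show ?thesis using assms(2) by (simp add: cube_maps_def)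
qed

lemma cube_homotopy_refl:
  assumes "f \<in> cube_maps k X x" shows "cube_homotopy k X (\<lambda>_. x) f f"
  using homotopy_class_self[OF assms] unfolding mem_homotopy_class_iff cube_homotopy_rel_iff by simp

lemma cube_concat_in_cube_maps:
  assumes "1 \<le> k" "f \<in> cube_maps k X x" "g \<in> cube_maps k X x"
  shows "cube_concat k f g \<in> cube_maps k X x"
proof (rule cube_homotopy_endpoint)
  show "cube_homotopy k X (\<lambda>_. x) (cube_concat k f g) (cube_concat k f g)"
    by (intro cube_homotopy_concat cube_homotopy_refl assms)
qed (simp only: cube_concat_def restrict_extensional)

text \<open>Multiplication and induced maps are unions over representatives; this reduces them to one
  representative.\<close>

lemma UN_const_on:
  assumes "a \<in> A" "\<And>x. x \<in> A \<Longrightarrow> F x = C" shows "(\<Union>x\<in>A. F x) = C"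
  using assms by auto

lemma cube_concat_respects:
  assumes "1 \<le> k" "(f, f') \<in> cube_homotopy_rel k X x" "(g, g') \<in> cube_homotopy_rel k X x"
  shows "(cube_concat k f g, cube_concat k f' g') \<in> cube_homotopy_rel k X x"
  using assms unfolding cube_homotopy_rel_iff
  by (intro conjI cube_homotopy_concat cube_concat_in_cube_maps) blast+

lemma mult_homotopy_class:
  assumes k: "1 \<le> k" and f: "f \<in> cube_maps k X x" and g: "g \<in> cube_maps k X x"
  shows "homotopy_class k X x f \<otimes>\<^bsub>homotopy_group k X x\<^esub> homotopy_class k X x g =
    homotopy_class k X x (cube_concat k f g)"
proof -
  have "(\<Union>f'\<in>homotopy_class k X x f. \<Union>g'\<in>homotopy_class k X x g. homotopy_class k X x (cube_concat k f' g')) =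
     homotopy_class k X x (cube_concat k f g)"
  proof (rule UN_const_on[OF homotopy_class_self[OF f]], rule UN_const_on[OF homotopy_class_self[OF g]])
    fix f' g' assume "f' \<in> homotopy_class k X x f" "g' \<in> homotopy_class k X x g"
    then show "homotopy_class k X x (cube_concat k f' g') = homotopy_class k X x (cube_concat k f g)"
      unfolding mem_homotopy_class_iff
      by (rule homotopy_class_eqI[OF cube_concat_respects[OF k], symmetric])
  qed
  then show ?thesis
    by (simp only: homotopy_group_def homotopy_class_def monoid.select_convs)
qed

lemma cube_homotopy_compose:
  assumes p: "continuous_map X Y p" and "cube_homotopy k X \<gamma> f g"
  shows "cube_homotopy k Y (p \<circ> \<gamma>) (restrict (p \<circ> f) (topspace (cube k))) (restrict (p \<circ> g) (topspace (cube k)))"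
proof -
  obtain h where h: "continuous_map (prod_topology (top_of_set {0..1::real}) (cube k)) X h"
    "\<And>t. t \<in> topspace (cube k) \<Longrightarrow> h (0, t) = f t \<and> h (1, t) = g t"
    "\<And>s t. s \<in> {0..1} \<Longrightarrow> t \<in> cube_boundary k \<Longrightarrow> h (s, t) = \<gamma> s"
    using assms(2) unfolding cube_homotopy_def by blast
  show ?thesis
    unfolding cube_homotopy_def
  proof (intro exI[of _ "p \<circ> h"] conjI ballI)
    show "continuous_map (prod_topology (top_of_set {0..1::real}) (cube k)) Y (p \<circ> h)"
      by (rule continuous_map_compose[OF h(1) p])
  qed (simp_all add: h(2,3))
qed

lemma compose_in_cube_maps:
  assumes p: "continuous_map X Y p" and f: "f \<in> cube_maps k X x"
  shows "restrict (p \<circ> f) (topspace (cube k)) \<in> cube_maps k Y (p x)"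
  unfolding cube_maps_def
proof (intro CollectI conjI ballI)
  have "continuous_map (cube k) Y (p \<circ> f)"
    by (rule continuous_map_compose[OF cube_mapsD(1)[OF f] p])
  then show "continuous_map (cube k) Y (restrict (p \<circ> f) (topspace (cube k)))"
    by (rule continuous_map_eq) simp
  show "restrict (p \<circ> f) (topspace (cube k)) t = p x" if "t \<in> cube_boundary k" for t
    using cube_mapsD(3)[OF f that] subsetD[OF cube_boundary_subset that] by simp
qed simp

lemma homotopy_induced_class:
  assumes p: "continuous_map X Y p" and f: "f \<in> cube_maps k X x"
  shows "homotopy_induced k Y p x (homotopy_class k X x f) =
    homotopy_class k Y (p x) (restrict (p \<circ> f) (topspace (cube k)))"
proof -
  let ?c = "\<lambda>f. homotopy_class k Y (p x) (restrict (p \<circ> f) (topspace (cube k)))"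
  have "?c f' = ?c f" if "f' \<in> homotopy_class k X x f" for f'
  proof -
    have f': "f' \<in> cube_maps k X x" and ff': "cube_homotopy k X (\<lambda>_. x) f f'"
      using that by (auto simp: mem_homotopy_class_iff cube_homotopy_rel_iff)
    have "cube_homotopy k Y (\<lambda>_. p x) (restrict (p \<circ> f) (topspace (cube k))) (restrict (p \<circ> f') (topspace (cube k)))"
      using cube_homotopy_compose[OF p ff'] unfolding comp_def[of p "\<lambda>_. x"] .
    with compose_in_cube_maps[OF p f] compose_in_cube_maps[OF p f']
    have "(restrict (p \<circ> f) (topspace (cube k)), restrict (p \<circ> f') (topspace (cube k)))
        \<in> cube_homotopy_rel k Y (p x)"
      unfolding cube_homotopy_rel_iff by (intro conjI)
    then show ?thesis by (rule homotopy_class_eqI[symmetric])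
  qed
  then have "(\<Union>f'\<in>homotopy_class k X x f. ?c f') = ?c f"
    by (rule UN_const_on[OF homotopy_class_self[OF f]])
  then show ?thesis by (simp only: homotopy_induced_def homotopy_class_def)
qed

lemma restrict_compose_cube_concat:
  assumes "1 \<le> k"
  shows "restrict (p \<circ> cube_concat k f g) (topspace (cube k)) =
    cube_concat k (restrict (p \<circ> f) (topspace (cube k))) (restrict (p \<circ> g) (topspace (cube k)))"
proof
  fix t
  show "restrict (p \<circ> cube_concat k f g) (topspace (cube k)) t =
    cube_concat k (restrict (p \<circ> f) (topspace (cube k))) (restrict (p \<circ> g) (topspace (cube k))) t"
  proof (cases "t \<in> topspace (cube k)")
    case True
    have "0 < k" using assms by simp
    then have "0 \<le> t 0 \<and> t 0 \<le> 1" by (rule cube_coordinate[OF True])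
    then have "t 0 \<le> 1/2 \<Longrightarrow> t(0 := 2 * t 0) \<in> topspace (cube k)"
      "\<not> t 0 \<le> 1/2 \<Longrightarrow> t(0 := 2 * t 0 - 1) \<in> topspace (cube k)"
      using cube_upd[OF True \<open>0 < k\<close>] by simp_all
    with True show ?thesis by (simp add: cube_concat_def)
  qed (simp add: cube_concat_def)
qed

lemma homotopy_induced_hom:
  assumes k: "1 \<le> k" and p: "continuous_map X Y p"
  shows "homotopy_induced k Y p x \<in> hom (homotopy_group k X x) (homotopy_group k Y (p x))"
proof (rule homI)
  show "homotopy_induced k Y p x A \<in> carrier (homotopy_group k Y (p x))"
    if "A \<in> carrier (homotopy_group k X x)" for A
    using that compose_in_cube_maps[OF p]
    by (auto simp: carrier_homotopy_group homotopy_induced_class[OF p])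
  fix A B assume "A \<in> carrier (homotopy_group k X x)" "B \<in> carrier (homotopy_group k X x)"
  then obtain f g where "f \<in> cube_maps k X x" "g \<in> cube_maps k X x"
    "A = homotopy_class k X x f" "B = homotopy_class k X x g"
    by (auto simp: carrier_homotopy_group)
  then show "homotopy_induced k Y p x (A \<otimes>\<^bsub>homotopy_group k X x\<^esub> B) =
      homotopy_induced k Y p x A \<otimes>\<^bsub>homotopy_group k Y (p x)\<^esub> homotopy_induced k Y p x B"
    using k by (simp add: mult_homotopy_class homotopy_induced_class[OF p] cube_concat_in_cube_maps
        compose_in_cube_maps[OF p] restrict_compose_cube_concat)
qed

section \<open>Cubes as compact metric spaces\<close>

text \<open>The product topology on extensional functions is the subspace topology of \<open>nat \<Rightarrow> real\<close>,
  which is a metric space. This makes uniform continuity available on cubes of every dimension.\<close>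

lemma cube_eq_top_of_set: "cube k = top_of_set (topspace (cube k))"
proof -
  let ?C = "topspace (cube k)"
  have "continuous_map (cube k) (product_topology (\<lambda>_. euclideanreal) UNIV) (\<lambda>t. t)"
    unfolding continuous_map_componentwise_UNIV
  proof
    fix i
    show "continuous_map (cube k) euclideanreal (\<lambda>t. t i)"
    proof (cases "i < k")
      case True
      then show ?thesis by (intro continuous_map_cube_coordinate[OF continuous_map_id[unfolded id_def]])
    next
      case False
      have "continuous_map (cube k) euclideanreal (\<lambda>t. undefined)" by simp
      then show ?thesis
        by (rule continuous_map_eq) (use False in \<open>auto simp: topspace_cube PiE_iff extensional_def\<close>)
    qed
  qed
  then have "continuous_map (cube k) euclidean (\<lambda>t. t)"
    unfolding euclidean_product_topology .
  then have 1: "continuous_map (cube k) (top_of_set ?C) (\<lambda>t. t)"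
    by (rule continuous_map_into_subtopology) simp
  have "continuous_map (top_of_set ?C) (product_topology (\<lambda>_. top_of_set {0..1}) {..<k}) (\<lambda>t. t)"
    unfolding continuous_map_componentwise
  proof (intro conjI ballI)
    show "(\<lambda>t. t) ` topspace (top_of_set ?C) \<subseteq> extensional {..<k}"
      unfolding topspace_cube by (simp add: PiE_iff subset_iff)
    fix i assume "i \<in> {..<k}"
    then have "(\<lambda>t. t i) \<in> ?C \<rightarrow> {0..1}" by (simp add: cube_coordinate)
    moreover have "continuous_on ?C (\<lambda>t. t i)"
      by (rule continuous_on_product_then_coordinatewise[OF continuous_on_id])
    ultimately show "continuous_map (top_of_set ?C) (top_of_set {0..1}) (\<lambda>t. t i)"
      unfolding continuous_map_subtopology_eu by simp
  qed
  then have 2: "continuous_map (top_of_set ?C) (cube k) (\<lambda>t. t)"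
    unfolding cube_def[of k, symmetric] .
  show ?thesis
    unfolding topology_eq
  proof (intro allI iffI)
    fix S
    show "openin (top_of_set ?C) S" if S: "openin (cube k) S"
    proof -
      have "openin (top_of_set ?C) {x \<in> topspace (top_of_set ?C). x \<in> S}"
        using 2 S by (rule openin_continuous_map_preimage)
      moreover have "{x \<in> topspace (top_of_set ?C). x \<in> S} = S"
        using openin_subset[OF S] by auto
      ultimately show ?thesis by simp
    qed
    show "openin (cube k) S" if S: "openin (top_of_set ?C) S"
    proof -
      have "openin (cube k) {x \<in> topspace (cube k). x \<in> S}"
        using 1 S by (rule openin_continuous_map_preimage)
      moreover have "{x \<in> topspace (cube k). x \<in> S} = S"
        using openin_subset[OF S] by auto
      ultimately show ?thesis by simp
    qed
  qed
qed

lemma compact_cube: "compact (topspace (cube k))"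
proof -
  have "compact_space (cube k)"
    unfolding cube_def by (simp add: compact_space_product_topology compact_space_subtopology)
  then have "compact_space (top_of_set (topspace (cube k)))"
    by (simp only: cube_eq_top_of_set[symmetric])
  then show ?thesis by (simp add: compact_space_def compactin_subtopology compactin_euclidean_iff)
qed

lemma prod_cube_eq_top_of_set:
  "prod_topology (top_of_set {0..1::real}) (cube k) = top_of_set ({0..1} \<times> topspace (cube k))"
  by (subst cube_eq_top_of_set) (simp add: subtopology_Times[symmetric])

lemma continuous_map_S2_iff:
  "continuous_map (top_of_set S) S2 f \<longleftrightarrow> continuous_on S f \<and> (\<forall>z\<in>S. norm (f z) = 1)"
  by (auto simp: Pi_iff)

lemma cube_maps_S2_iff:
  "f \<in> cube_maps k S2 y \<longleftrightarrow> f \<in> extensional (topspace (cube k)) \<and> continuous_on (topspace (cube k)) f \<and>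
     (\<forall>t\<in>topspace (cube k). norm (f t) = 1) \<and> (\<forall>t\<in>cube_boundary k. f t = y)"
proof -
  have "continuous_map (cube k) S2 f \<longleftrightarrow> continuous_on (topspace (cube k)) f \<and> (\<forall>z\<in>topspace (cube k). norm (f z) = 1)"
    by (subst cube_eq_top_of_set) (rule continuous_map_S2_iff)
  then show ?thesis by (simp add: cube_maps_def)
qed

lemma cube_homotopy_S2_iff:
  "cube_homotopy k S2 \<gamma> f g \<longleftrightarrow>
     (\<exists>h. continuous_on ({0..1} \<times> topspace (cube k)) h \<and> (\<forall>z\<in>{0..1} \<times> topspace (cube k). norm (h z) = 1) \<and>
        (\<forall>t\<in>topspace (cube k). h (0, t) = f t \<and> h (1, t) = g t) \<and>
        (\<forall>s\<in>{0..1}. \<forall>t\<in>cube_boundary k. h (s, t) = \<gamma> s))"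
  unfolding cube_homotopy_def prod_cube_eq_top_of_set continuous_map_S2_iff by (simp only: conj_assoc)

lemma cube_homotopy_S2I:
  assumes "continuous_on ({0..1} \<times> topspace (cube k)) h"
    and "\<And>s t. s \<in> {0..1} \<Longrightarrow> t \<in> topspace (cube k) \<Longrightarrow> norm (h (s, t)) = 1"
    and "\<And>t. t \<in> topspace (cube k) \<Longrightarrow> h (0, t) = f t" "\<And>t. t \<in> topspace (cube k) \<Longrightarrow> h (1, t) = g t"
    and "\<And>s t. s \<in> {0..1} \<Longrightarrow> t \<in> cube_boundary k \<Longrightarrow> h (s, t) = \<gamma> s"
  shows "cube_homotopy k S2 \<gamma> f g"
  unfolding cube_homotopy_S2_iff using assms by (intro exI[of _ h]) auto

lemma cube_homotopy_S2E:
  assumes "cube_homotopy k S2 \<gamma> f g"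
  obtains h where "continuous_on ({0..1} \<times> topspace (cube k)) h"
    "\<forall>s\<in>{0..1}. \<forall>t\<in>topspace (cube k). norm (h (s, t)) = 1"
    "\<forall>t\<in>topspace (cube k). h (0, t) = f t" "\<forall>t\<in>topspace (cube k). h (1, t) = g t"
    "\<forall>s\<in>{0..1}. \<forall>t\<in>cube_boundary k. h (s, t) = \<gamma> s"
proof -
  obtain h where h: "continuous_on ({0..1} \<times> topspace (cube k)) h \<and> (\<forall>z\<in>{0..1} \<times> topspace (cube k). norm (h z) = 1) \<and>
        (\<forall>t\<in>topspace (cube k). h (0, t) = f t \<and> h (1, t) = g t) \<and>
        (\<forall>s\<in>{0..1}. \<forall>t\<in>cube_boundary k. h (s, t) = \<gamma> s)"
    using assms unfolding cube_homotopy_S2_iff by (rule exE)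
  show thesis by (rule that[of h]) (use h in \<open>auto\<close>)
qed

section \<open>The degree on the second homotopy group\<close>

text \<open>The point of the 2-cube with given coordinates, extensional as required by \<open>cube\<close>.\<close>

definition square_point :: "real \<times> real \<Rightarrow> nat \<Rightarrow> real" where
  "square_point z = (\<lambda>i. if i = 0 then fst z else if i = 1 then snd z else undefined)"

lemma square_point_simps [simp]: "square_point z 0 = fst z" "square_point z (Suc 0) = snd z"
  by (simp_all add: square_point_def)

lemma square_point_extensional: "square_point z \<in> extensional {..<2}"
  unfolding extensional_def square_point_def by simp

lemma square_point_in_cube: "square_point z \<in> topspace (cube 2) \<longleftrightarrow> z \<in> {0..1} \<times> {0..1}"
proof -
  have "{..<2::nat} = {0, Suc 0}" by auto
  then show ?thesis
    unfolding topspace_cube PiE_iff using square_point_extensional[of z]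
    by (simp add: mem_Times_iff)
qed

lemma square_point_in_boundary:
  "square_point (a, b) \<in> cube_boundary 2 \<longleftrightarrow> a \<in> {0..1} \<and> b \<in> {0..1} \<and> (a \<in> {0, 1} \<or> b \<in> {0, 1})"
proof -
  have "(\<exists>i<2. P i) \<longleftrightarrow> P 0 \<or> P (Suc 0)" for P :: "nat \<Rightarrow> bool"
    by (auto simp: numeral_2_eq_2 Ex_less_Suc)
  then show ?thesis
    unfolding cube_boundary_def mem_Collect_eq square_point_in_cube by auto
qed

lemma boundary_cube_2:
  assumes "t \<in> cube_boundary 2"
  shows "t \<in> topspace (cube 2)" "t 0 \<in> {0, 1} \<or> t 1 \<in> {0, 1}"
  using assms unfolding cube_boundary_def by (simp_all add: numeral_2_eq_2 Ex_less_Suc) blast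

lemma square_point_surj:
  assumes "t \<in> topspace (cube 2)" shows "square_point (t 0, t 1) = t"
proof (rule extensionalityI[OF square_point_extensional])
  show "t \<in> extensional {..<2}" using assms by (simp add: topspace_cube PiE_iff)
  fix i :: nat assume "i \<in> {..<2}"
  then have "i = 0 \<or> i = 1" by auto
  then show "square_point (t 0, t 1) i = t i" by (auto simp: square_point_def)
qed

lemma continuous_on_square_point [continuous_intros]:
  assumes "continuous_on S (f :: 'a::topological_space \<Rightarrow> real \<times> real)"
  shows "continuous_on S (\<lambda>x. square_point (f x))"
proof (rule continuous_on_coordinatewise_then_product)
  fix i :: nat
  consider "i = 0" | "i = 1" | "i \<noteq> 0" "i \<noteq> 1" by blast
  then show "continuous_on S (\<lambda>x. square_point (f x) i)"
    unfolding square_point_def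
    by cases (simp_all add: continuous_on_fst[OF assms] continuous_on_snd[OF assms])
qed

definition cube_degree :: "((nat \<Rightarrow> real) \<Rightarrow> real^3) \<Rightarrow> int" where
  "cube_degree f = (THE d. sphere_degree (\<lambda>z. f (square_point z)) d)"

lemma cube_degree_eqI: "sphere_degree (\<lambda>z. f (square_point z)) d \<Longrightarrow> cube_degree f = d"
  unfolding cube_degree_def by (rule the_equality) (assumption, rule sphere_degree_unique)

lemma cube_homotopy_degree:
  assumes "cube_homotopy 2 S2 \<gamma> f g"
  obtains d where "sphere_degree (\<lambda>z. f (square_point z)) d" "sphere_degree (\<lambda>z. g (square_point z)) d"
proof -
  obtain h where h': "continuous_on ({0..1} \<times> topspace (cube 2)) h"
    "\<forall>s\<in>{0..1}. \<forall>t\<in>topspace (cube 2). norm (h (s, t)) = 1"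
    "\<forall>t\<in>topspace (cube 2). h (0, t) = f t" "\<forall>t\<in>topspace (cube 2). h (1, t) = g t"
    "\<forall>s\<in>{0..1}. \<forall>t\<in>cube_boundary 2. h (s, t) = \<gamma> s"
    using assms by (rule cube_homotopy_S2E)
  note h = h'[rule_format]
  define H where "H z = h (fst z, square_point (snd z))" for z
  have H1: "continuous_on ({0..1} \<times> {0..1} \<times> {0..1}) H"
    unfolding H_def
    by (intro continuous_on_compose2[OF h(1)] continuous_intros) (auto simp: square_point_in_cube mem_Times_iff)
  have H2: "H z \<in> sphere 0 1" if "z \<in> {0..1} \<times> {0..1} \<times> {0..1}" for z
  proof -
    obtain s w where z: "z = (s, w)" by (cases z)
    have "square_point w \<in> topspace (cube 2)" "s \<in> {0..1}" using that unfolding square_point_in_cube z by auto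
    from h(2)[OF this(2,1)] show ?thesis unfolding H_def z fst_conv snd_conv by simp
  qed
  have H3: "H (s, a, b) = \<gamma> s" if "s \<in> {0..1}" "a \<in> {0..1}" "b \<in> {0..1}" "a \<in> {0, 1} \<or> b \<in> {0, 1}" for s a b
  proof -
    have "square_point (a, b) \<in> cube_boundary 2" using that unfolding square_point_in_boundary by blast
    from h(5)[OF that(1) this] show ?thesis unfolding H_def fst_conv snd_conv .
  qed
  obtain d where d: "sphere_degree (\<lambda>z. H (0, z)) d" "sphere_degree (\<lambda>z. H (1, z)) d"
    by (rule degree_family[OF H1 H2 H3])
  have "H (0, z) = f (square_point z)" "H (1, z) = g (square_point z)" if "z \<in> {0..1} \<times> {0..1}" for z
    unfolding H_def fst_conv snd_conv using that
    by (rule h(3)[OF square_point_in_cube[THEN iffD2]], rule h(4)[OF square_point_in_cube[THEN iffD2]])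
  then show thesis
    by (rule that[OF sphere_degree_cong[OF d(1)] sphere_degree_cong[OF d(2)]])
qed

lemma cube_degree_homotopy: "cube_homotopy 2 S2 \<gamma> f g \<Longrightarrow> cube_degree f = cube_degree g"
  by (erule cube_homotopy_degree) (simp only: cube_degree_eqI)

lemma sphere_degree_cube_degree:
  assumes "f \<in> cube_maps 2 S2 y" shows "sphere_degree (\<lambda>z. f (square_point z)) (cube_degree f)"
proof -
  obtain d where d: "sphere_degree (\<lambda>z. f (square_point z)) d"
    by (rule cube_homotopy_degree[OF cube_homotopy_refl[OF assms]])
  then show ?thesis by (simp only: cube_degree_eqI[OF d])
qed

lemma cube_degree_concat:
  assumes f: "f \<in> cube_maps 2 S2 y" and g: "g \<in> cube_maps 2 S2 y"
  shows "cube_degree (cube_concat 2 f g) = cube_degree f + cube_degree g"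
proof (rule cube_degree_eqI, rule sphere_degree_cong)
  have "square_point (0, 0) \<in> cube_boundary 2" by (simp add: square_point_in_boundary)
  then have "f (square_point (0, 0)) = g (square_point (0, 0))"
    using cube_mapsD(3)[OF f] cube_mapsD(3)[OF g] by simp
  then show "sphere_degree (\<lambda>(a, b). if a \<le> 1/2 then f (square_point (2 * a, b)) else g (square_point (2 * a - 1, b)))
      (cube_degree f + cube_degree g)"
    by (rule sphere_degree_concat[OF sphere_degree_cube_degree[OF f] sphere_degree_cube_degree[OF g]])
  have upd: "(square_point z)(0 := r) = square_point (r, snd z)" for z r
    by (auto simp: square_point_def)
  fix z :: "real \<times> real" assume "z \<in> {0..1} \<times> {0..1}"
  then show "(case z of (a, b) \<Rightarrow> if a \<le> 1/2 then f (square_point (2 * a, b)) else g (square_point (2 * a - 1, b)))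
      = cube_concat 2 f g (square_point z)"
    by (simp add: cube_concat_def square_point_in_cube upd split: prod.split)
qed

lemma cube_degree_antipode:
  assumes "f \<in> cube_maps 2 S2 y"
  shows "cube_degree (restrict (uminus \<circ> f) (topspace (cube 2))) = - cube_degree f"
  by (rule cube_degree_eqI, rule sphere_degree_cong[OF sphere_degree_antipode[OF sphere_degree_cube_degree[OF assms]]])
     (simp add: square_point_in_cube)

lemma cube_homotopic_of_equal_degree:
  assumes f: "f \<in> cube_maps 2 S2 y" and g: "g \<in> cube_maps 2 S2 y" and "cube_degree f = cube_degree g"
  shows "(f, g) \<in> cube_homotopy_rel 2 S2 y"
proof -
  let ?Q = "{0..1::real} \<times> {0..1::real}"
  have "square_point (0, 0) \<in> cube_boundary 2" by (simp add: square_point_in_boundary)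
  then have f0: "f (square_point (0, 0)) = y" "f (square_point (0, 0)) = g (square_point (0, 0))"
    using cube_mapsD(3)[OF f] cube_mapsD(3)[OF g] by simp_all
  note deg = sphere_degree_cube_degree[OF f] sphere_degree_cube_degree[OF g, folded assms(3)]
  obtain H :: "real \<times> real \<times> real \<Rightarrow> real^3" where H: "continuous_on ({0..1} \<times> ?Q) H" "H ` ({0..1} \<times> ?Q) \<subseteq> sphere 0 1"
    "\<And>z. z \<in> ?Q \<Longrightarrow> H (0, z) = f (square_point z)" "\<And>z. z \<in> ?Q \<Longrightarrow> H (1, z) = g (square_point z)"
    "\<And>s a b. s \<in> {0..1} \<Longrightarrow> a \<in> {0..1} \<Longrightarrow> b \<in> {0..1} \<Longrightarrow> a \<in> {0, 1} \<or> b \<in> {0, 1} \<Longrightarrow> H (s, a, b) = y"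
    by (rule equal_degree_homotopic[OF deg f0(2), unfolded f0(1)]) (rule that; assumption)
  have "cube_homotopy 2 S2 (\<lambda>_. y) f g"
  proof (rule cube_homotopy_S2I[where h="\<lambda>x. H (fst x, snd x 0, snd x 1)"])
    have "continuous_on ({0..1::real} \<times> topspace (cube 2)) (\<lambda>x. snd x i)" for i
      by (rule continuous_on_product_then_coordinatewise) (intro continuous_intros)
    then show "continuous_on ({0..1} \<times> topspace (cube 2)) (\<lambda>x. H (fst x, snd x 0, snd x 1))"
      by (intro continuous_on_compose2[OF H(1)] continuous_on_Pair continuous_on_fst continuous_on_id)
         (auto simp: cube_coordinate)
    fix t assume t: "t \<in> topspace (cube 2)"
    then have tQ: "(t 0, t 1) \<in> ?Q" by (simp add: cube_coordinate)
    show "H (fst (0, t), snd (0, t) 0, snd (0, t) 1) = f t"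
      using H(3)[OF tQ] by (simp only: fst_conv snd_conv square_point_surj[OF t])
    show "H (fst (1, t), snd (1, t) 0, snd (1, t) 1) = g t"
      using H(4)[OF tQ] by (simp only: fst_conv snd_conv square_point_surj[OF t])
    fix s :: real assume s: "s \<in> {0..1}"
    have "(s, t 0, t 1) \<in> {0..1} \<times> ?Q" using s tQ by simp
    then have "H (s, t 0, t 1) \<in> sphere 0 1" using H(2) by blast
    then show "norm (H (fst (s, t), snd (s, t) 0, snd (s, t) 1)) = 1" by simp
  next
    fix s :: real and t assume s: "s \<in> {0..1}" and t: "t \<in> cube_boundary 2"
    then have "t \<in> topspace (cube 2)" "t 0 \<in> {0, 1} \<or> t 1 \<in> {0, 1}"
      using boundary_cube_2[OF t] by blast+
    then show "H (fst (s, t), snd (s, t) 0, snd (s, t) 1) = y"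
      using H(5)[OF s, of "t 0" "t 1"] by (simp add: cube_coordinate)
  qed
  then show ?thesis using f g by (simp add: cube_homotopy_rel_iff)
qed

lemma cube_degree_realised:
  assumes "norm y = 1"
  obtains f where "f \<in> cube_maps 2 S2 y" "cube_degree f = d"
proof -
  let ?Q = "{0..1::real} \<times> {0..1::real}"
  obtain f where f: "continuous_on ?Q f" "f ` ?Q \<subseteq> sphere 0 1" "sphere_degree f d"
    "\<And>a b. a \<in> {0..1} \<Longrightarrow> b \<in> {0..1} \<Longrightarrow> a \<in> {0, 1} \<or> b \<in> {0, 1} \<Longrightarrow> f (a, b) = y"
    by (rule sphere_degree_realised[OF assms, where d=d]) (rule that; assumption)
  define g where "g = restrict (\<lambda>t. f (t 0, t 1)) (topspace (cube 2))"
  have tQ: "(t 0, t 1) \<in> ?Q" if "t \<in> topspace (cube 2)" for t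
    using that by (simp add: cube_coordinate)
  have "continuous_on (topspace (cube 2)) (\<lambda>t. f (t 0, t 1))"
    by (intro continuous_on_compose2[OF f(1)] continuous_on_Pair
        continuous_on_product_then_coordinatewise[OF continuous_on_id]) (use tQ in auto)
  then have "continuous_on (topspace (cube 2)) g"
    by (simp add: g_def cong: continuous_on_cong)
  moreover have "norm (g t) = 1" if "t \<in> topspace (cube 2)" for t
  proof -
    have "f (t 0, t 1) \<in> sphere 0 1" using f(2) tQ[OF that] by blast
    then show ?thesis using that by (simp add: g_def)
  qed
  moreover have "g t = y" if "t \<in> cube_boundary 2" for t
  proof -
    have "t \<in> topspace (cube 2)" "t 0 \<in> {0, 1} \<or> t 1 \<in> {0, 1}"
      using boundary_cube_2[OF that] by blast+
    then show ?thesis using f(4)[of "t 0" "t 1"] by (simp add: g_def cube_coordinate)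
  qed
  ultimately have "g \<in> cube_maps 2 S2 y"
    unfolding cube_maps_S2_iff by (simp add: g_def)
  moreover have "cube_degree g = d"
    by (rule cube_degree_eqI, rule sphere_degree_cong[OF f(3)]) (simp add: g_def square_point_in_cube)
  ultimately show thesis by (rule that)
qed

section \<open>Rotations and the change of basepoint\<close>

text \<open>The default simplification would replace products with a transposed matrix on the left by
  \<open>v*\<close>, which hides the associativity used below.\<close>

declare transpose_matrix_vector [simp del]

text \<open>The orthogonal matrix with last row \<open>hopf F\<close>. Up to conventions it is the rotation given
  by the unit quaternion \<open>F\<close> in the parametrisation of Euler and Rodrigues.\<close>

definition hopf_frame :: "complex \<times> complex \<Rightarrow> real^3^3" where
  "hopf_frame F = (let z = fst F; w = snd F in
     vector [vector [Re (z\<^sup>2 - w\<^sup>2), - Im (z\<^sup>2 + w\<^sup>2), - 2 * Re (z * w)],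
             vector [Im (z\<^sup>2 - w\<^sup>2), Re (z\<^sup>2 + w\<^sup>2), - 2 * Im (z * w)],
             hopf F])"

text \<open>An orthogonal map that takes \<open>hopf F\<close> to \<open>hopf G\<close> and depends continuously on \<open>F\<close> and \<open>G\<close>.
  Transport of maps into the sphere along a path is composition with these maps, which
  replaces the homotopy extension property.\<close>

definition fibre_rotation :: "complex \<times> complex \<Rightarrow> complex \<times> complex \<Rightarrow> real^3 \<Rightarrow> real^3" where
  "fibre_rotation F G v = transpose (hopf_frame G) *v (hopf_frame F *v v)"

lemma orthogonal_hopf_frame:
  assumes "norm F = 1" shows "hopf_frame F ** transpose (hopf_frame F) = mat 1"
proof -
  obtain a b c d where F: "F = (Complex a b, Complex c d)"
    by (metis complex_surj prod.collapse)
  have "a\<^sup>2 + b\<^sup>2 + c\<^sup>2 + d\<^sup>2 = 1"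
    using norm_C2_sq[of F] assms by (simp add: F cmod_power2)
  then have d2: "d\<^sup>2 = 1 - a\<^sup>2 - b\<^sup>2 - c\<^sup>2" by simp
  show ?thesis
    unfolding vec_eq_iff forall_3 matrix_matrix_mult_def transpose_def mat_def hopf_frame_def Let_def sum_3
    using d2 by (simp add: F cmod_power2 power2_eq_square[of "Complex _ _"]; algebra)
qed

lemma orthogonal_hopf_frame':
  "norm F = 1 \<Longrightarrow> transpose (hopf_frame F) ** hopf_frame F = mat 1"
  using orthogonal_hopf_frame matrix_left_right_inverse by blast

lemma fibre_rotation_compose:
  assumes "norm G = 1"
  shows "fibre_rotation G H (fibre_rotation F G v) = fibre_rotation F H v"
proof -
  have "hopf_frame G *v (transpose (hopf_frame G) *v w) = w" for w
    by (simp add: matrix_vector_mul_assoc orthogonal_hopf_frame[OF assms])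
  then show ?thesis by (simp add: fibre_rotation_def)
qed

lemma fibre_rotation_self: "norm F = 1 \<Longrightarrow> fibre_rotation F F v = v"
  by (simp add: fibre_rotation_def matrix_vector_mul_assoc orthogonal_hopf_frame')

lemma norm_fibre_rotation:
  assumes "norm F = 1" "norm G = 1" shows "norm (fibre_rotation F G v) = norm v"
proof -
  have "norm (hopf_frame F *v v) = norm v"
    using orthogonal_hopf_frame[OF assms(1)] orthogonal_hopf_frame'[OF assms(1)]
    by (intro orthogonal_transformation_norm)
       (simp add: orthogonal_transformation_matrix orthogonal_matrix_def)
  moreover have "norm (transpose (hopf_frame G) *v w) = norm w" for w
    using orthogonal_hopf_frame[OF assms(2)] orthogonal_hopf_frame'[OF assms(2)]
    by (intro orthogonal_transformation_norm)
       (simp add: orthogonal_transformation_matrix orthogonal_matrix_def)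
  ultimately show ?thesis by (simp add: fibre_rotation_def)
qed

lemma fibre_rotation_hopf:
  assumes "norm F = 1" shows "fibre_rotation F G (hopf F) = hopf G"
proof -
  have row: "hopf F = transpose (hopf_frame F) *v axis 3 1" for F
    by (simp add: vec_eq_iff forall_3 matrix_vector_mult_def transpose_def axis_def sum_3 hopf_frame_def Let_def)
  have "hopf_frame F *v hopf F = axis 3 1"
    by (subst row) (simp add: matrix_vector_mul_assoc orthogonal_hopf_frame[OF assms])
  then show ?thesis by (simp add: fibre_rotation_def row[of G, symmetric])
qed

lemma continuous_on_fibre_rotation [continuous_intros]:
  assumes "continuous_on S F" "continuous_on S G" "continuous_on S v"
  shows "continuous_on S (\<lambda>x. fibre_rotation (F x) (G x) (v x))"
proof -
  have frame: "continuous_on S (\<lambda>x. hopf_frame (F x) $ i $ j)" if F: "continuous_on S F" for F i j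
  proof -
    have "continuous_on S (\<lambda>x. hopf (F x) $ j)" by (intro continuous_on_component continuous_intros F)
    moreover have "i = 1 \<or> i = 2 \<or> i = 3" "j = 1 \<or> j = 2 \<or> j = 3" by (rule exhaust_3)+
    ultimately show ?thesis
      by (elim disjE; simp add: hopf_frame_def Let_def del: hopf_simps)
         (intro continuous_intros F)+
  qed
  have "continuous_on S (\<lambda>x. v x $ i)" for i by (intro continuous_on_component assms)
  then have "continuous_on S (\<lambda>x. fibre_rotation (F x) (G x) (v x) $ i)" for i
    unfolding fibre_rotation_def matrix_vector_mult_def transpose_def sum_3 vec_lambda_beta
    by (intro continuous_on_add continuous_on_mult frame assms)
  then show ?thesis
    using continuous_on_vec_lambda[where f="\<lambda>i x. fibre_rotation (F x) (G x) (v x) $ i" and S=S] by simp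
qed

definition rotate_map ::
  "nat \<Rightarrow> complex \<times> complex \<Rightarrow> complex \<times> complex \<Rightarrow> ((nat \<Rightarrow> real) \<Rightarrow> real^3) \<Rightarrow> (nat \<Rightarrow> real) \<Rightarrow> real^3" where
  "rotate_map k F G f = restrict (fibre_rotation F G \<circ> f) (topspace (cube k))"

lemma continuous_map_fibre_rotation:
  "norm F = 1 \<Longrightarrow> norm G = 1 \<Longrightarrow> continuous_map S2 S2 (fibre_rotation F G)"
  unfolding continuous_map_S2_iff by (auto simp: norm_fibre_rotation intro!: continuous_intros)

lemma rotate_map_in_cube_maps:
  assumes "norm F = 1" "norm G = 1" "f \<in> cube_maps k S2 (hopf F)"
  shows "rotate_map k F G f \<in> cube_maps k S2 (hopf G)"
  using compose_in_cube_maps[OF continuous_map_fibre_rotation[OF assms(1,2)] assms(3)]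
  unfolding rotate_map_def fibre_rotation_hopf[OF assms(1)] .

lemma rotate_map_respects:
  assumes "norm F = 1" "norm G = 1" "(f, g) \<in> cube_homotopy_rel k S2 (hopf F)"
  shows "(rotate_map k F G f, rotate_map k F G g) \<in> cube_homotopy_rel k S2 (hopf G)"
proof -
  have f: "f \<in> cube_maps k S2 (hopf F)" and g: "g \<in> cube_maps k S2 (hopf F)"
    and h: "cube_homotopy k S2 (\<lambda>_. hopf F) f g"
    using assms(3) unfolding cube_homotopy_rel_iff by simp_all
  have "cube_homotopy k S2 (\<lambda>_. hopf G) (rotate_map k F G f) (rotate_map k F G g)"
    using cube_homotopy_compose[OF continuous_map_fibre_rotation[OF assms(1,2)] h]
    unfolding rotate_map_def comp_def[of "fibre_rotation F G" "\<lambda>_. hopf F"] fibre_rotation_hopf[OF assms(1)] .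
  then show ?thesis
    unfolding cube_homotopy_rel_iff using rotate_map_in_cube_maps[OF assms(1,2)] f g by blast
qed

lemma rotate_map_compose:
  "norm G = 1 \<Longrightarrow> rotate_map k G H (rotate_map k F G f) = rotate_map k F H f"
  unfolding rotate_map_def by (rule restrict_ext) (simp add: fibre_rotation_compose)

lemma rotate_map_self:
  assumes "norm F = 1" "f \<in> cube_maps k S2 y" shows "rotate_map k F F f = f"
proof (rule extensionalityI)
  show "rotate_map k F F f \<in> extensional (topspace (cube k))"
    unfolding rotate_map_def by (rule restrict_extensional)
  show "f \<in> extensional (topspace (cube k))" by (rule cube_mapsD(2)[OF assms(2)])
qed (simp add: rotate_map_def fibre_rotation_self assms(1))

text \<open>Two choices of \<open>G\<close> in one fibre are joined inside that fibre, and the rotations along the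
  way all send the basepoint to the same point. In particular the transport along a path
  depends only on its end points, as it must in a simply connected space.\<close>

lemma rotate_map_fibre_independent:
  assumes f: "f \<in> cube_maps k S2 (hopf F)" and n: "norm F = 1" "norm G = 1" "norm G' = 1"
    and eq: "hopf G = hopf G'"
  shows "(rotate_map k F G f, rotate_map k F G' f) \<in> cube_homotopy_rel k S2 (hopf G)"
proof -
  define c where "c = hermitian G' G"
  have c: "G' = phase c G" "cmod c = 1"
    using same_fibre[OF n(2,3) eq] by (simp_all add: c_def)
  then have c_cis: "c = cis (Arg c)"
    by (metis cis_Arg norm_zero sgn_eq zero_neq_one div_by_1 of_real_1)
  note cont_f = cube_maps_S2_iff[THEN iffD1, OF f, THEN conjunct2, THEN conjunct1]
  have norm_f: "norm (f t) = 1" if "t \<in> topspace (cube k)" for t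
    using f that unfolding cube_maps_S2_iff by blast
  have "cube_homotopy k S2 (\<lambda>_. hopf G) (rotate_map k F G f) (rotate_map k F G' f)"
  proof (rule cube_homotopy_S2I[where h="\<lambda>x. fibre_rotation F (phase (cis (fst x * Arg c)) G) (f (snd x))"])
    show "continuous_on ({0..1} \<times> topspace (cube k))
        (\<lambda>x. fibre_rotation F (phase (cis (fst x * Arg c)) G) (f (snd x)))"
      unfolding cis_conv_exp
      by (intro continuous_intros continuous_on_compose2[OF cont_f]) auto
    show "norm (fibre_rotation F (phase (cis (fst (s, t) * Arg c)) G) (f (snd (s, t)))) = 1"
      if "t \<in> topspace (cube k)" for s t
      using norm_f[OF that] by (simp add: norm_fibre_rotation n)
    show "fibre_rotation F (phase (cis (fst (0, t) * Arg c)) G) (f (snd (0, t))) = rotate_map k F G f t"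
      if "t \<in> topspace (cube k)" for t
      using that by (simp add: rotate_map_def)
    show "fibre_rotation F (phase (cis (fst (1, t) * Arg c)) G) (f (snd (1, t))) = rotate_map k F G' f t"
      if "t \<in> topspace (cube k)" for t
      using that by (simp add: rotate_map_def c(1) c_cis[symmetric])
    show "fibre_rotation F (phase (cis (fst (s, t) * Arg c)) G) (f (snd (s, t))) = hopf G"
      if "t \<in> cube_boundary k" for s t
      using cube_mapsD(3)[OF f that] by (simp add: fibre_rotation_hopf n hopf_phase)
  qed
  then show ?thesis
    using rotate_map_in_cube_maps[OF n(1,2) f] rotate_map_in_cube_maps[OF n(1,3) f]
    by (simp add: cube_homotopy_rel_iff eq)
qed

lemma cube_boundary_nonempty: "1 \<le> k \<Longrightarrow> (\<lambda>i. if i < k then 0 else undefined) \<in> cube_boundary k"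
  by (auto simp: cube_boundary_def topspace_cube PiE_iff extensional_def intro!: exI[of _ 0])

lemma cube_homotopy_path:
  assumes "1 \<le> k" "cube_homotopy k S2 \<gamma> f g"
  shows "continuous_on {0..1} \<gamma>" "\<And>s. s \<in> {0..1} \<Longrightarrow> norm (\<gamma> s) = 1"
proof -
  obtain h where h: "continuous_on ({0..1} \<times> topspace (cube k)) h"
    "\<forall>s\<in>{0..1}. \<forall>t\<in>topspace (cube k). norm (h (s, t)) = 1"
    "\<forall>s\<in>{0..1}. \<forall>t\<in>cube_boundary k. h (s, t) = \<gamma> s"
    using assms(2) by (rule cube_homotopy_S2E)
  obtain t where t: "t \<in> cube_boundary k" using cube_boundary_nonempty[OF assms(1)] by blast
  then have t': "t \<in> topspace (cube k)" using cube_boundary_subset by blast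
  have \<gamma>: "\<gamma> s = h (s, t)" if "s \<in> {0..1}" for s
    using h(3) that t by simp
  have "continuous_on {0..1} (\<lambda>s. h (s, t))"
    by (intro continuous_on_compose2[OF h(1)] continuous_intros) (use t' in auto)
  then show "continuous_on {0..1} \<gamma>"
    by (rule continuous_on_eq) (rule \<gamma>[symmetric])
  show "norm (\<gamma> s) = 1" if "s \<in> {0..1}" for s
    using \<gamma>[OF that] h(2) that t' by simp
qed

lemma rotation_homotopy:
  assumes cont: "continuous_on {0..1} \<Gamma>" and n: "\<And>s. s \<in> {0..1} \<Longrightarrow> norm (\<Gamma> s) = 1"
    and \<gamma>: "\<And>s. s \<in> {0..1} \<Longrightarrow> hopf (\<Gamma> s) = \<gamma> s" and f: "f \<in> cube_maps k S2 (\<gamma> 0)"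
  shows "cube_homotopy k S2 \<gamma> f (rotate_map k (\<Gamma> 0) (\<Gamma> 1) f)"
proof (rule cube_homotopy_S2I[where h="\<lambda>x. fibre_rotation (\<Gamma> 0) (\<Gamma> (fst x)) (f (snd x))"])
  have n0: "norm (\<Gamma> 0) = 1" and \<gamma>0: "\<gamma> 0 = hopf (\<Gamma> 0)" using n \<gamma> by simp_all
  note cont_f = cube_maps_S2_iff[THEN iffD1, OF f, THEN conjunct2, THEN conjunct1]
  show "continuous_on ({0..1} \<times> topspace (cube k)) (\<lambda>x. fibre_rotation (\<Gamma> 0) (\<Gamma> (fst x)) (f (snd x)))"
    by (intro continuous_intros continuous_on_compose2[OF cont_f] continuous_on_compose2[OF cont]) auto
  show "norm (fibre_rotation (\<Gamma> 0) (\<Gamma> (fst (s, t))) (f (snd (s, t)))) = 1"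
    if "s \<in> {0..1}" "t \<in> topspace (cube k)" for s t
  proof -
    have "norm (f t) = 1" using f that unfolding cube_maps_S2_iff by blast
    then show ?thesis using n[OF that(1)] n0 by (simp add: norm_fibre_rotation)
  qed
  show "fibre_rotation (\<Gamma> 0) (\<Gamma> (fst (0, t))) (f (snd (0, t))) = f t" for t
    using n0 by (simp add: fibre_rotation_self)
  show "fibre_rotation (\<Gamma> 0) (\<Gamma> (fst (1, t))) (f (snd (1, t))) = rotate_map k (\<Gamma> 0) (\<Gamma> 1) f t"
    if "t \<in> topspace (cube k)" for t
    using that by (simp add: rotate_map_def)
  show "fibre_rotation (\<Gamma> 0) (\<Gamma> (fst (s, t))) (f (snd (s, t))) = \<gamma> s"
    if "s \<in> {0..1}" "t \<in> cube_boundary k" for s t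
    using cube_mapsD(3)[OF f that(2)] \<gamma>[OF that(1)] unfolding \<gamma>0 by (simp add: fibre_rotation_hopf n0)
qed

text \<open>At time \<open>s\<close> the rotation from \<open>\<Gamma> s\<close> to \<open>\<Gamma> 1\<close> brings the moving basepoint back to its
  final position.\<close>

lemma straighten_homotopy:
  assumes cont: "continuous_on {0..1} \<Gamma>" and n: "\<And>s. s \<in> {0..1} \<Longrightarrow> norm (\<Gamma> s) = 1"
    and \<gamma>: "\<And>s. s \<in> {0..1} \<Longrightarrow> hopf (\<Gamma> s) = \<gamma> s"
    and f: "f \<in> cube_maps k S2 (\<gamma> 0)" and g: "g \<in> cube_maps k S2 (\<gamma> 1)" and fg: "cube_homotopy k S2 \<gamma> f g"
  shows "(rotate_map k (\<Gamma> 0) (\<Gamma> 1) f, g) \<in> cube_homotopy_rel k S2 (\<gamma> 1)"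
proof -
  have n01: "norm (\<Gamma> 0) = 1" "norm (\<Gamma> 1) = 1" and \<gamma>01: "\<gamma> 0 = hopf (\<Gamma> 0)" "\<gamma> 1 = hopf (\<Gamma> 1)"
    using n \<gamma> by simp_all
  obtain h where h: "continuous_on ({0..1} \<times> topspace (cube k)) h"
    "\<forall>s\<in>{0..1}. \<forall>t\<in>topspace (cube k). norm (h (s, t)) = 1"
    "\<forall>t\<in>topspace (cube k). h (0, t) = f t" "\<forall>t\<in>topspace (cube k). h (1, t) = g t"
    "\<forall>s\<in>{0..1}. \<forall>t\<in>cube_boundary k. h (s, t) = \<gamma> s"
    using fg by (rule cube_homotopy_S2E)
  have "cube_homotopy k S2 (\<lambda>_. \<gamma> 1) (rotate_map k (\<Gamma> 0) (\<Gamma> 1) f) g"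
  proof (rule cube_homotopy_S2I[where h="\<lambda>x. fibre_rotation (\<Gamma> (fst x)) (\<Gamma> 1) (h x)"])
    show "continuous_on ({0..1} \<times> topspace (cube k)) (\<lambda>x. fibre_rotation (\<Gamma> (fst x)) (\<Gamma> 1) (h x))"
      by (intro continuous_intros h(1) continuous_on_compose2[OF cont]) auto
    show "norm (fibre_rotation (\<Gamma> (fst (s, t))) (\<Gamma> 1) (h (s, t))) = 1"
      if "s \<in> {0..1}" "t \<in> topspace (cube k)" for s t
      using h(2) that n by (simp add: norm_fibre_rotation n01)
    show "fibre_rotation (\<Gamma> (fst (0, t))) (\<Gamma> 1) (h (0, t)) = rotate_map k (\<Gamma> 0) (\<Gamma> 1) f t"
      if "t \<in> topspace (cube k)" for t
      using that h(3) by (simp add: rotate_map_def)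
    show "fibre_rotation (\<Gamma> (fst (1, t))) (\<Gamma> 1) (h (1, t)) = g t" if "t \<in> topspace (cube k)" for t
      using that h(4) by (simp add: fibre_rotation_self n01)
    show "fibre_rotation (\<Gamma> (fst (s, t))) (\<Gamma> 1) (h (s, t)) = \<gamma> 1"
      if "s \<in> {0..1}" "t \<in> cube_boundary k" for s t
    proof -
      have "h (s, t) = hopf (\<Gamma> s)" using h(5) that \<gamma>[OF that(1)] by simp
      then show ?thesis using n[OF that(1)] by (simp add: fibre_rotation_hopf \<gamma>01)
    qed
  qed
  moreover have "rotate_map k (\<Gamma> 0) (\<Gamma> 1) f \<in> cube_maps k S2 (\<gamma> 1)"
    using rotate_map_in_cube_maps[OF n01 f[unfolded \<gamma>01]] unfolding \<gamma>01 .
  ultimately show ?thesis using g by (simp add: cube_homotopy_rel_iff)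
qed

lemma cube_homotopy_rel_trans:
  "(f, g) \<in> cube_homotopy_rel k X x \<Longrightarrow> (g, h) \<in> cube_homotopy_rel k X x \<Longrightarrow> (f, h) \<in> cube_homotopy_rel k X x"
  using equiv_cube_homotopy_rel[of k X x] unfolding equiv_def by (blast dest: transD)

lemma cube_homotopy_rel_sym:
  "(f, g) \<in> cube_homotopy_rel k X x \<Longrightarrow> (g, f) \<in> cube_homotopy_rel k X x"
  using equiv_cube_homotopy_rel[of k X x] unfolding equiv_def by (blast dest: symD)

lemma free_homotopy_rotation:
  assumes k: "1 \<le> k" and f: "f \<in> cube_maps k S2 (hopf F)" and g: "g \<in> cube_maps k S2 (hopf G)"
    and fg: "cube_homotopy k S2 \<gamma> f g" and n: "norm F = 1" "norm G = 1"
    and \<gamma>: "\<gamma> 0 = hopf F" "\<gamma> 1 = hopf G"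
  shows "(rotate_map k F G f, g) \<in> cube_homotopy_rel k S2 (hopf G)"
proof -
  obtain \<Gamma> where \<Gamma>': "continuous_on {0..1} \<Gamma>" "\<forall>s\<in>{0..1}. norm (\<Gamma> s) = 1"
    "\<forall>s\<in>{0..1}. hopf (\<Gamma> s) = \<gamma> s" "\<Gamma> 0 = F"
    by (rule hopf_path_lift[OF cube_homotopy_path[OF k fg] n(1) \<gamma>(1)[symmetric]])
  note \<Gamma> = \<Gamma>'(1) \<Gamma>'(2,3)[rule_format] \<Gamma>'(4)
  have "(rotate_map k F (\<Gamma> 1) f, g) \<in> cube_homotopy_rel k S2 (hopf G)"
    using straighten_homotopy[OF \<Gamma>(1-3), of f k g] f g fg unfolding \<Gamma>(4) \<gamma> by blast
  moreover have "(rotate_map k F G f, rotate_map k F (\<Gamma> 1) f) \<in> cube_homotopy_rel k S2 (hopf G)"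
    using \<Gamma>(2,3)[of 1] \<gamma>(2) by (intro rotate_map_fibre_independent[OF f n]) auto
  ultimately show ?thesis by (rule cube_homotopy_rel_trans[rotated])
qed

text \<open>The change of basepoint, defined as a set of end points of free homotopies, is a single
  homotopy class, represented by a rotated map. An arbitrary \<open>g\<close> in that class is reached by a
  free homotopy from the map obtained by rotating \<open>g\<close> back.\<close>

lemma basepoint_change_S2:
  assumes k: "1 \<le> k" and path: "pathin S2 \<gamma>" and f: "f \<in> cube_maps k S2 (hopf F)"
    and n: "norm F = 1" "norm G = 1" and \<gamma>: "\<gamma> 0 = hopf F" "\<gamma> 1 = hopf G"
  shows "basepoint_change k S2 \<gamma> (homotopy_class k S2 (hopf F) f) =
    homotopy_class k S2 (hopf G) (rotate_map k F G f)"
proof (intro equalityI subsetI)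
  fix g assume "g \<in> basepoint_change k S2 \<gamma> (homotopy_class k S2 (hopf F) f)"
  then obtain f' where g: "g \<in> cube_maps k S2 (hopf G)" and f': "(f, f') \<in> cube_homotopy_rel k S2 (hopf F)"
    and h: "cube_homotopy k S2 \<gamma> f' g"
    unfolding basepoint_change_eq Bex_def mem_homotopy_class_iff \<gamma> by blast
  have "f' \<in> cube_maps k S2 (hopf F)" using f' unfolding cube_homotopy_rel_iff by simp
  then have "(rotate_map k F G f', g) \<in> cube_homotopy_rel k S2 (hopf G)"
    by (rule free_homotopy_rotation[OF k _ g h n \<gamma>])
  with rotate_map_respects[OF n f'] show "g \<in> homotopy_class k S2 (hopf G) (rotate_map k F G f)"
    unfolding mem_homotopy_class_iff by (rule cube_homotopy_rel_trans)
next
  fix g assume g: "g \<in> homotopy_class k S2 (hopf G) (rotate_map k F G f)"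
  have \<gamma>': "continuous_on {0..1} \<gamma>" "\<And>s. s \<in> {0..1} \<Longrightarrow> norm (\<gamma> s) = 1"
    using path unfolding pathin_def continuous_map_S2_iff by simp_all
  obtain \<Gamma> where \<Gamma>': "continuous_on {0..1} \<Gamma>" "\<forall>s\<in>{0..1}. norm (\<Gamma> s) = 1"
    "\<forall>s\<in>{0..1}. hopf (\<Gamma> s) = \<gamma> s" "\<Gamma> 0 = F"
    by (rule hopf_path_lift[OF \<gamma>' n(1) \<gamma>(1)[symmetric]])
  note \<Gamma> = \<Gamma>'(1) \<Gamma>'(2,3)[rule_format] \<Gamma>'(4)
  have \<Gamma>1: "norm (\<Gamma> 1) = 1" "hopf (\<Gamma> 1) = hopf G" using \<Gamma>(2,3)[of 1] \<gamma> by simp_all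
  have "(rotate_map k F (\<Gamma> 1) f, rotate_map k F G f) \<in> cube_homotopy_rel k S2 (hopf (\<Gamma> 1))"
    by (rule rotate_map_fibre_independent[OF f n(1) \<Gamma>1(1) n(2) \<Gamma>1(2)])
  then have rg: "(rotate_map k F (\<Gamma> 1) f, g) \<in> cube_homotopy_rel k S2 (hopf (\<Gamma> 1))"
    using g unfolding mem_homotopy_class_iff \<Gamma>1(2) by (rule cube_homotopy_rel_trans)
  \<comment> \<open>The start of the free homotopy to \<open>g\<close> is \<open>g\<close> itself, rotated back to the old basepoint.\<close>
  define f' where "f' = rotate_map k (\<Gamma> 1) F g"
  have "(rotate_map k (\<Gamma> 1) F (rotate_map k F (\<Gamma> 1) f), f') \<in> cube_homotopy_rel k S2 (hopf F)"
    unfolding f'_def by (rule rotate_map_respects[OF \<Gamma>1(1) n(1) rg])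
  then have f': "(f, f') \<in> cube_homotopy_rel k S2 (hopf F)"
    unfolding rotate_map_compose[OF \<Gamma>1(1)] rotate_map_self[OF n(1) f] .
  have gm: "g \<in> cube_maps k S2 (hopf G)"
    using rg unfolding cube_homotopy_rel_iff \<Gamma>1(2) by simp
  have "cube_homotopy k S2 \<gamma> f' (rotate_map k (\<Gamma> 0) (\<Gamma> 1) f')"
    using f' by (intro rotation_homotopy[OF \<Gamma>(1-3)]) (simp_all add: cube_homotopy_rel_iff \<gamma>)
  moreover have "rotate_map k (\<Gamma> 0) (\<Gamma> 1) f' = g"
    unfolding f'_def \<Gamma>(4) rotate_map_compose[OF n(1)] by (rule rotate_map_self[OF \<Gamma>1(1) gm])
  ultimately show "g \<in> basepoint_change k S2 \<gamma> (homotopy_class k S2 (hopf F) f)"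
    unfolding basepoint_change_eq Bex_def mem_homotopy_class_iff \<gamma> using f' gm by blast
qed

section \<open>The antipode on higher homotopy groups\<close>

text \<open>The segment from \<open>f t\<close> to \<open>- g t\<close> misses the origin when \<open>f t\<close> and \<open>g t\<close> differ, and can
  be projected to the sphere.\<close>

lemma antipodal_homotopy_of_disjoint:
  assumes f: "f \<in> cube_maps k S2 y" and g: "g \<in> cube_maps k S2 z"
    and yz: "norm y = 1" "norm z = 1" and ne: "\<And>t. t \<in> topspace (cube k) \<Longrightarrow> f t \<noteq> g t"
  obtains \<gamma> where "cube_homotopy k S2 \<gamma> f (restrict (uminus \<circ> g) (topspace (cube k)))" "\<gamma> 0 = y" "\<gamma> 1 = - z"
proof -
  let ?C = "topspace (cube k)"
  define L where "L x = (1 - fst x) *\<^sub>R f (snd x) - fst x *\<^sub>R g (snd x)" for x :: "real \<times> (nat \<Rightarrow> real)"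
  have fS: "norm (f t) = 1" and gS: "norm (g t) = 1" if "t \<in> ?C" for t
    using f g that unfolding cube_maps_S2_iff by blast+
  note cont_f = cube_maps_S2_iff[THEN iffD1, OF f, THEN conjunct2, THEN conjunct1]
  note cont_g = cube_maps_S2_iff[THEN iffD1, OF g, THEN conjunct2, THEN conjunct1]
  have nz: "L (s, t) \<noteq> 0" if s: "s \<in> {0..1}" and t: "t \<in> ?C" for s t
  proof
    assume "L (s, t) = 0"
    then have eq: "(1 - s) *\<^sub>R f t = s *\<^sub>R g t" by (simp add: L_def)
    have "1 - s = s"
      using arg_cong[OF eq, of norm] s fS[OF t] gS[OF t] by simp
    with eq s have "f t = g t" by (metis add.right_neutral diff_zero scaleR_cancel_left diff_self zero_neq_one)
    with ne[OF t] show False ..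
  qed
  have "continuous_on ({0..1} \<times> ?C) L"
    unfolding L_def
    by (intro continuous_intros continuous_on_compose2[OF cont_f] continuous_on_compose2[OF cont_g]) auto
  then have cont: "continuous_on ({0..1} \<times> ?C) (\<lambda>x. inverse (norm (L x)) *\<^sub>R L x)"
    by (intro continuous_intros) (use nz in auto)
  define \<gamma> where "\<gamma> s = (let v = (1 - s) *\<^sub>R y - s *\<^sub>R z in inverse (norm v) *\<^sub>R v)" for s
  have "cube_homotopy k S2 \<gamma> f (restrict (uminus \<circ> g) ?C)"
  proof (rule cube_homotopy_S2I[OF cont])
    show "norm (inverse (norm (L (s, t))) *\<^sub>R L (s, t)) = 1" if "s \<in> {0..1}" "t \<in> ?C" for s t
      using nz[OF that] by simp
    show "inverse (norm (L (0, t))) *\<^sub>R L (0, t) = f t" if "t \<in> ?C" for t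
      using fS[OF that] by (simp add: L_def)
    show "inverse (norm (L (1, t))) *\<^sub>R L (1, t) = restrict (uminus \<circ> g) ?C t" if "t \<in> ?C" for t
      using gS[OF that] that by (simp add: L_def)
    show "inverse (norm (L (s, t))) *\<^sub>R L (s, t) = \<gamma> s" if "t \<in> cube_boundary k" for s t
      using cube_mapsD(3)[OF f that] cube_mapsD(3)[OF g that] by (simp add: L_def \<gamma>_def Let_def)
  qed
  moreover have "\<gamma> 0 = y" "\<gamma> 1 = - z"
    using yz by (simp_all add: \<gamma>_def)
  ultimately show thesis by (rule that)
qed

text \<open>From dimension 3 on, a lift through the Hopf map can be made constant on the boundary. A
  lift along coordinate 1 is constant on all faces except \<open>t 1 = 1\<close>, and on that face it is given
  by a phase. The logarithm of this phase, taken along coordinate 0, vanishes on all sides of that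
  face except \<open>t 0 = 1\<close>, where it is an integer. Along coordinate 2 this integer does not change, and
  at \<open>t 2 = 0\<close> it is zero. In dimension 2 the same integer is the degree.\<close>

lemma constant_boundary_lift:
  assumes k: "3 \<le> k" and f: "f \<in> cube_maps k S2 (hopf p)" and p: "norm p = 1"
  obtains F where "continuous_on (topspace (cube k)) F" "\<forall>t\<in>topspace (cube k). norm (F t) = 1 \<and> hopf (F t) = f t"
    "\<forall>t\<in>cube_boundary k. F t = p"
proof -
  let ?C = "topspace (cube k)"
  let ?I = "{0..1::real}"
  note cont_f = cube_maps_S2_iff[THEN iffD1, OF f, THEN conjunct2, THEN conjunct1]
  have fS: "norm (f t) = 1" if "t \<in> ?C" for t using f that unfolding cube_maps_S2_iff by blast
  have upd: "t(j := s) \<in> ?C" if "t \<in> ?C" "j < 3" "s \<in> ?I" for t j s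
    using cube_upd[OF that(1), of j s] that k by simp
  have cont_upd: "continuous_on S (\<lambda>x. (a x)(j := b x))"
    if "continuous_on S a" "continuous_on S b" for S and a :: "'x::topological_space \<Rightarrow> nat \<Rightarrow> real" and b j
  proof (rule continuous_on_coordinatewise_then_product)
    fix i
    show "continuous_on S (\<lambda>x. ((a x)(j := b x)) i)"
      using that by (cases "i = j") (auto intro: continuous_on_product_then_coordinatewise)
  qed
  have face: "t(j := s) \<in> cube_boundary k" if "t \<in> ?C" "j < 3" "s \<in> {0, 1}" for t j s
    using upd[OF that(1,2), of s] that k by (auto simp: cube_boundary_def intro!: exI[of _ j])
  have lateral: "t(j := s) \<in> cube_boundary k"
    if "t \<in> ?C" "j < 3" "s \<in> ?I" "i < k" "i \<noteq> j" "t i \<in> {0, 1}" for t i j s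
    using upd[OF that(1-3)] that(4-6) by (auto simp: cube_boundary_def intro!: exI[of _ i])
  have f_bdry: "f t = hopf p" if "t \<in> cube_boundary k" for t
    by (rule cube_mapsD(3)[OF f that])
  define g where "g x = f ((fst x)(1 := snd x))" for x
  have cont_g: "continuous_on (?C \<times> ?I) g"
    unfolding g_def
    by (intro continuous_on_compose2[OF cont_f] cont_upd continuous_intros) (use upd in auto)
  obtain G where G: "continuous_on (?C \<times> ?I) G" "\<And>z. z \<in> ?C \<times> ?I \<Longrightarrow> G z \<in> sphere 0 1"
    "\<And>z. z \<in> ?C \<times> ?I \<Longrightarrow> hopf (G z) = g z" "\<And>x. x \<in> ?C \<Longrightarrow> G (x, 0) = p"
    "\<And>x c s. x \<in> ?C \<Longrightarrow> (\<And>s. s \<in> ?I \<Longrightarrow> g (x, s) = c) \<Longrightarrow> s \<in> ?I \<Longrightarrow> G (x, s) = p"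
  proof (rule hopf_lift_along_interval[where K="?C" and f=g and init="\<lambda>_. p"])
    show "g z \<in> sphere 0 1" if "z \<in> ?C \<times> ?I" for z
      using that fS[OF upd[of "fst z" 1 "snd z"]] by (simp add: g_def mem_Times_iff)
    show "hopf p = g (x, 0)" if "x \<in> ?C" for x
      using f_bdry[OF face[OF that, of 1 0]] by (simp add: g_def)
  qed (use compact_cube cont_g p in \<open>auto\<close>)
  have G_lateral: "G (x, s) = p" if "x \<in> ?C" "i < k" "i \<noteq> 1" "x i \<in> {0, 1}" "s \<in> ?I" for x i s
  proof (rule G(5)[OF that(1) _ that(5), of "hopf p"])
    show "g (x, s) = hopf p" if "s \<in> ?I" for s
      using f_bdry[OF lateral[OF \<open>x \<in> ?C\<close> _ that \<open>i < k\<close> \<open>i \<noteq> 1\<close> \<open>x i \<in> {0, 1}\<close>]] by (simp add: g_def)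
  qed
  define v where "v x = hermitian (G (x, 1)) p" for x
  have v: "G (x, 1) = phase (v x) p" "cmod (v x) = 1" if "x \<in> ?C" for x
  proof -
    have "norm (G (x, 1)) = 1" "hopf (G (x, 1)) = hopf p"
      using G(2,3)[of "(x, 1)"] that f_bdry[OF face[OF that, of 1 1]] by (simp_all add: g_def)
    then show "G (x, 1) = phase (v x) p" "cmod (v x) = 1"
      using same_fibre[OF p, of "G (x, 1)"] by (simp_all add: v_def)
  qed
  have v1: "v x = 1" if "x \<in> ?C" "i < k" "i \<noteq> 1" "x i \<in> {0, 1}" for x i
    using G_lateral[OF that, of 1] by (simp add: v_def hermitian_self_unit p)
  define u where "u x = v ((fst x)(0 := snd x))" for x
  obtain \<eta> where \<eta>: "continuous_on (?C \<times> ?I) \<eta>"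
    "\<And>z. z \<in> ?C \<times> ?I \<Longrightarrow> cis (2 * pi * \<eta> z) = u z" "\<And>x. x \<in> ?C \<Longrightarrow> \<eta> (x, 0) = 0"
    "\<And>x s. x \<in> ?C \<Longrightarrow> (\<And>s. s \<in> ?I \<Longrightarrow> u (x, s) = 1) \<Longrightarrow> s \<in> ?I \<Longrightarrow> \<eta> (x, s) = 0"
  proof (rule log_lift_along_interval[where K="?C" and u=u])
    show "continuous_on (?C \<times> ?I) u"
      unfolding u_def v_def
      by (intro continuous_intros continuous_on_compose2[OF G(1)] cont_upd) (use upd in auto)
    show "cmod (u z) = 1" if "z \<in> ?C \<times> ?I" for z
      using that v(2)[OF upd[of "fst z" 0 "snd z"]] by (simp add: u_def mem_Times_iff)
    show "u (x, 0) = 1" if "x \<in> ?C" for x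
      using v1[OF upd[OF that, of 0 0], of 0] k by (simp add: u_def)
  qed (use compact_cube in auto)
  have \<eta>_lateral: "\<eta> (x, s) = 0" if "x \<in> ?C" "i < k" "i \<noteq> 0" "i \<noteq> 1" "x i \<in> {0, 1}" "s \<in> ?I" for x i s
  proof (rule \<eta>(4)[OF that(1) _ that(6)])
    show "u (x, s) = 1" if "s \<in> ?I" for s
      using v1[OF upd[OF \<open>x \<in> ?C\<close> _ that, of 0] \<open>i < k\<close> \<open>i \<noteq> 1\<close>] \<open>x i \<in> {0, 1}\<close> \<open>i \<noteq> 0\<close> by (simp add: u_def)
  qed
  \<comment> \<open>This is where a third coordinate is needed.\<close>
  have \<eta>_end: "\<eta> (x, 1) = 0" if x: "x \<in> ?C" for x
  proof -
    have x2: "x(2 := r) \<in> ?C" if "r \<in> ?I" for r using upd[OF x, of 2 r] that by simp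
    have "\<eta> (x(2 := x 2), 1) = \<eta> (x(2 := 0), 1)"
    proof (rule continuous_Ints_constant[where S="?I" and f="\<lambda>r. \<eta> (x(2 := r), 1)"])
      show "continuous_on ?I (\<lambda>r. \<eta> (x(2 := r), 1))"
        by (intro continuous_on_compose2[OF \<eta>(1)] continuous_intros cont_upd) (use x2 in auto)
      show "\<eta> (x(2 := r), 1) \<in> \<int>" if "r \<in> ?I" for r
      proof -
        have "u (x(2 := r), 1) = 1"
          using v1[OF upd[OF x2[OF that], of 0 1], of 0] k by (simp add: u_def)
        then show ?thesis using \<eta>(2)[of "(x(2 := r), 1)"] x2[OF that] by (simp add: cis_2pi_eq_1_iff)
      qed
      show "x 2 \<in> ?I" using cube_coordinate[OF x, of 2] k by simp
    qed auto
    moreover have "\<eta> (x(2 := 0), 1) = 0"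
      using k by (intro \<eta>_lateral[OF x2, of 0 2]) auto
    ultimately show ?thesis by simp
  qed
  define \<theta> where "\<theta> t = \<eta> (t, t 0)" for t
  have cont_coord: "continuous_on ?C (\<lambda>t. t i)" for i
    by (rule continuous_on_product_then_coordinatewise[OF continuous_on_id])
  have tI: "t i \<in> ?I" if "t \<in> ?C" "i < 3" for t i
    using cube_coordinate[OF that(1), of i] that(2) k by simp
  have cont_\<theta>: "continuous_on ?C \<theta>"
    unfolding \<theta>_def
    by (intro continuous_on_compose2[OF \<eta>(1)] continuous_intros cont_coord) (use tI in auto)
  have \<theta>: "cis (2 * pi * \<theta> t) = v t" if "t \<in> ?C" for t
    using \<eta>(2)[of "(t, t 0)"] tI[OF that, of 0] that by (simp add: \<theta>_def u_def)
  have \<theta>0: "\<theta> t = 0" if "t \<in> ?C" "i < k" "i \<noteq> 1" "t i \<in> {0, 1}" for t i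
  proof (cases "i = 0")
    case True
    then show ?thesis using that \<eta>(3)[OF that(1)] \<eta>_end[OF that(1)] by (auto simp: \<theta>_def)
  next
    case False
    then show ?thesis using \<eta>_lateral[OF that(1,2) False that(3,4) tI[OF that(1), of 0]] by (simp add: \<theta>_def)
  qed
  \<comment> \<open>The factor \<open>t 1\<close> undoes the phase on the face \<open>t 1 = 1\<close> and leaves the face \<open>t 1 = 0\<close> alone.\<close>
  define F where "F t = phase (cis (2 * pi * (- (t 1 * \<theta> t)))) (G (t, t 1))" for t
  show thesis
  proof (rule that[of F])
    show "continuous_on ?C F"
      unfolding F_def cis_conv_exp
      by (intro continuous_intros continuous_on_compose2[OF G(1)] cont_coord cont_\<theta>) (use tI in auto)
    show "\<forall>t\<in>?C. norm (F t) = 1 \<and> hopf (F t) = f t"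
    proof
      fix t assume t: "t \<in> ?C"
      then have "(t, t 1) \<in> ?C \<times> ?I" using tI[OF t, of 1] by simp
      from G(2,3)[OF this] show "norm (F t) = 1 \<and> hopf (F t) = f t"
        by (simp add: F_def hopf_phase g_def)
    qed
    show "\<forall>t\<in>cube_boundary k. F t = p"
    proof
      fix t assume "t \<in> cube_boundary k"
      then obtain i where t: "t \<in> ?C" and i: "i < k" "t i \<in> {0, 1}"
        unfolding cube_boundary_def by auto
      consider "i \<noteq> 1" | "i = 1" "t 1 = 0" | "i = 1" "t 1 = 1" using i(2) by auto
      then show "F t = p"
      proof cases
        case 1
        then show ?thesis
          using \<theta>0[OF t i(1) 1 i(2)] G_lateral[OF t i(1) 1 i(2) tI[OF t, of 1]] by (simp add: F_def)
      next
        case 2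
        then show ?thesis using G(4)[OF t] by (simp add: F_def)
      next
        case 3
        have "cis (2 * pi * (- (t 1 * \<theta> t))) * v t = cis 0"
          using \<theta>[OF t, symmetric] 3 by (simp add: cis_mult)
        then show ?thesis using v(1)[OF t] 3 by (simp add: F_def)
      qed
    qed
  qed
qed

text \<open>Multiplication by a path of unit quaternions joins a lift of \<open>f\<close> to a lift of its
  antipode. These multiplications do not preserve the Hopf fibres, so the boundary stays
  constant under the homotopy only because the lift is constant there.\<close>

lemma homotopic_to_antipode:
  assumes k: "3 \<le> k" and f: "f \<in> cube_maps k S2 y" and y: "norm y = 1"
  obtains \<gamma> where "cube_homotopy k S2 \<gamma> f (restrict (uminus \<circ> f) (topspace (cube k)))" "\<gamma> 0 = y" "\<gamma> 1 = - y"
proof -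
  obtain p where p: "norm p = 1" "hopf p = y" using y by (rule hopf_surj)
  obtain F where F: "continuous_on (topspace (cube k)) F" "\<forall>t\<in>topspace (cube k). norm (F t) = 1 \<and> hopf (F t) = f t"
    "\<forall>t\<in>cube_boundary k. F t = p"
    by (rule constant_boundary_lift[OF k f[folded p(2)] p(1)])
  define T where "T s q = phase (of_real (cos (s * pi / 2))) q + phase (of_real (sin (s * pi / 2))) (conj_swap q)"
    for s q
  have nT: "norm (T s q) = 1" if "norm q = 1" for s q
  proof -
    have "(norm (T s q))\<^sup>2 = 1\<^sup>2" unfolding T_def norm_add_conj_swap using that by simp
    then show ?thesis by (rule power2_eq_imp_eq) simp_all
  qed
  have T0: "T 0 q = q" and T1: "T 1 q = conj_swap q" for q
    by (simp_all add: T_def phase_def conj_swap_def prod_eq_iff)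
  have "cube_homotopy k S2 (\<lambda>s. hopf (T s p)) f (restrict (uminus \<circ> f) (topspace (cube k)))"
  proof (rule cube_homotopy_S2I[where h="\<lambda>x. hopf (T (fst x) (F (snd x)))"])
    show "continuous_on ({0..1} \<times> topspace (cube k)) (\<lambda>x. hopf (T (fst x) (F (snd x))))"
      unfolding T_def by (intro continuous_intros continuous_on_compose2[OF F(1)]) auto
  qed (use F nT T0 T1 in \<open>simp_all add: norm_hopf hopf_conj_swap\<close>)
  moreover have "hopf (T 0 p) = y" "hopf (T 1 p) = - y"
    by (simp_all add: T0 T1 hopf_conj_swap p(2))
  ultimately show thesis by (rule that)
qed

section \<open>Coordinates of maps to the configuration space\<close>

lemma config_space_point:
  assumes "x \<in> topspace (config_space n S2)"
  shows "i \<in> {1..n} \<Longrightarrow> norm (x i) = 1" "inj_on x {1..n}" "x \<in> extensional {1..n}"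
  using assms by (auto simp: config_space_def power_space_def PiE_iff)

lemma continuous_map_power_projection:
  "i \<in> {1..n} \<Longrightarrow> continuous_map (power_space n S2) S2 (\<lambda>y. y i)"
  unfolding power_space_def by (rule continuous_map_product_projection)

lemma continuous_map_config_inclusion:
  "continuous_map (config_space n S2) (power_space n S2) (\<lambda>y. y)"
  unfolding config_space_def by (rule continuous_map_from_subtopology) (rule continuous_map_id[unfolded id_def])

lemma continuous_map_config_projection:
  "i \<in> {1..n} \<Longrightarrow> continuous_map (config_space n S2) S2 (\<lambda>y. y i)"
  unfolding config_space_def by (intro continuous_map_from_subtopology continuous_map_power_projection)

lemma incl_induced_hom:
  assumes "1 \<le> k"
  shows "incl_induced n k x \<in> hom (homotopy_group k (config_space n S2) x) (homotopy_group k (power_space n S2) x)"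
  unfolding incl_induced_def by (rule homotopy_induced_hom[OF assms continuous_map_config_inclusion])

definition coordinate_map :: "nat \<Rightarrow> nat \<Rightarrow> ((nat \<Rightarrow> real) \<Rightarrow> nat \<Rightarrow> real^3) \<Rightarrow> (nat \<Rightarrow> real) \<Rightarrow> real^3" where
  "coordinate_map k i f = restrict ((\<lambda>y. y i) \<circ> f) (topspace (cube k))"

lemma coordinate_map_in_cube_maps:
  "f \<in> cube_maps k (config_space n S2) x \<Longrightarrow> i \<in> {1..n} \<Longrightarrow> coordinate_map k i f \<in> cube_maps k S2 (x i)"
  unfolding coordinate_map_def by (rule compose_in_cube_maps[OF continuous_map_config_projection])

lemma coordinate_maps_disjoint:
  assumes f: "f \<in> cube_maps k (config_space n S2) x" and t: "t \<in> topspace (cube k)"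
    and ij: "i \<in> {1..n}" "j \<in> {1..n}" "i \<noteq> j"
  shows "coordinate_map k i f t \<noteq> coordinate_map k j f t"
proof -
  have "f t \<in> topspace (config_space n S2)"
    using continuous_map_image_subset_topspace[OF cube_mapsD(1)[OF f]] t by blast
  from inj_on_eq_iff[OF config_space_point(2)[OF this] ij(1,2)] show ?thesis
    using ij(3) t by (simp add: coordinate_map_def)
qed

lemma antipode_in_cube_maps:
  assumes "f \<in> cube_maps k S2 y"
  shows "restrict (uminus \<circ> f) (topspace (cube k)) \<in> cube_maps k S2 (- y)"
proof -
  have "continuous_map S2 S2 uminus"
    unfolding continuous_map_S2_iff by (auto intro: continuous_intros)
  from compose_in_cube_maps[OF this assms] show ?thesis .
qed

lemma antipode_antipode:
  assumes "f \<in> cube_maps k S2 y"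
  shows "restrict (uminus \<circ> restrict (uminus \<circ> f) (topspace (cube k))) (topspace (cube k)) = f"
  by (rule extensionalityI[OF restrict_extensional cube_mapsD(2)[OF assms]]) simp

text \<open>\<open>f\<close> is freely homotopic to the antipode of \<open>g\<close>, and this to \<open>g\<close>. Each free homotopy is a
  based one after a rotation.\<close>

lemma disjoint_maps_homotopic:
  assumes k: "3 \<le> k" and f: "f \<in> cube_maps k S2 (hopf F)" and g: "g \<in> cube_maps k S2 (hopf G)"
    and n: "norm F = 1" "norm G = 1" and ne: "\<And>t. t \<in> topspace (cube k) \<Longrightarrow> f t \<noteq> g t"
  shows "(rotate_map k F G f, g) \<in> cube_homotopy_rel k S2 (hopf G)"
proof -
  have k1: "1 \<le> k" using k by simp
  let ?g = "restrict (uminus \<circ> g) (topspace (cube k))"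
  have h: "norm (hopf F) = 1" "norm (hopf G) = 1" using n by (simp_all add: norm_hopf)
  \<comment> \<open>A lift of the antipode of the basepoint of \<open>g\<close>.\<close>
  define K where "K = conj_swap G"
  have K: "norm K = 1" "hopf K = - hopf G" using n by (simp_all add: K_def hopf_conj_swap)
  have g': "?g \<in> cube_maps k S2 (hopf K)" unfolding K(2) by (rule antipode_in_cube_maps[OF g])
  obtain \<gamma> where \<gamma>: "cube_homotopy k S2 \<gamma> f ?g" "\<gamma> 0 = hopf F" "\<gamma> 1 = - hopf G"
    by (rule antipodal_homotopy_of_disjoint[OF f g h ne])
  have 1: "(rotate_map k F K f, ?g) \<in> cube_homotopy_rel k S2 (hopf K)"
    by (rule free_homotopy_rotation[OF k1 f g' \<gamma>(1) n(1) K(1) \<gamma>(2)]) (simp add: \<gamma>(3) K(2))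
  have "norm (hopf K) = 1" unfolding norm_hopf K(1) by simp
  then obtain \<delta> where "cube_homotopy k S2 \<delta> ?g (restrict (uminus \<circ> ?g) (topspace (cube k)))"
      "\<delta> 0 = hopf K" "\<delta> 1 = - hopf K"
    by (rule homotopic_to_antipode[OF k g'])
  then have \<delta>: "cube_homotopy k S2 \<delta> ?g g" "\<delta> 0 = hopf K" "\<delta> 1 = hopf G"
    unfolding antipode_antipode[OF g] K(2) by simp_all
  have 2: "(rotate_map k K G ?g, g) \<in> cube_homotopy_rel k S2 (hopf G)"
    by (rule free_homotopy_rotation[OF k1 g' g \<delta>(1) K(1) n(2) \<delta>(2,3)])
  have "(rotate_map k F G f, rotate_map k K G ?g) \<in> cube_homotopy_rel k S2 (hopf G)"
    using rotate_map_respects[OF K(1) n(2) 1] unfolding rotate_map_compose[OF K(1)] .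
  then show ?thesis using 2 by (rule cube_homotopy_rel_trans)
qed

lemma homotopy_induced_coordinate:
  assumes "f \<in> cube_maps k (config_space n S2) x" "i \<in> {1..n}"
  shows "homotopy_induced k S2 (\<lambda>y. y i) x (homotopy_class k (config_space n S2) x f) =
    homotopy_class k S2 (x i) (coordinate_map k i f)"
  unfolding coordinate_map_def
  by (rule homotopy_induced_class[OF continuous_map_config_projection[OF assms(2)] assms(1)])

text \<open>Two coordinates of a map into the configuration space are disjoint maps into the sphere.\<close>

lemma diagonal_incl_induced_higher:
  assumes k: "3 \<le> k" and x: "x \<in> topspace (config_space n S2)"
  shows "diagonal_incl_induced n k x"
  unfolding diagonal_incl_induced_def
proof (intro allI impI ballI)
  fix i j \<gamma> A
  assume ij: "1 \<le> i \<and> i < j \<and> j \<le> n \<and> pathin S2 \<gamma> \<and> \<gamma> 0 = x i \<and> \<gamma> 1 = x j"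
    and "A \<in> carrier (homotopy_group k (config_space n S2) x)"
  then obtain f where f: "f \<in> cube_maps k (config_space n S2) x" and A: "A = homotopy_class k (config_space n S2) x f"
    unfolding carrier_homotopy_group by blast
  have k1: "1 \<le> k" using k by simp
  have i: "i \<in> {1..n}" and j: "j \<in> {1..n}" and "i \<noteq> j" and \<gamma>: "pathin S2 \<gamma>" "\<gamma> 0 = x i" "\<gamma> 1 = x j"
    using ij by auto
  obtain F where F: "norm F = 1" "hopf F = x i"
    using config_space_point(1)[OF x i] by (rule hopf_surj)
  obtain G where G: "norm G = 1" "hopf G = x j"
    using config_space_point(1)[OF x j] by (rule hopf_surj)
  have fi: "coordinate_map k i f \<in> cube_maps k S2 (hopf F)" and fj: "coordinate_map k j f \<in> cube_maps k S2 (hopf G)"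
    using coordinate_map_in_cube_maps[OF f i] coordinate_map_in_cube_maps[OF f j] by (simp_all add: F G)
  have "basepoint_change k S2 \<gamma> (homotopy_class k S2 (hopf F) (coordinate_map k i f)) =
      homotopy_class k S2 (hopf G) (rotate_map k F G (coordinate_map k i f))"
    by (rule basepoint_change_S2[OF k1 \<gamma>(1) fi F(1) G(1)]) (simp_all add: \<gamma> F G)
  also have "\<dots> = homotopy_class k S2 (hopf G) (coordinate_map k j f)"
    by (intro homotopy_class_eqI disjoint_maps_homotopic[OF k fi fj F(1) G(1)]
        coordinate_maps_disjoint[OF f _ i j \<open>i \<noteq> j\<close>])
  finally show "basepoint_change k S2 \<gamma> (homotopy_induced k S2 (\<lambda>y. y i) x A) =
      homotopy_induced k S2 (\<lambda>y. y j) x A"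
    unfolding A homotopy_induced_coordinate[OF f i] homotopy_induced_coordinate[OF f j] F(2) G(2) .
qed

section \<open>Orientations of the sphere\<close>

lemma additive_int: 
  fixes \<psi> :: "int \<Rightarrow> int"
  assumes add: "\<And>a b. \<psi> (a + b) = \<psi> a + \<psi> b"
  shows "\<psi> n = n * \<psi> 1"
proof (induction n rule: int_induct[where k=0])
  case base
  show ?case using add[of 0 0] by simp
next
  case (step1 i)
  then show ?case using add[of i 1] by (simp add: algebra_simps)
next
  case (step2 i)
  then show ?case using add[of "i - 1" 1] by (simp add: algebra_simps)
qed

text \<open>The integers have only two automorphisms.\<close>

lemma iso_integer_unique_up_to_sign:
  assumes \<alpha>: "\<alpha> \<in> iso G integer_group" and \<beta>: "\<beta> \<in> iso G integer_group"
    and closed: "\<And>A B. A \<in> carrier G \<Longrightarrow> B \<in> carrier G \<Longrightarrow> A \<otimes>\<^bsub>G\<^esub> B \<in> carrier G"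
  obtains \<epsilon> :: int where "\<epsilon> = 1 \<or> \<epsilon> = -1" "\<forall>A\<in>carrier G. \<alpha> A = \<epsilon> * \<beta> A"
proof -
  have \<beta>_bij: "bij_betw \<beta> (carrier G) UNIV" and \<alpha>_bij: "bij_betw \<alpha> (carrier G) UNIV"
    using \<alpha> \<beta> by (simp_all add: iso_def)
  have mult: "\<alpha> (A \<otimes>\<^bsub>G\<^esub> B) = \<alpha> A + \<alpha> B" "\<beta> (A \<otimes>\<^bsub>G\<^esub> B) = \<beta> A + \<beta> B"
    if "A \<in> carrier G" "B \<in> carrier G" for A B
    using \<alpha> \<beta> that by (simp_all add: iso_def hom_def)
  \<comment> \<open>\<open>\<alpha>\<close> read through \<open>\<beta>\<close> is an additive map of the integers.\<close>
  define \<sigma> where "\<sigma> = inv_into (carrier G) \<beta>"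
  have \<sigma>: "\<sigma> d \<in> carrier G" "\<beta> (\<sigma> d) = d" for d
    using \<beta>_bij unfolding \<sigma>_def by (auto simp: bij_betw_def inv_into_into f_inv_into_f)
  have \<sigma>\<beta>: "\<sigma> (\<beta> A) = A" if "A \<in> carrier G" for A
    using \<beta>_bij that unfolding \<sigma>_def by (simp add: bij_betw_def)
  define \<psi> where "\<psi> d = \<alpha> (\<sigma> d)" for d
  have "\<psi> (a + b) = \<psi> a + \<psi> b" for a b
  proof -
    have "\<sigma> (\<beta> (\<sigma> a \<otimes>\<^bsub>G\<^esub> \<sigma> b)) = \<sigma> a \<otimes>\<^bsub>G\<^esub> \<sigma> b" by (rule \<sigma>\<beta>[OF closed[OF \<sigma>(1) \<sigma>(1)]])
    then have "\<sigma> (a + b) = \<sigma> a \<otimes>\<^bsub>G\<^esub> \<sigma> b" by (simp add: mult(2) \<sigma>)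
    then show ?thesis by (simp add: \<psi>_def mult(1) \<sigma>(1))
  qed
  then have lin: "\<psi> n = n * \<psi> 1" for n by (rule additive_int)
  have eq: "\<alpha> A = \<psi> 1 * \<beta> A" if "A \<in> carrier G" for A
    using lin[of "\<beta> A"] \<sigma>\<beta>[OF that] by (simp add: \<psi>_def mult.commute)
  obtain A where A: "A \<in> carrier G" "\<alpha> A = 1"
    using \<alpha>_bij unfolding bij_betw_def by (metis UNIV_I imageE)
  then have "\<psi> 1 * \<beta> A = 1" using eq by simp
  then have "\<psi> 1 = 1 \<or> \<psi> 1 = - 1" by (auto simp: zmult_eq_1_iff)
  then show thesis using eq by (intro that[of "\<psi> 1"]) auto
qed

text \<open>The group laws are transported from the integers along the bijection.\<close>

lemma group_of_iso_integer:
  assumes \<alpha>: "\<alpha> \<in> iso G integer_group"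
    and closed: "\<And>A B. A \<in> carrier G \<Longrightarrow> B \<in> carrier G \<Longrightarrow> A \<otimes>\<^bsub>G\<^esub> B \<in> carrier G"
    and one: "\<one>\<^bsub>G\<^esub> \<in> carrier G" "\<alpha> \<one>\<^bsub>G\<^esub> = 0"
  shows "group G"
proof -
  have inj: "inj_on \<alpha> (carrier G)" and surj: "\<alpha> ` carrier G = UNIV"
    using \<alpha> by (simp_all add: iso_def bij_betw_def)
  have mult: "\<alpha> (A \<otimes>\<^bsub>G\<^esub> B) = \<alpha> A + \<alpha> B"
    if "A \<in> carrier G" "B \<in> carrier G" for A B
    using \<alpha> that by (simp add: iso_def hom_def)
  show ?thesis
  proof (rule groupI[OF closed one(1)])
    fix A B C assume "A \<in> carrier G" "B \<in> carrier G" "C \<in> carrier G"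
    then show "A \<otimes>\<^bsub>G\<^esub> B \<otimes>\<^bsub>G\<^esub> C = A \<otimes>\<^bsub>G\<^esub> (B \<otimes>\<^bsub>G\<^esub> C)"
      by (intro inj_onD[OF inj]) (simp_all add: mult closed)
  next
    fix A assume A: "A \<in> carrier G"
    then show "\<one>\<^bsub>G\<^esub> \<otimes>\<^bsub>G\<^esub> A = A"
      by (intro inj_onD[OF inj]) (simp_all add: mult closed one)
    have "- \<alpha> A \<in> \<alpha> ` carrier G" by (simp add: surj)
    then obtain B where B: "B \<in> carrier G" "\<alpha> B = - \<alpha> A" by auto
    have "B \<otimes>\<^bsub>G\<^esub> A = \<one>\<^bsub>G\<^esub>"
      using A B by (intro inj_onD[OF inj]) (simp_all add: mult closed one)
    with B(1) show "\<exists>B\<in>carrier G. B \<otimes>\<^bsub>G\<^esub> A = \<one>\<^bsub>G\<^esub>" by blast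
  qed
qed

text \<open>The multiples of \<open>\<alpha> g\<close> contain the values of \<open>\<alpha>\<close> on everything generated by \<open>g\<close>, hence 1.\<close>

lemma generator_of_iso_integer:
  assumes G: "group G" and \<alpha>: "\<alpha> \<in> iso G integer_group"
    and g: "g \<in> carrier G" and gen: "generate G {g} = carrier G"
  shows "\<alpha> g = 1 \<or> \<alpha> g = -1"
proof -
  interpret group_hom G integer_group \<alpha>
    using G \<alpha> group_integer_group by (simp add: group_hom_def group_hom_axioms_def iso_def)
  have "\<alpha> g dvd \<alpha> A" if "A \<in> generate G {g}" for A
    using that
  proof (induction rule: generate.induct)
    case one
    show ?case using hom_one by simp
  next
    case (incl h)
    then show ?case by simp
  next
    case (inv h)
    then show ?case using hom_inv[OF g] by simp
  next
    case (eng h1 h2)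
    then have "\<alpha> (h1 \<otimes>\<^bsub>G\<^esub> h2) = \<alpha> h1 + \<alpha> h2"
      using hom_mult[of h1 h2] gen by simp
    then show ?case using eng by simp
  qed
  then have dvd: "\<alpha> g dvd \<alpha> A" if "A \<in> carrier G" for A
    using that unfolding gen by blast
  have "1 \<in> \<alpha> ` carrier G"
    using \<alpha> by (simp add: iso_def bij_betw_def)
  then obtain A where "A \<in> carrier G" "\<alpha> A = 1" by auto
  with dvd[of A] have "\<alpha> g dvd 1" by simp
  then show ?thesis by (auto simp: zdvd1_eq)
qed

lemma homotopy_group_closed:
  assumes "1 \<le> k" "A \<in> carrier (homotopy_group k X x)" "B \<in> carrier (homotopy_group k X x)"
  shows "A \<otimes>\<^bsub>homotopy_group k X x\<^esub> B \<in> carrier (homotopy_group k X x)"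
  using assms unfolding carrier_homotopy_group
  by (auto simp: mult_homotopy_class cube_concat_in_cube_maps)

text \<open>The degree of an arbitrary representative, chosen because all have the same one.\<close>

definition class_degree :: "((nat \<Rightarrow> real) \<Rightarrow> real^3) set \<Rightarrow> int" where
  "class_degree A = cube_degree (SOME f. f \<in> A)"

lemma class_degree:
  assumes "f \<in> cube_maps 2 S2 y" shows "class_degree (homotopy_class 2 S2 y f) = cube_degree f"
proof -
  define g where "g = (SOME g. g \<in> homotopy_class 2 S2 y f)"
  have "g \<in> homotopy_class 2 S2 y f"
    unfolding g_def by (rule someI[of "\<lambda>g. g \<in> homotopy_class 2 S2 y f", OF homotopy_class_self[OF assms]])
  then have "cube_homotopy 2 S2 (\<lambda>_. y) f g"
    unfolding mem_homotopy_class_iff cube_homotopy_rel_iff by simp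
  then show ?thesis unfolding class_degree_def g_def[symmetric] by (rule cube_degree_homotopy[symmetric])
qed

lemma class_degree_iso:
  assumes y: "norm y = 1"
  shows "class_degree \<in> iso (homotopy_group 2 S2 y) integer_group"
proof -
  have "class_degree \<in> hom (homotopy_group 2 S2 y) integer_group"
  proof (rule homI)
    fix A B assume "A \<in> carrier (homotopy_group 2 S2 y)" "B \<in> carrier (homotopy_group 2 S2 y)"
    then obtain f g where f: "f \<in> cube_maps 2 S2 y" "A = homotopy_class 2 S2 y f"
      and g: "g \<in> cube_maps 2 S2 y" "B = homotopy_class 2 S2 y g"
      unfolding carrier_homotopy_group by blast
    show "class_degree (A \<otimes>\<^bsub>homotopy_group 2 S2 y\<^esub> B) = class_degree A \<otimes>\<^bsub>integer_group\<^esub> class_degree B"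
      using f g cube_concat_in_cube_maps[OF _ f(1) g(1)]
      by (simp add: mult_homotopy_class class_degree cube_degree_concat)
  qed simp
  moreover have "inj_on class_degree (carrier (homotopy_group 2 S2 y))"
  proof (rule inj_onI)
    fix A B assume "A \<in> carrier (homotopy_group 2 S2 y)" "B \<in> carrier (homotopy_group 2 S2 y)"
      and eq: "class_degree A = class_degree B"
    then obtain f g where f: "f \<in> cube_maps 2 S2 y" "A = homotopy_class 2 S2 y f"
      and g: "g \<in> cube_maps 2 S2 y" "B = homotopy_class 2 S2 y g"
      unfolding carrier_homotopy_group by blast
    have "cube_degree f = cube_degree g" using eq f g by (simp add: class_degree)
    then show "A = B"
      unfolding f(2) g(2) by (rule homotopy_class_eqI[OF cube_homotopic_of_equal_degree[OF f(1) g(1)]])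
  qed
  moreover have "d \<in> class_degree ` carrier (homotopy_group 2 S2 y)" for d
  proof -
    obtain f where f: "f \<in> cube_maps 2 S2 y" "cube_degree f = d"
      by (rule cube_degree_realised[OF y])
    then have "class_degree (homotopy_class 2 S2 y f) = d" by (simp add: class_degree)
    then show ?thesis using f(1) unfolding carrier_homotopy_group by blast
  qed
  ultimately show ?thesis by (auto simp: iso_def bij_betw_def)
qed

lemma cube_degree_rotate_map:
  assumes path: "pathin S2 \<gamma>" and f: "f \<in> cube_maps 2 S2 (hopf F)"
    and n: "norm F = 1" "norm G = 1" and \<gamma>: "\<gamma> 0 = hopf F" "\<gamma> 1 = hopf G"
  shows "cube_degree (rotate_map 2 F G f) = cube_degree f"
proof -
  have \<gamma>': "continuous_on {0..1} \<gamma>" "\<And>s. s \<in> {0..1} \<Longrightarrow> norm (\<gamma> s) = 1"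
    using path unfolding pathin_def continuous_map_S2_iff by simp_all
  obtain \<Gamma> where \<Gamma>': "continuous_on {0..1} \<Gamma>" "\<forall>s\<in>{0..1}. norm (\<Gamma> s) = 1"
    "\<forall>s\<in>{0..1}. hopf (\<Gamma> s) = \<gamma> s" "\<Gamma> 0 = F"
    by (rule hopf_path_lift[OF \<gamma>' n(1) \<gamma>(1)[symmetric]])
  note \<Gamma> = \<Gamma>'(1) \<Gamma>'(2,3)[rule_format]
  have "cube_homotopy 2 S2 \<gamma> f (rotate_map 2 (\<Gamma> 0) (\<Gamma> 1) f)"
    by (rule rotation_homotopy[OF \<Gamma>]) (simp_all add: \<gamma>(1) f)
  then have "cube_degree f = cube_degree (rotate_map 2 F (\<Gamma> 1) f)"
    unfolding \<Gamma>'(4) by (rule cube_degree_homotopy)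
  moreover have "(rotate_map 2 F G f, rotate_map 2 F (\<Gamma> 1) f) \<in> cube_homotopy_rel 2 S2 (hopf G)"
    by (rule rotate_map_fibre_independent[OF f n]) (simp_all add: \<Gamma> \<gamma>(2))
  then have "cube_homotopy 2 S2 (\<lambda>_. hopf G) (rotate_map 2 F G f) (rotate_map 2 F (\<Gamma> 1) f)"
    unfolding cube_homotopy_rel_iff by simp
  then have "cube_degree (rotate_map 2 F G f) = cube_degree (rotate_map 2 F (\<Gamma> 1) f)"
    by (rule cube_degree_homotopy)
  ultimately show ?thesis by simp
qed

lemma basepoint_change_class_degree:
  assumes path: "pathin S2 \<gamma>" and A: "A \<in> carrier (homotopy_group 2 S2 (\<gamma> 0))"
  shows "basepoint_change 2 S2 \<gamma> A \<in> carrier (homotopy_group 2 S2 (\<gamma> 1))"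
    and "class_degree (basepoint_change 2 S2 \<gamma> A) = class_degree A"
proof -
  have "norm (\<gamma> 0) = 1" "norm (\<gamma> 1) = 1"
    using path unfolding pathin_def continuous_map_S2_iff by simp_all
  obtain F where F: "norm F = 1" "hopf F = \<gamma> 0" using \<open>norm (\<gamma> 0) = 1\<close> by (rule hopf_surj)
  obtain G where G: "norm G = 1" "hopf G = \<gamma> 1" using \<open>norm (\<gamma> 1) = 1\<close> by (rule hopf_surj)
  obtain f where f: "f \<in> cube_maps 2 S2 (hopf F)" "A = homotopy_class 2 S2 (hopf F) f"
    using A unfolding carrier_homotopy_group F(2) by blast
  have r: "rotate_map 2 F G f \<in> cube_maps 2 S2 (hopf G)" by (rule rotate_map_in_cube_maps[OF F(1) G(1) f(1)])
  have bc: "basepoint_change 2 S2 \<gamma> A = homotopy_class 2 S2 (hopf G) (rotate_map 2 F G f)"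
    unfolding f(2) by (rule basepoint_change_S2[OF _ path f(1) F(1) G(1)]) (simp_all add: F G)
  show "basepoint_change 2 S2 \<gamma> A \<in> carrier (homotopy_group 2 S2 (\<gamma> 1))"
    unfolding bc carrier_homotopy_group G(2)[symmetric] using r by (rule imageI)
  have "class_degree (basepoint_change 2 S2 \<gamma> A) = cube_degree (rotate_map 2 F G f)"
    unfolding bc by (rule class_degree[OF r])
  also have "\<dots> = cube_degree f"
    by (rule cube_degree_rotate_map[OF path f(1) F(1) G(1)]) (simp_all add: F G)
  also have "\<dots> = class_degree A"
    unfolding f(2) by (rule class_degree[OF f(1), symmetric])
  finally show "class_degree (basepoint_change 2 S2 \<gamma> A) = class_degree A" .
qed

lemma S2_orientation_degree:
  assumes "\<epsilon> = 1 \<or> \<epsilon> = - 1" shows "S2_orientation (\<lambda>y A. \<epsilon> * class_degree A)"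
  unfolding S2_orientation_def
proof (intro conjI ballI allI impI)
  fix y assume "y \<in> topspace S2"
  then have cd: "class_degree \<in> iso (homotopy_group 2 S2 y) integer_group"
    by (intro class_degree_iso) simp
  have "(\<lambda>d. \<epsilon> * d) \<in> iso integer_group integer_group"
  proof -
    have "bij_betw (\<lambda>d. \<epsilon> * d) UNIV (UNIV :: int set)"
      by (rule bij_betwI[where g="\<lambda>d. \<epsilon> * d"]) (use assms in auto)
    then show ?thesis by (auto simp: iso_def hom_def distrib_left)
  qed
  from iso_set_trans[OF cd this]
  show "(\<lambda>A. \<epsilon> * class_degree A) \<in> iso (homotopy_group 2 S2 y) integer_group"
    by (simp add: comp_def)
next
  fix \<gamma> A assume "pathin S2 \<gamma>" "A \<in> carrier (homotopy_group 2 S2 (\<gamma> 0))"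
  then show "\<epsilon> * class_degree (basepoint_change 2 S2 \<gamma> A) = \<epsilon> * class_degree A"
    by (simp only: basepoint_change_class_degree(2))
qed

text \<open>At each point an orientation agrees with the degree up to a sign. The signs at two points
  agree, because both the orientation and the degree are invariant under transport along a
  path between them.\<close>

lemma S2_orientation_sign:
  assumes \<phi>: "S2_orientation \<phi>" and yz: "norm y = 1" "norm z = 1"
  obtains \<epsilon> where "\<epsilon> = 1 \<or> \<epsilon> = - 1"
    "\<forall>A\<in>carrier (homotopy_group 2 S2 y). \<phi> y A = \<epsilon> * class_degree A"
    "\<forall>A\<in>carrier (homotopy_group 2 S2 z). \<phi> z A = \<epsilon> * class_degree A"
proof -
  have sign: "\<exists>\<epsilon>. (\<epsilon> = 1 \<or> \<epsilon> = - 1) \<and> (\<forall>A\<in>carrier (homotopy_group 2 S2 y). \<phi> y A = \<epsilon> * class_degree A)"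
    if y: "norm y = 1" for y
  proof -
    have "\<phi> y \<in> iso (homotopy_group 2 S2 y) integer_group"
      using \<phi> y unfolding S2_orientation_def by simp
    then obtain \<epsilon> where "\<epsilon> = 1 \<or> \<epsilon> = - 1" "\<forall>A\<in>carrier (homotopy_group 2 S2 y). \<phi> y A = \<epsilon> * class_degree A"
      using iso_integer_unique_up_to_sign[OF _ class_degree_iso[OF y] homotopy_group_closed] by (metis one_le_numeral)
    then show ?thesis by blast
  qed
  obtain \<epsilon> where \<epsilon>: "\<epsilon> = 1 \<or> \<epsilon> = - 1" "\<forall>A\<in>carrier (homotopy_group 2 S2 y). \<phi> y A = \<epsilon> * class_degree A"
    using sign[OF yz(1)] by blast
  obtain \<delta> where \<delta>: "\<delta> = 1 \<or> \<delta> = - 1" "\<forall>A\<in>carrier (homotopy_group 2 S2 z). \<phi> z A = \<delta> * class_degree A"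
    using sign[OF yz(2)] by blast
  have "path_connected (sphere 0 1 :: (real^3) set)"
    by (rule path_connected_sphere) simp
  then obtain \<gamma> where \<gamma>: "path \<gamma>" "path_image \<gamma> \<subseteq> sphere 0 1" "pathstart \<gamma> = y" "pathfinish \<gamma> = z"
    using yz unfolding path_connected_def by (metis dist_0_norm mem_sphere)
  then have path: "pathin S2 \<gamma>" and ends: "\<gamma> 0 = y" "\<gamma> 1 = z"
    unfolding pathin_def continuous_map_S2_iff path_def path_image_def pathstart_def pathfinish_def by auto
  obtain f where f: "f \<in> cube_maps 2 S2 y" "cube_degree f = 1"
    by (rule cube_degree_realised[OF yz(1)])
  let ?A = "homotopy_class 2 S2 y f"
  have A: "?A \<in> carrier (homotopy_group 2 S2 (\<gamma> 0))" "class_degree ?A = 1"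
    unfolding carrier_homotopy_group ends using f by (simp_all add: class_degree)
  have "\<phi> (\<gamma> 1) (basepoint_change 2 S2 \<gamma> ?A) = \<phi> (\<gamma> 0) ?A"
    using \<phi> path A(1) unfolding S2_orientation_def by blast
  moreover have "\<phi> (\<gamma> 0) ?A = \<epsilon>" using \<epsilon>(2) A unfolding ends by simp
  moreover have "\<phi> (\<gamma> 1) (basepoint_change 2 S2 \<gamma> ?A) = \<delta>"
    using \<delta>(2)[rule_format, OF basepoint_change_class_degree(1)[OF path A(1), unfolded ends]]
    unfolding ends(2) basepoint_change_class_degree(2)[OF path A(1)] A(2) by simp
  ultimately have "\<delta> = \<epsilon>" by simp
  with \<epsilon> \<delta> show thesis by (intro that[of \<epsilon>]) simp_all
qed

section \<open>The configuration space of two points\<close>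

text \<open>The second point in which the line from \<open>v\<close> through \<open>c\<close> meets the unit sphere. It is used to
  contract the sphere minus the point \<open>v\<close>.\<close>

definition chord_end :: "real^3 \<Rightarrow> real^3 \<Rightarrow> real^3" where
  "chord_end v c = v + (2 * (1 - v \<bullet> c) / ((c - v) \<bullet> (c - v))) *\<^sub>R (c - v)"

lemma inner_less_1:
  fixes v a :: "real^3"
  assumes "norm v = 1" "norm a = 1" "a \<noteq> v" shows "v \<bullet> a < 1"
proof -
  have "0 < (norm (a - v))\<^sup>2" using assms(3) by simp
  also have "(norm (a - v))\<^sup>2 = 2 - 2 * (v \<bullet> a)"
    using assms(1,2) unfolding power2_norm_eq_inner
    by (simp add: inner_diff_left inner_diff_right inner_commute norm_eq_1)
  finally show ?thesis by simp
qed

lemma norm_chord_end: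
  assumes v: "norm v = 1" and c: "v \<bullet> c < 1" shows "norm (chord_end v c) = 1" "chord_end v c \<noteq> v"
proof -
  have vv: "v \<bullet> v = 1" using v by (simp add: norm_eq_1)
  have "c \<noteq> v" using c vv by auto
  then have q: "(c - v) \<bullet> (c - v) \<noteq> 0" by simp
  define m where "m = 2 * (1 - v \<bullet> c) / ((c - v) \<bullet> (c - v))"
  have m: "m * ((c - v) \<bullet> (c - v)) = 2 * (1 - v \<bullet> c)" using q by (simp add: m_def)
  have "chord_end v c \<bullet> chord_end v c = v \<bullet> v + 2 * m * (v \<bullet> (c - v)) + m * (m * ((c - v) \<bullet> (c - v)))"
    unfolding chord_end_def m_def[symmetric]
    by (simp only: inner_add_left inner_add_right inner_scaleR_left inner_scaleR_right inner_commute[of "c - v" v])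
       (simp add: distrib_left)
  also have "\<dots> = 1"
    unfolding m by (simp add: inner_diff_right vv algebra_simps)
  finally show "norm (chord_end v c) = 1" by (simp add: norm_eq_1)
  have "m \<noteq> 0" using c q by (simp add: m_def)
  then show "chord_end v c \<noteq> v" using \<open>c \<noteq> v\<close> unfolding chord_end_def m_def[symmetric] by simp
qed

lemma chord_end_sphere:
  assumes v: "norm v = 1" and a: "norm a = 1" "a \<noteq> v" shows "chord_end v a = a"
proof -
  have q: "(a - v) \<bullet> (a - v) = 2 * (1 - v \<bullet> a)"
    using v a(1) by (simp add: inner_diff_left inner_diff_right inner_commute norm_eq_1)
  have "2 * (1 - v \<bullet> a) \<noteq> 0" using inner_less_1[OF v a] by simp
  then show ?thesis unfolding chord_end_def q by simp
qed

lemma continuous_on_chord_end: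
  assumes "continuous_on S v" "continuous_on S c" "\<And>x. x \<in> S \<Longrightarrow> c x \<noteq> v x"
  shows "continuous_on S (\<lambda>x. chord_end (v x) (c x))"
  unfolding chord_end_def by (intro continuous_intros assms(1,2)) (use assms(3) in auto)

text \<open>A fixed-point-free map of the sphere with one prescribed value. Its graph is a section of
  the projection of the configuration space to the first point.\<close>

lemma fixed_point_free_map:
  fixes y z :: "real^3"
  assumes yz: "norm y = 1" "norm z = 1" "z \<noteq> y"
  obtains s where "continuous_on (sphere 0 1) s" "\<forall>v\<in>sphere 0 1. norm (s v) = 1 \<and> s v \<noteq> v" "s y = z"
proof -
  define a where "a = y \<bullet> z"
  define w where "w = z - a *\<^sub>R y"
  have yy: "y \<bullet> y = 1" using yz by (simp add: norm_eq_1)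
  have wy: "w \<bullet> y = 0" by (simp add: w_def a_def inner_diff_left yy inner_commute[of z y])
  have a1: "a < 1" unfolding a_def by (rule inner_less_1[OF yz])
  \<comment> \<open>The tangential part of \<open>V\<close> vanishes only at the unit multiples of \<open>w\<close>. There \<open>\<alpha>\<close> is \<open>a - 2\<close>, hence negative, so that \<open>V\<close> never points outward; at \<open>y\<close> it is \<open>a\<close>. If \<open>w = 0\<close> then the quotient is 0, \<open>z = - y\<close> and \<open>V\<close> is the antipode.\<close>
  define \<alpha> where "\<alpha> v = a - 2 * (w \<bullet> v)\<^sup>2 / (w \<bullet> w)" for v
  define V where "V v = \<alpha> v *\<^sub>R v + (w - (w \<bullet> v) *\<^sub>R v)" for v
  have not_outward: "V v \<noteq> r *\<^sub>R v" if v: "norm v = 1" and r: "0 \<le> r" for v r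
  proof
    assume eq: "V v = r *\<^sub>R v"
    have vv: "v \<bullet> v = 1" using v by (simp add: norm_eq_1)
    have "V v \<bullet> v = \<alpha> v" by (simp add: V_def inner_add_left inner_diff_left vv)
    then have r\<alpha>: "r = \<alpha> v" using eq vv by simp
    then have w: "w = (w \<bullet> v) *\<^sub>R v" using eq by (simp add: V_def)
    have ww: "w \<bullet> w = (w \<bullet> v)\<^sup>2"
      by (subst w) (simp add: vv power2_eq_square)
    show False
    proof (cases "w = 0")
      case True
      then have z: "z = a *\<^sub>R y" by (simp add: w_def)
      then have "\<bar>a\<bar> = 1" using yz by simp
      then have "a = - 1" using a1 by linarith
      moreover have "\<alpha> v = a" using True by (simp add: \<alpha>_def)
      ultimately show False using r r\<alpha> by simp
    next
      case False
      then have "\<alpha> v = a - 2" unfolding \<alpha>_def ww[symmetric] by simp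
      then show False using r r\<alpha> a1 by simp
    qed
  qed
  have nz: "V v \<noteq> 0" if "norm v = 1" for v using not_outward[OF that, of 0] by simp
  define s where "s v = inverse (norm (V v)) *\<^sub>R V v" for v
  have "continuous_on (sphere 0 1) V"
    unfolding V_def \<alpha>_def divide_inverse by (intro continuous_intros)
  then have "continuous_on (sphere 0 1) s"
    unfolding s_def by (intro continuous_intros) (use nz in auto)
  moreover have "norm (s v) = 1 \<and> s v \<noteq> v" if "v \<in> sphere 0 1" for v
  proof
    have v: "norm v = 1" using that by simp
    show "norm (s v) = 1" using nz[OF v] by (simp add: s_def)
    show "s v \<noteq> v"
    proof
      assume "s v = v"
      then have "norm (V v) *\<^sub>R s v = norm (V v) *\<^sub>R v" by simp
      then have "V v = norm (V v) *\<^sub>R v" using nz[OF v] by (simp add: s_def)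
      then show False using not_outward[OF v norm_ge_zero] by blast
    qed
  qed
  moreover have "s y = z"
  proof -
    have "V y = z" by (simp add: V_def \<alpha>_def wy) (simp add: w_def)
    then show ?thesis using yz by (simp add: s_def)
  qed
  ultimately show thesis by (intro that[of s]) simp_all
qed

definition point_pair :: "real^3 \<Rightarrow> real^3 \<Rightarrow> nat \<Rightarrow> real^3" where
  "point_pair a b = restrict (\<lambda>i. if i = 1 then a else b) {1..2}"

lemma point_pair_simps [simp]: "point_pair a b (Suc 0) = a" "point_pair a b 2 = b"
  by (simp_all add: point_pair_def)

lemma interval_1_2: "{1..2::nat} = {1, 2}" "{Suc 0..2} = {Suc 0, 2}" by auto

lemma point_pair_eq:
  assumes "x \<in> extensional {1..2}" shows "point_pair (x 1) (x 2) = x"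
  by (rule extensionalityI[OF _ assms]) (auto simp: point_pair_def interval_1_2)

lemma continuous_map_point_pair:
  assumes ab: "continuous_on S a" "continuous_on S b"
    and n: "\<And>z. z \<in> S \<Longrightarrow> norm (a z) = 1" "\<And>z. z \<in> S \<Longrightarrow> norm (b z) = 1" and ne: "\<And>z. z \<in> S \<Longrightarrow> a z \<noteq> b z"
  shows "continuous_map (top_of_set S) (config_space 2 S2) (\<lambda>z. point_pair (a z) (b z))"
  unfolding config_space_def
proof (rule continuous_map_into_subtopology)
  show "continuous_map (top_of_set S) (power_space 2 S2) (\<lambda>z. point_pair (a z) (b z))"
    unfolding power_space_def continuous_map_componentwise
  proof (intro conjI ballI)
    show "(\<lambda>z. point_pair (a z) (b z)) ` topspace (top_of_set S) \<subseteq> extensional {1..2}"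
      by (auto simp: point_pair_def)
    fix i :: nat assume "i \<in> {1..2}"
    then consider "i = 1" | "i = 2" unfolding interval_1_2 by blast
    then show "continuous_map (top_of_set S) S2 (\<lambda>z. point_pair (a z) (b z) i)"
      unfolding continuous_map_S2_iff by cases (simp_all add: ab n)
  qed
  show "(\<lambda>z. point_pair (a z) (b z)) \<in> topspace (top_of_set S) \<rightarrow> {x. inj_on x {1..2}}"
    using ne by (auto simp: interval_1_2)
qed

text \<open>Maps with the same first coordinate are homotopic: the second coordinates lie in the sphere
  minus one point, which is contracted along segments of the ball projected from that point.\<close>

lemma pair_maps_homotopic:
  assumes f: "f \<in> cube_maps k (config_space 2 S2) x" and g: "g \<in> cube_maps k (config_space 2 S2) x"
    and eq: "coordinate_map k 1 f = coordinate_map k 1 g"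
  shows "(f, g) \<in> cube_homotopy_rel k (config_space 2 S2) x"
proof -
  let ?C = "topspace (cube k)"
  have f1: "coordinate_map k 1 f \<in> cube_maps k S2 (x 1)" and f2: "coordinate_map k 2 f \<in> cube_maps k S2 (x 2)"
    and g2: "coordinate_map k 2 g \<in> cube_maps k S2 (x 2)"
    by (intro coordinate_map_in_cube_maps[OF f] coordinate_map_in_cube_maps[OF g]; simp)+
  define p where "p = coordinate_map k 1 f"
  define a where "a = coordinate_map k 2 f"
  define b where "b = coordinate_map k 2 g"
  have cont: "continuous_on ?C p" "continuous_on ?C a" "continuous_on ?C b"
    using f1 f2 g2 unfolding cube_maps_S2_iff p_def a_def b_def by blast+
  have n: "norm (p t) = 1" "norm (a t) = 1" "norm (b t) = 1" if "t \<in> ?C" for t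
    using f1 f2 g2 that unfolding cube_maps_S2_iff p_def a_def b_def by blast+
  have ne: "a t \<noteq> p t" "b t \<noteq> p t" if "t \<in> ?C" for t
    using coordinate_maps_disjoint[OF f that, of 2 1] coordinate_maps_disjoint[OF g that, of 2 1]
    unfolding p_def a_def b_def eq by simp_all
  have ext: "f t \<in> extensional {1..2}" "g t \<in> extensional {1..2}" if "t \<in> ?C" for t
    using continuous_map_image_subset_topspace[OF cube_mapsD(1)[OF f]]
      continuous_map_image_subset_topspace[OF cube_mapsD(1)[OF g]] that config_space_point(3) by blast+
  have fp: "f t = point_pair (p t) (a t)" if "t \<in> ?C" for t
    using point_pair_eq[OF ext(1)[OF that]] that by (simp add: p_def a_def coordinate_map_def)
  have gp: "g t = point_pair (p t) (b t)" if "t \<in> ?C" for t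
    using point_pair_eq[OF ext(2)[OF that]] that unfolding p_def eq by (simp add: b_def coordinate_map_def)
  define L where "L z = (1 - fst z) *\<^sub>R a (snd z) + fst z *\<^sub>R b (snd z)" for z :: "real \<times> (nat \<Rightarrow> real)"
  have L1: "p t \<bullet> L (s, t) < 1" if s: "s \<in> {0..1}" and t: "t \<in> ?C" for s t
  proof -
    have "p t \<bullet> L (s, t) = (1 - s) * (p t \<bullet> a t) + s * (p t \<bullet> b t)"
      by (simp add: L_def inner_add_right)
    also have "\<dots> < 1"
      using s inner_less_1[OF n(1,2)[OF t] ne(1)[OF t]] inner_less_1[OF n(1,3)[OF t] ne(2)[OF t]]
      by (intro convex_bound_lt) auto
    finally show ?thesis .
  qed
  have L_ne: "L (s, t) \<noteq> p t" if "s \<in> {0..1}" "t \<in> ?C" for s t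
    using L1[OF that] n(1)[OF that(2)] by (auto simp: norm_eq_1)
  define h where "h z = point_pair (p (snd z)) (chord_end (p (snd z)) (L z))" for z :: "real \<times> (nat \<Rightarrow> real)"
  have cp: "continuous_on ({0..1::real} \<times> ?C) (\<lambda>z. p (snd z))"
    by (intro continuous_on_compose2[OF cont(1)] continuous_intros) auto
  have cL: "continuous_on ({0..1} \<times> ?C) L"
    unfolding L_def
    by (intro continuous_intros continuous_on_compose2[OF cont(2)] continuous_on_compose2[OF cont(3)]) auto
  have cont_h: "continuous_map (top_of_set ({0..1} \<times> ?C)) (config_space 2 S2) h"
    unfolding h_def
  proof (rule continuous_map_point_pair)
    show "continuous_on ({0..1} \<times> ?C) (\<lambda>z. chord_end (p (snd z)) (L z))"
      by (rule continuous_on_chord_end[OF cp cL]) (use L_ne in auto)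
    fix z :: "real \<times> (nat \<Rightarrow> real)" assume "z \<in> {0..1} \<times> ?C"
    then obtain s t where z: "z = (s, t)" "s \<in> {0..1}" "t \<in> ?C" by blast
    show "norm (p (snd z)) = 1" using n(1)[OF z(3)] z(1) by simp
    show "norm (chord_end (p (snd z)) (L z)) = 1" "p (snd z) \<noteq> chord_end (p (snd z)) (L z)"
      using norm_chord_end[OF n(1)[OF z(3)] L1[OF z(2,3)]] z(1) by auto
  qed (rule cp)
  have ends: "h (0, t) = f t \<and> h (1, t) = g t" if t: "t \<in> ?C" for t
    unfolding h_def L_def fp[OF t] gp[OF t] fst_conv snd_conv
    using chord_end_sphere[OF n(1)[OF t] n(2)[OF t] ne(1)[OF t]]
      chord_end_sphere[OF n(1)[OF t] n(3)[OF t] ne(2)[OF t]] by simp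
  have bdry: "h (s, t) = x" if "s \<in> {0..1}" "t \<in> cube_boundary k" for s t
  proof -
    have t: "t \<in> ?C" using that(2) cube_boundary_subset by blast
    have "a t = x 2" "b t = x 2"
      using cube_mapsD(3)[OF f2 that(2)] cube_mapsD(3)[OF g2 that(2)] by (simp_all add: a_def b_def)
    then have "L (s, t) = a t" by (simp add: L_def flip: scaleR_add_left)
    then have "h (s, t) = f t"
      unfolding h_def fp[OF t] snd_conv using chord_end_sphere[OF n(1)[OF t] n(2)[OF t] ne(1)[OF t]] by simp
    then show ?thesis using cube_mapsD(3)[OF f that(2)] by simp
  qed
  have "cube_homotopy k (config_space 2 S2) (\<lambda>_. x) f g"
    unfolding cube_homotopy_def prod_cube_eq_top_of_set
    by (intro exI[of _ h] conjI ballI cont_h ends bdry)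
  then show ?thesis using f g by (simp add: cube_homotopy_rel_iff)
qed

lemma config_section:
  assumes x: "x \<in> topspace (config_space 2 S2)"
  obtains \<sigma> where "continuous_map S2 (config_space 2 S2) \<sigma>" "\<sigma> (x 1) = x" "\<forall>v. \<sigma> v 1 = v"
proof -
  have n: "norm (x 1) = 1" "norm (x 2) = 1" using config_space_point(1)[OF x] by simp_all
  have "x 2 \<noteq> x 1" using inj_onD[OF config_space_point(2)[OF x], of 2 1] by auto
  then obtain s where s: "continuous_on (sphere 0 1) s" "\<forall>v\<in>sphere 0 1. norm (s v) = 1 \<and> s v \<noteq> v" "s (x 1) = x 2"
    by (rule fixed_point_free_map[OF n])
  show thesis
  proof (rule that[of "\<lambda>v. point_pair v (s v)"])
    show "continuous_map S2 (config_space 2 S2) (\<lambda>v. point_pair v (s v))"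
    proof (rule continuous_map_point_pair[OF continuous_on_id s(1)])
      show "v \<noteq> s v" "norm (s v) = 1" "norm v = 1" if "v \<in> sphere 0 1" for v
        using bspec[OF s(2) that] that by auto
    qed
    show "point_pair (x 1) (s (x 1)) = x"
      unfolding s(3) by (rule point_pair_eq[OF config_space_point(3)[OF x]])
  qed simp
qed

text \<open>The first projection of the configuration space of two points is a homotopy equivalence, so
  the degree of the first coordinate identifies its second homotopy group with the integers.\<close>

definition pair_degree :: "(nat \<Rightarrow> real^3) \<Rightarrow> ((nat \<Rightarrow> real) \<Rightarrow> nat \<Rightarrow> real^3) set \<Rightarrow> int" where
  "pair_degree x A = class_degree (homotopy_induced 2 S2 (\<lambda>y. y 1) x A)"

lemma pair_degree_class:
  assumes "f \<in> cube_maps 2 (config_space 2 S2) x"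
  shows "pair_degree x (homotopy_class 2 (config_space 2 S2) x f) = cube_degree (coordinate_map 2 1 f)"
proof -
  have 1: "1 \<in> {1..2::nat}" by simp
  show ?thesis
    unfolding pair_degree_def homotopy_induced_coordinate[OF assms 1]
    by (rule class_degree[OF coordinate_map_in_cube_maps[OF assms 1]])
qed

lemma pair_degree_iso:
  assumes x: "x \<in> topspace (config_space 2 S2)"
  shows "pair_degree x \<in> iso (homotopy_group 2 (config_space 2 S2) x) integer_group"
proof -
  let ?G = "homotopy_group 2 (config_space 2 S2) x"
  have 1: "1 \<in> {1..2::nat}" by simp
  have n: "norm (x 1) = 1" using config_space_point(1)[OF x] by simp
  have cd: "class_degree \<in> hom (homotopy_group 2 S2 (x 1)) integer_group"
    using class_degree_iso[OF n] by (simp add: iso_def)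
  obtain \<sigma> where \<sigma>: "continuous_map S2 (config_space 2 S2) \<sigma>" "\<sigma> (x 1) = x" "\<forall>v. \<sigma> v 1 = v"
    by (rule config_section[OF x])
  have "homotopy_induced 2 S2 (\<lambda>y. y 1) x \<in> hom ?G (homotopy_group 2 S2 (x 1))"
    by (rule homotopy_induced_hom[OF _ continuous_map_config_projection[OF 1]]) simp
  from hom_compose[OF this cd] have hom: "pair_degree x \<in> hom ?G integer_group"
    unfolding pair_degree_def[abs_def] comp_def .
  have lift: "restrict (\<sigma> \<circ> u) (topspace (cube 2)) \<in> cube_maps 2 (config_space 2 S2) x"
    "coordinate_map 2 1 (restrict (\<sigma> \<circ> u) (topspace (cube 2))) = u"
    if u: "u \<in> cube_maps 2 S2 (x 1)" for u
  proof -
    show "restrict (\<sigma> \<circ> u) (topspace (cube 2)) \<in> cube_maps 2 (config_space 2 S2) x"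
      using compose_in_cube_maps[OF \<sigma>(1) u] unfolding \<sigma>(2) .
    show "coordinate_map 2 1 (restrict (\<sigma> \<circ> u) (topspace (cube 2))) = u"
      unfolding coordinate_map_def
      by (rule extensionalityI[OF restrict_extensional cube_mapsD(2)[OF u]]) (simp add: \<sigma>(3)[rule_format, unfolded One_nat_def])
  qed
  have "inj_on (pair_degree x) (carrier ?G)"
  proof (rule inj_onI)
    fix A B assume "A \<in> carrier ?G" "B \<in> carrier ?G" and eq: "pair_degree x A = pair_degree x B"
    then obtain f g where f: "f \<in> cube_maps 2 (config_space 2 S2) x" "A = homotopy_class 2 (config_space 2 S2) x f"
      and g: "g \<in> cube_maps 2 (config_space 2 S2) x" "B = homotopy_class 2 (config_space 2 S2) x g"
      unfolding carrier_homotopy_group by blast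
    define u where "u = coordinate_map 2 1 f"
    define v where "v = coordinate_map 2 1 g"
    have u: "u \<in> cube_maps 2 S2 (x 1)" and v: "v \<in> cube_maps 2 S2 (x 1)"
      unfolding u_def v_def by (intro coordinate_map_in_cube_maps[OF f(1) 1] coordinate_map_in_cube_maps[OF g(1) 1])+
    have "cube_degree u = cube_degree v"
      using eq unfolding f(2) g(2) pair_degree_class[OF f(1)] pair_degree_class[OF g(1)] u_def v_def .
    then have "(u, v) \<in> cube_homotopy_rel 2 S2 (x 1)"
      by (rule cube_homotopic_of_equal_degree[OF u v])
    then have "cube_homotopy 2 S2 (\<lambda>_. x 1) u v" unfolding cube_homotopy_rel_iff by simp
    from cube_homotopy_compose[OF \<sigma>(1) this]
    have uv: "(restrict (\<sigma> \<circ> u) (topspace (cube 2)), restrict (\<sigma> \<circ> v) (topspace (cube 2)))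
        \<in> cube_homotopy_rel 2 (config_space 2 S2) x"
      unfolding cube_homotopy_rel_iff comp_def[of \<sigma> "\<lambda>_. x 1"] \<sigma>(2) using lift(1)[OF u] lift(1)[OF v] by blast
    have fu: "(f, restrict (\<sigma> \<circ> u) (topspace (cube 2))) \<in> cube_homotopy_rel 2 (config_space 2 S2) x"
      by (rule pair_maps_homotopic[OF f(1) lift(1)[OF u]]) (subst lift(2)[OF u], rule u_def[symmetric])
    have gv: "(g, restrict (\<sigma> \<circ> v) (topspace (cube 2))) \<in> cube_homotopy_rel 2 (config_space 2 S2) x"
      by (rule pair_maps_homotopic[OF g(1) lift(1)[OF v]]) (subst lift(2)[OF v], rule v_def[symmetric])
    have "(f, g) \<in> cube_homotopy_rel 2 (config_space 2 S2) x"
      by (rule cube_homotopy_rel_trans[OF fu cube_homotopy_rel_trans[OF uv cube_homotopy_rel_sym[OF gv]]])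
    then show "A = B" unfolding f(2) g(2) by (rule homotopy_class_eqI)
  qed
  moreover have "d \<in> pair_degree x ` carrier ?G" for d
  proof -
    obtain u where u: "u \<in> cube_maps 2 S2 (x 1)" "cube_degree u = d" by (rule cube_degree_realised[OF n])
    have "pair_degree x (homotopy_class 2 (config_space 2 S2) x (restrict (\<sigma> \<circ> u) (topspace (cube 2)))) = d"
      unfolding pair_degree_class[OF lift(1)[OF u(1)]] lift(2)[OF u(1)] by (rule u(2))
    then show ?thesis using lift(1)[OF u(1)] unfolding carrier_homotopy_group by blast
  qed
  ultimately show ?thesis using hom by (auto simp: iso_def bij_betw_def)
qed

lemma group_homotopy_group_pairs:
  assumes x: "x \<in> topspace (config_space 2 S2)"
  shows "group (homotopy_group 2 (config_space 2 S2) x)"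
proof (rule group_of_iso_integer[OF pair_degree_iso[OF x]])
  let ?G = "homotopy_group 2 (config_space 2 S2) x"
  show "A \<otimes>\<^bsub>?G\<^esub> B \<in> carrier ?G" if "A \<in> carrier ?G" "B \<in> carrier ?G" for A B
    by (rule homotopy_group_closed[OF _ that]) simp
  define e where "e = restrict (\<lambda>_. x) (topspace (cube 2))"
  have "continuous_map (cube 2) (config_space 2 S2) (\<lambda>_. x)" using x by simp
  then have "continuous_map (cube 2) (config_space 2 S2) e"
    unfolding e_def by (rule continuous_map_eq) simp
  then have e: "e \<in> cube_maps 2 (config_space 2 S2) x"
    unfolding cube_maps_def using subsetD[OF cube_boundary_subset] by (simp add: e_def)
  have one: "\<one>\<^bsub>?G\<^esub> = homotopy_class 2 (config_space 2 S2) x e"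
    by (simp add: homotopy_group_def homotopy_class_def e_def)
  then show one_closed: "\<one>\<^bsub>?G\<^esub> \<in> carrier ?G"
    unfolding carrier_homotopy_group using e by blast
  \<comment> \<open>The constant map is idempotent, so its degree is 0.\<close>
  have "cube_concat 2 e e = e"
  proof (rule extensionalityI[of _ "topspace (cube 2)"])
    show "cube_concat 2 e e \<in> extensional (topspace (cube 2))"
      unfolding cube_concat_def by (rule restrict_extensional)
    show "e \<in> extensional (topspace (cube 2))" unfolding e_def by (rule restrict_extensional)
    fix t assume t: "t \<in> topspace (cube 2)"
    then have "t 0 \<le> 1/2 \<Longrightarrow> t(0 := 2 * t 0) \<in> topspace (cube 2)"
      "\<not> t 0 \<le> 1/2 \<Longrightarrow> t(0 := 2 * t 0 - 1) \<in> topspace (cube 2)"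
      using cube_coordinate[OF t, of 0] cube_upd[OF t, of 0] by simp_all
    then show "cube_concat 2 e e t = e t" using t by (simp add: cube_concat_def e_def)
  qed
  then have "\<one>\<^bsub>?G\<^esub> \<otimes>\<^bsub>?G\<^esub> \<one>\<^bsub>?G\<^esub> = \<one>\<^bsub>?G\<^esub>"
    unfolding one by (subst mult_homotopy_class[OF _ e e]) simp_all
  moreover have "pair_degree x (\<one>\<^bsub>?G\<^esub> \<otimes>\<^bsub>?G\<^esub> \<one>\<^bsub>?G\<^esub>) = pair_degree x \<one>\<^bsub>?G\<^esub> + pair_degree x \<one>\<^bsub>?G\<^esub>"
    using pair_degree_iso[OF x] one_closed by (simp add: iso_def hom_def)
  ultimately show "pair_degree x \<one>\<^bsub>?G\<^esub> = 0" by simp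
qed

text \<open>The first coordinate is freely homotopic to the antipode of the second, and the antipode has
  degree \<open>-1\<close>.\<close>

lemma coordinate_degrees_opposite:
  assumes x: "x \<in> topspace (config_space 2 S2)" and f: "f \<in> cube_maps 2 (config_space 2 S2) x"
  shows "cube_degree (coordinate_map 2 2 f) = - cube_degree (coordinate_map 2 1 f)"
proof -
  have i: "1 \<in> {1..2::nat}" "2 \<in> {1..2::nat}" by simp_all
  note f12 = coordinate_map_in_cube_maps[OF f i(1)] coordinate_map_in_cube_maps[OF f i(2)]
  obtain \<gamma> where "cube_homotopy 2 S2 \<gamma> (coordinate_map 2 1 f)
      (restrict (uminus \<circ> coordinate_map 2 2 f) (topspace (cube 2)))"
    by (rule antipodal_homotopy_of_disjoint[OF f12 config_space_point(1)[OF x i(1)] config_space_point(1)[OF x i(2)]])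
       (rule coordinate_maps_disjoint[OF f _ i], assumption, simp)
  from cube_degree_homotopy[OF this] show ?thesis
    unfolding cube_degree_antipode[OF f12(2)] by simp
qed

lemma pi2_coords_incl_induced:
  assumes x: "x \<in> topspace (config_space 2 S2)" and f: "f \<in> cube_maps 2 (config_space 2 S2) x"
  shows "pi2_coords \<phi> x (incl_induced 2 2 x (homotopy_class 2 (config_space 2 S2) x f)) =
    (\<phi> (x 1) (homotopy_class 2 S2 (x 1) (coordinate_map 2 1 f)),
     \<phi> (x 2) (homotopy_class 2 S2 (x 2) (coordinate_map 2 2 f)))"
proof -
  let ?f = "restrict ((\<lambda>y. y) \<circ> f) (topspace (cube 2))"
  have f': "?f \<in> cube_maps 2 (power_space 2 S2) x"
    by (rule compose_in_cube_maps[OF continuous_map_config_inclusion f])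
  have incl: "incl_induced 2 2 x (homotopy_class 2 (config_space 2 S2) x f) = homotopy_class 2 (power_space 2 S2) x ?f"
    unfolding incl_induced_def by (rule homotopy_induced_class[OF continuous_map_config_inclusion f])
  have "homotopy_induced 2 S2 (\<lambda>y. y i) x (homotopy_class 2 (power_space 2 S2) x ?f) =
      homotopy_class 2 S2 (x i) (coordinate_map 2 i f)" if "i \<in> {1..2}" for i
  proof -
    have "restrict ((\<lambda>y. y i) \<circ> ?f) (topspace (cube 2)) = coordinate_map 2 i f"
      unfolding coordinate_map_def by (rule restrict_ext) simp
    then show ?thesis
      using homotopy_induced_class[OF continuous_map_power_projection[OF that] f'] by simp
  qed
  from this[of 1] this[of 2] show ?thesis
    unfolding pi2_coords_def incl by simp
qed

text \<open>A generator has coordinates of degrees \<open>d\<close> and \<open>-d\<close> with \<open>d\<close> equal to 1 or \<open>-1\<close>, and an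
  orientation is a sign times the degree, at both points the same sign. Both signs occur.\<close>

lemma antidiagonal_incl_induced:
  assumes x: "x \<in> topspace (config_space 2 S2)"
    and g: "g \<in> carrier (homotopy_group 2 (config_space 2 S2) x)"
    and gen: "generate (homotopy_group 2 (config_space 2 S2) x) {g} = carrier (homotopy_group 2 (config_space 2 S2) x)"
  shows "{pi2_coords \<phi> x (incl_induced 2 2 x g) | \<phi>. S2_orientation \<phi>} = {(1, -1), (-1, 1)}"
proof -
  have i: "1 \<in> {1..2::nat}" "2 \<in> {1..2::nat}" by simp_all
  obtain f where f: "f \<in> cube_maps 2 (config_space 2 S2) x" "g = homotopy_class 2 (config_space 2 S2) x f"
    using g unfolding carrier_homotopy_group by blast
  define d where "d = cube_degree (coordinate_map 2 1 f)"
  have d: "d = 1 \<or> d = - 1"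
    using generator_of_iso_integer[OF group_homotopy_group_pairs[OF x] pair_degree_iso[OF x] g gen]
    unfolding f(2) pair_degree_class[OF f(1)] d_def .
  define A where "A = homotopy_class 2 S2 (x 1) (coordinate_map 2 1 f)"
  define B where "B = homotopy_class 2 S2 (x 2) (coordinate_map 2 2 f)"
  note f12 = coordinate_map_in_cube_maps[OF f(1) i(1)] coordinate_map_in_cube_maps[OF f(1) i(2)]
  have A: "A \<in> carrier (homotopy_group 2 S2 (x 1))" "class_degree A = d"
    unfolding A_def carrier_homotopy_group d_def using f12(1) by (simp_all add: class_degree)
  have B: "B \<in> carrier (homotopy_group 2 S2 (x 2))" "class_degree B = - d"
    unfolding B_def carrier_homotopy_group d_def using f12(2) coordinate_degrees_opposite[OF x f(1)]
    by (simp_all add: class_degree)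
  have coords: "pi2_coords \<phi> x (incl_induced 2 2 x g) = (\<phi> (x 1) A, \<phi> (x 2) B)" for \<phi>
    unfolding f(2) A_def B_def by (rule pi2_coords_incl_induced[OF x f(1)])
  have sub: "(\<phi> (x 1) A, \<phi> (x 2) B) \<in> {(1, -1), (-1, 1)}" if \<phi>: "S2_orientation \<phi>" for \<phi>
  proof -
    obtain \<epsilon> where \<epsilon>: "\<epsilon> = 1 \<or> \<epsilon> = - 1"
      "\<forall>A\<in>carrier (homotopy_group 2 S2 (x 1)). \<phi> (x 1) A = \<epsilon> * class_degree A"
      "\<forall>A\<in>carrier (homotopy_group 2 S2 (x 2)). \<phi> (x 2) A = \<epsilon> * class_degree A"
      by (rule S2_orientation_sign[OF \<phi> config_space_point(1)[OF x i(1)] config_space_point(1)[OF x i(2)]])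
    then have "\<phi> (x 1) A = \<epsilon> * d" "\<phi> (x 2) B = - (\<epsilon> * d)" using A B by simp_all
    then show ?thesis using \<epsilon>(1) d by auto
  qed
  show ?thesis
    unfolding coords
  proof (intro equalityI subsetI)
    fix c assume "c \<in> {(\<phi> (x 1) A, \<phi> (x 2) B) | \<phi>. S2_orientation \<phi>}"
    then obtain \<phi> where "S2_orientation \<phi>" "c = (\<phi> (x 1) A, \<phi> (x 2) B)" by (elim CollectE exE conjE)
    then show "c \<in> {(1, -1), (-1, 1)}" by (simp only: sub)
  next
    fix c :: "int \<times> int" assume c: "c \<in> {(1, -1), (-1, 1)}"
    \<comment> \<open>The sign for which \<open>\<epsilon> * d\<close> is the first entry of \<open>c\<close>.\<close>
    define \<epsilon> where "\<epsilon> = fst c * d"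
    have \<epsilon>: "\<epsilon> = 1 \<or> \<epsilon> = - 1" and "c = (\<epsilon> * d, \<epsilon> * - d)"
      using c d by (auto simp: \<epsilon>_def)
    then have "c = (\<epsilon> * class_degree A, \<epsilon> * class_degree B)" unfolding A(2) B(2) by simp
    then show "c \<in> {(\<phi> (x 1) A, \<phi> (x 2) B) | \<phi>. S2_orientation \<phi>}"
      by (intro CollectI exI[of _ "\<lambda>y A. \<epsilon> * class_degree A"] conjI S2_orientation_degree[OF \<epsilon>])
  qed
qed

theorem proposition9:
  fixes n k :: nat
  assumes "n \<ge> 2" and "k \<ge> 2"
  shows
    "(n = 2 \<and> k = 2 \<longrightarrow>
       (\<forall>x\<in>topspace (config_space n S2).
          homotopy_group k (config_space n S2) x \<cong> integer_group \<and>
          incl_induced n k x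
            \<in> hom (homotopy_group k (config_space n S2) x) (homotopy_group k (power_space n S2) x) \<and>
          (\<forall>g\<in>carrier (homotopy_group k (config_space n S2) x).
             generate (homotopy_group k (config_space n S2) x) {g}
               = carrier (homotopy_group k (config_space n S2) x) \<longrightarrow>
             {pi2_coords \<phi> x (incl_induced n k x g) | \<phi>. S2_orientation \<phi>} = {(1, -1), (-1, 1)})))
     \<and>
     (n \<ge> 2 \<and> k \<ge> 3 \<longrightarrow>
       (\<forall>x\<in>topspace (config_space n S2).
          incl_induced n k x
            \<in> hom (homotopy_group k (config_space n S2) x) (homotopy_group k (power_space n S2) x) \<and>
          diagonal_incl_induced n k x))"
proof (intro conjI impI ballI)
  fix x assume "n = 2 \<and> k = 2" and xn: "x \<in> topspace (config_space n S2)"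
  then have nk: "n = 2" "k = 2" by simp_all
  have x: "x \<in> topspace (config_space 2 S2)" using xn unfolding nk .
  show "homotopy_group k (config_space n S2) x \<cong> integer_group"
    unfolding nk by (rule is_isoI[OF pair_degree_iso[OF x]])
  show "incl_induced n k x \<in> hom (homotopy_group k (config_space n S2) x) (homotopy_group k (power_space n S2) x)"
    by (rule incl_induced_hom) (use assms(2) in simp)
  fix g assume g: "g \<in> carrier (homotopy_group k (config_space n S2) x)"
    "generate (homotopy_group k (config_space n S2) x) {g} = carrier (homotopy_group k (config_space n S2) x)"
  show "{pi2_coords \<phi> x (incl_induced n k x g) | \<phi>. S2_orientation \<phi>} = {(1, -1), (-1, 1)}"
    unfolding nk by (rule antidiagonal_incl_induced[OF x g[unfolded nk]])
next
  fix x assume nk: "n \<ge> 2 \<and> k \<ge> 3" and x: "x \<in> topspace (config_space n S2)"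
  show "incl_induced n k x \<in> hom (homotopy_group k (config_space n S2) x) (homotopy_group k (power_space n S2) x)"
    by (rule incl_induced_hom) (use assms(2) in simp)
  show "diagonal_incl_induced n k x"
    by (rule diagonal_incl_induced_higher[OF conjunct2[OF nk] x])
qed

end
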